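(* Let $p$ be a prime, $n\ge1$ an integer and $s>-1$ a real number. (a) For any block matrix $\begin{pmatrix}a&b\\c&d\end{pmatrix}\in\mathrm{GL}(2n,\mathbb{O}_p)$ (blocks of size $n\times n$), $$d\mu_s^n\left((a+zc)^{-1}(b+zd)\right)=|\det(a+zc)|^{s}\,d\mu_s^n(z).$$ (b) The measure $\mu_s^n$ is the unique probability Borel measure $\nu$ on $\mathrm{Mat}(n,\mathbb{Q}_p)$ satisfying $$d\nu\left((a+zc)^{-1}(b+zd)\right)=|\det(a+zc)|^{s}\,d\nu(z)$$ for all $\begin{pmatrix}a&b\\c&d\end{pmatrix}\in\mathrm{GL}(2n,\mathbb{O}_p)$.
   Context: $\mathbb{Q}_p$ is the field of $p$-adic numbers with its norm $|\cdot|$ (so $|p|=p^{-1}$), $\mathbb{O}_p$ the ring of $p$-adic integers. $\mathrm{Mat}(n,\mathbb{Q}_p)$ is the space of $n\times n$ matrices over $\mathbb{Q}_p$, and $\mathrm{vol}$ is the translation-invariant (Haar) measure on it normalized by $\mathrm{vol}(\mathrm{Mat}(n,\mathbb{O}_p))=1$. $\mathrm{GL}(m,\mathbb{O}_p)$ is the group of $m\times m$ matrices over $\mathbb{O}_p$ invertible over $\mathbb{O}_p$. Any $z\in\mathrm{Mat}(n,\mathbb{Q}_p)$ can be written as $z=A\,\mathrm{diag}(p^{-k_1},\dots,p^{-k_n})\,B$ with $A,B\in\mathrm{GL}(n,\mathbb{O}_p)$ and $k_1\ge\dots\ge k_n\ge-\infty$ ($k_j$ integers or $-\infty$, with the entry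 $p^{-k_j}$ equal to $0$ if $k_j=-\infty$); the $k_j$ are determined by $z$. Define $\gamma(z)=\prod_{j:\,k_j>0}p^{k_j}$ (empty product equal to $1$). For $s>-1$, $\mu_s^n$ is the probability measure on $\mathrm{Mat}(n,\mathbb{Q}_p)$ given by $d\mu_s^n(z)=c(n,s+2n)^{-1}\gamma(z)^{-s-2n}\,d\mathrm{vol}(z)$, where $c(n,\alpha)=\int_{\mathrm{Mat}(n,\mathbb{Q}_p)}\gamma(z)^{-\alpha}\,d\mathrm{vol}(z)=\prod_{j=1}^n\frac{1-p^{-\alpha+n-j}}{1-p^{-\alpha+n+j-1}}$. For $g=\begin{pmatrix}a&b\\c&d\end{pmatrix}$ the linear-fractional transformation $z\mapsto z*g:=(a+zc)^{-1}(b+zd)$ is defined on $\{z:\det(a+zc)\ne0\}$, whose complement has zero $\mathrm{vol}$-measure. The notation $d\nu(z*g)=h(z)\,d\nu(z)$ means that $\nu(\{z*g: z\in B\})=\int_B h(z)\,d\nu(z)$ for every Borel set $B\subset\{z:\det(a+zc)\neq0\}$. *)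

theory Defs
  imports "HOL-Probability.Probability_Measure"
begin

section \<open>The field of p-adic numbers\<close>

text \<open>The prime p is represented by a type parameter whose cardinality is p. Every prime is
  the cardinality of such a type, so a statement about an arbitrary type of this class is a
  statement about all primes.\<close>

class prime_type = finite +
  assumes prime_CARD: "prime CARD('a)"

definition padic_abs :: "nat \<Rightarrow> rat \<Rightarrow> real" where
  "padic_abs p x =
     (if x = 0 then 0
      else real p powi (int (multiplicity (int p) (snd (quotient_of x)))
                      - int (multiplicity (int p) (fst (quotient_of x)))))"

definition padic_cauchy :: "nat \<Rightarrow> (nat \<Rightarrow> rat) \<Rightarrow> bool" where
  "padic_cauchy p X \<longleftrightarrow> (\<forall>e>0. \<exists>N. \<forall>m\<ge>N. \<forall>n\<ge>N. padic_abs p (X m - X n) < e)"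

definition padic_null :: "nat \<Rightarrow> (nat \<Rightarrow> rat) \<Rightarrow> bool" where
  "padic_null p X \<longleftrightarrow> (\<lambda>n. padic_abs p (X n)) \<longlonglongrightarrow> 0"

definition padicrel :: "nat \<Rightarrow> (nat \<Rightarrow> rat) \<Rightarrow> (nat \<Rightarrow> rat) \<Rightarrow> bool" where
  "padicrel p X Y \<longleftrightarrow> padic_cauchy p X \<and> padic_cauchy p Y \<and> padic_null p (\<lambda>n. X n - Y n)"

lemma padic_abs_0 [simp]: "padic_abs p 0 = 0"
  by (simp add: padic_abs_def)

lemma padic_abs_nonneg [simp]: "0 \<le> padic_abs p x"
  by (simp add: padic_abs_def)

lemma multiplicity_minus_int: "multiplicity p (- x) = multiplicity p (x::int)"
  by (simp add: multiplicity_def)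

lemma padic_abs_minus [simp]: "padic_abs p (- x) = padic_abs p x"
  by (cases "x = 0") (auto simp: padic_abs_def rat_uminus_code Let_def multiplicity_minus_int split: prod.splits)

lemma padic_abs_minus_commute: "padic_abs p (x - y) = padic_abs p (y - x)"
  by (metis minus_diff_eq padic_abs_minus)

lemma padic_cauchy_const [simp]: "padic_cauchy p (\<lambda>n. c)"
  by (simp add: padic_cauchy_def)

context
  fixes p :: nat
  assumes p: "prime p"
begin

lemma padic_abs_divide_int:
  assumes "a \<noteq> 0" "b \<noteq> 0"
  shows "padic_abs p (of_int a / of_int b) =
    real p powi (int (multiplicity (int p) b) - int (multiplicity (int p) a))"
proof -
  have pe: "prime_elem (int p)" using p by simp
  obtain c d where q: "quotient_of (of_int a / of_int b) = (c, d)" by (cases "quotient_of (of_int a / of_int b)")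
  have d: "d > 0" using q quotient_of_denom_pos by blast
  have eq: "(of_int a / of_int b :: rat) = of_int c / of_int d" using q by (rule quotient_of_div)
  then have "(of_int (a * d) :: rat) = of_int (c * b)" using assms d by (simp add: field_simps)
  then have e: "a * d = c * b" by (simp only: of_int_eq_iff)
  then have c: "c \<noteq> 0" using assms d by auto
  have "multiplicity (int p) a + multiplicity (int p) d = multiplicity (int p) c + multiplicity (int p) b"
    using arg_cong[OF e, of "multiplicity (int p)"] assms c d pe
    by (simp add: prime_elem_multiplicity_mult_distrib)
  then show ?thesis using assms by (auto simp: padic_abs_def q intro!: arg_cong[where f="power_int _"])
qed

lemma rat_common_denom:
  fixes x y :: rat
  obtains a b d :: int where "d \<noteq> 0" "x = of_int a / of_int d" "y = of_int b / of_int d"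
proof -
  have *: "\<exists>a d. r = of_int a / of_int d \<and> d \<noteq> 0" for r :: rat
    using quotient_of_div[of r "fst (quotient_of r)" "snd (quotient_of r)"] quotient_of_denom_pos'[of r]
    by (intro exI[of _ "fst (quotient_of r)"] exI[of _ "snd (quotient_of r)"]) auto
  obtain a d where x: "x = of_int a / of_int d" "d \<noteq> 0"
    using *[of x] by blast
  obtain b e where y: "y = of_int b / of_int e" "e \<noteq> 0"
    using *[of y] by blast
  show ?thesis by (rule that[of "d * e" "a * e" "b * d"]) (use x y in \<open>auto simp: field_simps\<close>)
qed

lemma padic_abs_pos: "x \<noteq> 0 \<Longrightarrow> 0 < padic_abs p x"
  using p by (simp add: padic_abs_def prime_gt_0_nat)

lemma padic_abs_eq_0_iff [simp]: "padic_abs p x = 0 \<longleftrightarrow> x = 0"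
  by (metis less_irrefl padic_abs_0 padic_abs_pos)

lemma padic_abs_mult: "padic_abs p (x * y) = padic_abs p x * padic_abs p y"
proof (cases "x = 0 \<or> y = 0")
  case False
  obtain a b d where *: "d \<noteq> 0" "x = of_int a / of_int d" "y = of_int b / of_int d"
    by (rule rat_common_denom)
  have nz: "a \<noteq> 0" "b \<noteq> 0" using * False by auto
  have pe: "prime_elem (int p)" using p by simp
  have p0: "real p \<noteq> 0" using p by auto
  have xy: "x * y = of_int (a * b) / of_int (d * d)" using * by simp
  show ?thesis
    unfolding xy unfolding * using nz *(1) pe p0
    by (simp only: padic_abs_divide_int mult_eq_0_iff simp_thms not_False_eq_True
        prime_elem_multiplicity_mult_distrib flip: power_int_add) (simp add: algebra_simps)
qed auto

lemma padic_abs_ultra: "padic_abs p (x + y) \<le> max (padic_abs p x) (padic_abs p y)"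
proof (cases "x = 0 \<or> y = 0 \<or> x + y = 0")
  case False
  obtain a b d where *: "d \<noteq> 0" "x = of_int a / of_int d" "y = of_int b / of_int d"
    by (rule rat_common_denom)
  have xy: "x + y = of_int (a + b) / of_int d" using * by (simp add: add_divide_distrib)
  have nz: "a \<noteq> 0" "b \<noteq> 0" "a + b \<noteq> 0" using False * xy by auto
  have nu: "\<not> is_unit (int p)" using p by (auto simp: prime_int_nat_transfer)
  let ?m = "multiplicity (int p)"
  have "int p ^ min (?m a) (?m b) dvd a + b"
    by (intro dvd_add) (auto intro: multiplicity_dvd')
  then have "min (?m a) (?m b) \<le> ?m (a + b)"
    using nz nu by (intro multiplicity_geI) auto
  moreover have "real p \<ge> 1" using p prime_ge_1_nat by force
  ultimately have "real p powi (int (?m d) - int (?m (a + b)))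
      \<le> real p powi (int (?m d) - int (min (?m a) (?m b)))"
    by (intro power_int_increasing) auto
  also have "\<dots> \<le> max (real p powi (int (?m d) - int (?m a))) (real p powi (int (?m d) - int (?m b)))"
    by (simp add: min_def)
  finally show ?thesis
    unfolding xy unfolding * using nz *(1) by (simp only: padic_abs_divide_int simp_thms not_False_eq_True)
next
  case True
  then consider "x = 0" | "y = 0" | "x + y = 0" by blast
  then show ?thesis by cases (simp_all add: le_max_iff_disj)
qed


lemma padic_abs_ultra_diff: "padic_abs p (x - y) \<le> max (padic_abs p x) (padic_abs p y)"
  using padic_abs_ultra[of x "- y"] by (simp only: padic_abs_minus diff_conv_add_uminus)

lemma padic_abs_1 [simp]: "padic_abs p 1 = 1"
  by (simp add: padic_abs_def)

lemma padic_abs_inverse: "padic_abs p (inverse x) = inverse (padic_abs p x)"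
proof (cases "x = 0")
  case False
  then have "padic_abs p x * padic_abs p (inverse x) = padic_abs p 1"
    by (simp only: padic_abs_mult[symmetric] right_inverse not_False_eq_True)
  then show ?thesis by (metis inverse_unique padic_abs_1)
qed simp

lemma padic_abs_diff_le: "\<bar>padic_abs p x - padic_abs p y\<bar> \<le> padic_abs p (x - y)"
  using padic_abs_ultra[of "x - y" y] padic_abs_ultra[of "y - x" x] padic_abs_minus_commute[of p x y]
    padic_abs_nonneg[of p x] padic_abs_nonneg[of p y] padic_abs_nonneg[of p "x - y"]
  by (simp only: diff_add_cancel)

lemma padic_null_squeeze:
  assumes "padic_null p X" "padic_null p Y"
    "\<And>n. padic_abs p (Z n) \<le> max (padic_abs p (X n)) (padic_abs p (Y n))"
  shows "padic_null p Z"
  unfolding padic_null_def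
proof (rule tendsto_sandwich[OF _ _ tendsto_const])
  show "(\<lambda>n. max (padic_abs p (X n)) (padic_abs p (Y n))) \<longlonglongrightarrow> 0"
    using tendsto_max[OF assms(1,2)[unfolded padic_null_def]] by simp
qed (use assms(3) in auto)

lemma padic_null_add: "padic_null p X \<Longrightarrow> padic_null p Y \<Longrightarrow> padic_null p (\<lambda>n. X n + Y n)"
  by (rule padic_null_squeeze[of X Y]) (auto intro: padic_abs_ultra)

lemma padic_null_minus: "padic_null p X \<Longrightarrow> padic_null p (\<lambda>n. - X n)"
  by (simp add: padic_null_def)

lemma padic_null_mult_bounded:
  assumes "\<And>n. padic_abs p (X n) \<le> B" "padic_null p Y"
  shows "padic_null p (\<lambda>n. X n * Y n)"
  unfolding padic_null_def
proof (rule tendsto_sandwich[OF _ _ tendsto_const])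
  show "(\<lambda>n. B * padic_abs p (Y n)) \<longlonglongrightarrow> 0"
    using tendsto_mult_left[OF assms(2)[unfolded padic_null_def], of B] by simp
qed (use assms(1) in \<open>auto simp: padic_abs_mult intro!: mult_right_mono always_eventually\<close>)

lemma padic_cauchy_minus: "padic_cauchy p X \<Longrightarrow> padic_cauchy p (\<lambda>n. - X n)"
  by (simp only: padic_cauchy_def minus_diff_minus padic_abs_minus)

lemma padic_cauchy_add:
  assumes "padic_cauchy p X" "padic_cauchy p Y"
  shows "padic_cauchy p (\<lambda>n. X n + Y n)"
  unfolding padic_cauchy_def
proof (intro allI impI)
  fix e :: real assume e: "e > 0"
  obtain M N where M: "\<forall>m\<ge>M. \<forall>n\<ge>M. padic_abs p (X m - X n) < e"
    and N: "\<forall>m\<ge>N. \<forall>n\<ge>N. padic_abs p (Y m - Y n) < e"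
    using assms e unfolding padic_cauchy_def by meson
  have "padic_abs p ((X m + Y m) - (X n + Y n)) < e" if "m \<ge> max M N" "n \<ge> max M N" for m n
  proof -
    have "padic_abs p (X m - X n) < e" "padic_abs p (Y m - Y n) < e" using M N that by simp_all
    then show ?thesis
      unfolding add_diff_add by (intro le_less_trans[OF padic_abs_ultra]) simp
  qed
  then show "\<exists>N. \<forall>m\<ge>N. \<forall>n\<ge>N. padic_abs p (X m + Y m - (X n + Y n)) < e" by blast
qed

lemma padic_cauchy_convergent:
  assumes "padic_cauchy p X"
  shows "convergent (\<lambda>n. padic_abs p (X n))"
proof -
  have "Cauchy (\<lambda>n. padic_abs p (X n))"
    unfolding Cauchy_def dist_real_def
    using assms unfolding padic_cauchy_def
    by (meson padic_abs_diff_le le_less_trans)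
  then show ?thesis by (simp add: Cauchy_convergent_iff)
qed

lemma padic_cauchy_bounded:
  assumes "padic_cauchy p X"
  obtains B where "B > 0" "\<And>n. padic_abs p (X n) \<le> B"
proof -
  have "Bseq (\<lambda>n. padic_abs p (X n))"
    using padic_cauchy_convergent[OF assms] by (rule convergent_imp_Bseq)
  then show ?thesis using that by (auto elim!: BseqE)
qed

lemma padic_cauchy_mult:
  assumes X: "padic_cauchy p X" and Y: "padic_cauchy p Y"
  shows "padic_cauchy p (\<lambda>n. X n * Y n)"
  unfolding padic_cauchy_def
proof (intro allI impI)
  fix e :: real assume e: "e > 0"
  obtain A where A: "A > 0" "\<And>n. padic_abs p (X n) \<le> A" using padic_cauchy_bounded[OF X] by blast
  obtain B where B: "B > 0" "\<And>n. padic_abs p (Y n) \<le> B" using padic_cauchy_bounded[OF Y] by blast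
  obtain M where M: "\<forall>m\<ge>M. \<forall>n\<ge>M. padic_abs p (X m - X n) < e / B"
    using X e B(1) unfolding padic_cauchy_def by (meson divide_pos_pos)
  obtain N where N: "\<forall>m\<ge>N. \<forall>n\<ge>N. padic_abs p (Y m - Y n) < e / A"
    using Y e A(1) unfolding padic_cauchy_def by (meson divide_pos_pos)
  have "padic_abs p (X m * Y m - X n * Y n) < e" if "m \<ge> max M N" "n \<ge> max M N" for m n
  proof -
    have "padic_abs p (X m * (Y m - Y n)) \<le> A * padic_abs p (Y m - Y n)"
      using A by (simp add: padic_abs_mult mult_right_mono)
    also have "\<dots> < e" using N that A(1) by (simp add: pos_less_divide_eq mult.commute)
    finally have 1: "padic_abs p (X m * (Y m - Y n)) < e" .
    have "padic_abs p ((X m - X n) * Y n) \<le> padic_abs p (X m - X n) * B"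
      using B by (simp add: padic_abs_mult mult_left_mono)
    also have "\<dots> < e" using M that B(1) by (simp add: pos_less_divide_eq)
    finally show ?thesis
      using 1 padic_abs_ultra[of "X m * (Y m - Y n)" "(X m - X n) * Y n"]
      by (simp add: mult_diff_mult)
  qed
  then show "\<exists>N. \<forall>m\<ge>N. \<forall>n\<ge>N. padic_abs p (X m * Y m - X n * Y n) < e" by blast
qed

lemma padic_abs_tendsto_nonnull:
  assumes X: "padic_cauchy p X" "\<not> padic_null p X"
  obtains L where "L > 0" "(\<lambda>n. padic_abs p (X n)) \<longlonglongrightarrow> L"
proof -
  obtain L where L: "(\<lambda>n. padic_abs p (X n)) \<longlonglongrightarrow> L"
    using padic_cauchy_convergent[OF X(1)] by (auto simp: convergent_def)
  have "L \<ge> 0" by (rule LIMSEQ_le_const[OF L]) auto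
  moreover have "L \<noteq> 0" using L X(2) by (auto simp: padic_null_def)
  ultimately have "L > 0" by simp
  then show ?thesis using L by (rule that)
qed

lemma padic_nonnull_bound:
  assumes X: "padic_cauchy p X" "\<not> padic_null p X"
  obtains b N where "b > 0" "\<And>n. n \<ge> N \<Longrightarrow> b < padic_abs p (X n)"
proof -
  obtain L where L: "L > 0" "(\<lambda>n. padic_abs p (X n)) \<longlonglongrightarrow> L"
    by (rule padic_abs_tendsto_nonnull[OF X])
  have "eventually (\<lambda>n. L / 2 < padic_abs p (X n)) sequentially"
    using L by (intro order_tendstoD(1)[OF L(2)]) auto
  then obtain N where "\<And>n. n \<ge> N \<Longrightarrow> L / 2 < padic_abs p (X n)"
    unfolding eventually_sequentially by blast
  moreover have "L / 2 > 0" using L(1) by simp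
  ultimately show ?thesis using that[of "L / 2" N] by blast
qed

lemma padic_abs_diff_inverse:
  assumes "b > 0" "b < padic_abs p x" "c > 0" "c < padic_abs p y"
  shows "padic_abs p (inverse x - inverse y) \<le> padic_abs p (x - y) / (b * c)"
proof -
  have nz: "x \<noteq> 0" "y \<noteq> 0" using assms by auto
  have "padic_abs p (inverse x - inverse y) = padic_abs p (x - y) / (padic_abs p x * padic_abs p y)"
    by (simp only: inverse_diff_inverse[OF nz] padic_abs_minus padic_abs_mult padic_abs_inverse)
       (simp add: divide_inverse ac_simps)
  also have "\<dots> \<le> padic_abs p (x - y) / (b * c)"
    using assms by (intro divide_left_mono mult_mono mult_pos_pos) auto
  finally show ?thesis .
qed

lemma padic_cauchy_inverse:
  assumes X: "padic_cauchy p X" "\<not> padic_null p X"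
  shows "padic_cauchy p (\<lambda>n. inverse (X n))"
  unfolding padic_cauchy_def
proof (intro allI impI)
  fix e :: real assume e: "e > 0"
  obtain b M where b: "b > 0" "\<And>n. n \<ge> M \<Longrightarrow> b < padic_abs p (X n)"
    using padic_nonnull_bound[OF X] by blast
  obtain N where N: "\<forall>m\<ge>N. \<forall>n\<ge>N. padic_abs p (X m - X n) < e * (b * b)"
    using X e b(1) unfolding padic_cauchy_def by (meson mult_pos_pos)
  have "padic_abs p (inverse (X m) - inverse (X n)) < e" if "m \<ge> max M N" "n \<ge> max M N" for m n
  proof -
    have "padic_abs p (inverse (X m) - inverse (X n)) \<le> padic_abs p (X m - X n) / (b * b)"
      using b that by (intro padic_abs_diff_inverse) auto
    also have "\<dots> < e" using N that b(1) by (simp add: pos_divide_less_eq)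
    finally show ?thesis .
  qed
  then show "\<exists>N. \<forall>m\<ge>N. \<forall>n\<ge>N. padic_abs p (inverse (X m) - inverse (X n)) < e" by blast
qed

lemma padic_null_diff_inverse:
  assumes X: "padic_cauchy p X" "\<not> padic_null p X"
    and Y: "padic_cauchy p Y" "\<not> padic_null p Y"
    and XY: "padic_null p (\<lambda>n. X n - Y n)"
  shows "padic_null p (\<lambda>n. inverse (X n) - inverse (Y n))"
proof -
  obtain b M where b: "b > 0" "\<And>n. n \<ge> M \<Longrightarrow> b < padic_abs p (X n)"
    using padic_nonnull_bound[OF X] by blast
  obtain c N where c: "c > 0" "\<And>n. n \<ge> N \<Longrightarrow> c < padic_abs p (Y n)"
    using padic_nonnull_bound[OF Y] by blast
  have lim: "(\<lambda>n. padic_abs p (X n - Y n) / (b * c)) \<longlonglongrightarrow> 0"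
    using tendsto_divide[OF XY[unfolded padic_null_def] tendsto_const[of "b * c"]] b c by simp
  show ?thesis
    unfolding padic_null_def
  proof (rule tendsto_sandwich[OF _ _ tendsto_const lim])
    show "\<forall>\<^sub>F n in sequentially. padic_abs p (inverse (X n) - inverse (Y n))
        \<le> padic_abs p (X n - Y n) / (b * c)"
      using b c by (intro eventually_sequentiallyI[of "max M N"] padic_abs_diff_inverse) auto
  qed auto
qed

lemma padic_null_cong:
  assumes "padic_null p (\<lambda>n. X n - Y n)"
  shows "padic_null p X \<longleftrightarrow> padic_null p Y"
  using padic_null_add[OF assms, of Y] padic_null_add[OF padic_null_minus[OF assms], of X] by auto

lemma part_equivp_padicrel: "part_equivp (padicrel p)"
proof (rule part_equivpI)
  show "\<exists>X. padicrel p X X"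
    by (rule exI[of _ "\<lambda>_. 0"]) (simp add: padicrel_def padic_null_def)
  show "symp (padicrel p)"
    by (auto simp: symp_def padicrel_def padic_null_def padic_abs_minus_commute)
  show "transp (padicrel p)"
    unfolding transp_def padicrel_def by (auto dest: padic_null_add)
qed

end

text \<open>Completion of the rationals with respect to the p-adic absolute value: Cauchy sequences
  modulo null sequences. The package for quotient types does not accept the phantom parameter
  \<open>'p\<close>, so the quotient is built by hand; an element is an equivalence class of the partial
  equivalence relation \<^const>\<open>padicrel\<close>.\<close>

typedef 'p padic =
  "{C. \<exists>X. padicrel CARD('p::prime_type) X X \<and> C = {Y. padicrel CARD('p) X Y}}"
  by (rule exI[of _ "{Y. padicrel CARD('p) (\<lambda>_. 0) Y}"])
     (auto intro!: exI[of _ "\<lambda>_. 0"] simp: padicrel_def padic_null_def)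

definition Padic :: "(nat \<Rightarrow> rat) \<Rightarrow> 'p::prime_type padic" where
  "Padic X = Abs_padic {Y. padicrel CARD('p) X Y}"

definition rep_padic :: "'p::prime_type padic \<Rightarrow> nat \<Rightarrow> rat" where
  "rep_padic x = (SOME X. X \<in> Rep_padic x)"

definition cr_padic :: "(nat \<Rightarrow> rat) \<Rightarrow> 'p::prime_type padic \<Rightarrow> bool" where
  "cr_padic X x \<longleftrightarrow> padicrel CARD('p) X X \<and> Padic X = x"

lemma Padic_eq_iff:
  assumes "padicrel CARD('p::prime_type) X X" "padicrel CARD('p) Y Y"
  shows "(Padic X :: 'p padic) = Padic Y \<longleftrightarrow> padicrel CARD('p) X Y"
proof -
  have pe: "part_equivp (padicrel CARD('p))" by (rule part_equivp_padicrel[OF prime_CARD])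
  have "(Padic X :: 'p padic) = Padic Y \<longleftrightarrow> {Z. padicrel CARD('p) X Z} = {Z. padicrel CARD('p) Y Z}"
    unfolding Padic_def using assms by (intro Abs_padic_inject) auto
  also have "\<dots> \<longleftrightarrow> padicrel CARD('p) X Y"
    using assms part_equivp_symp[OF pe] part_equivp_transp[OF pe] by blast
  finally show ?thesis .
qed

lemma rep_padic:
  fixes x :: "'p::prime_type padic"
  shows "padicrel CARD('p) (rep_padic x) (rep_padic x)" "Padic (rep_padic x) = x"
proof -
  have pe: "part_equivp (padicrel CARD('p))" by (rule part_equivp_padicrel[OF prime_CARD])
  obtain X where X: "padicrel CARD('p) X X" "Rep_padic x = {Y. padicrel CARD('p) X Y}"
    using Rep_padic[of x] by auto
  have "rep_padic x \<in> Rep_padic x"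
    unfolding rep_padic_def by (rule someI[of _ X]) (use X in auto)
  then have r: "padicrel CARD('p) X (rep_padic x)" using X by simp
  then show 1: "padicrel CARD('p) (rep_padic x) (rep_padic x)"
    using part_equivp_symp[OF pe] part_equivp_transp[OF pe] by blast
  have "Padic X = x" unfolding Padic_def X(2)[symmetric] by (rule Rep_padic_inverse)
  then show "Padic (rep_padic x) = x" using Padic_eq_iff[OF X(1) 1] r by simp
qed

lemma Quotient_padic:
  "Quotient (padicrel CARD('p::prime_type)) (Padic :: _ \<Rightarrow> 'p padic) rep_padic cr_padic"
proof -
  have pe: "part_equivp (padicrel CARD('p))" by (rule part_equivp_padicrel[OF prime_CARD])
  have "padicrel CARD('p) X Y \<longleftrightarrow>
      padicrel CARD('p) X X \<and> padicrel CARD('p) Y Y \<and> (Padic X :: 'p padic) = Padic Y" for X Y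
    using Padic_eq_iff[where 'p='p, of X Y] part_equivp_symp[OF pe] part_equivp_transp[OF pe] by blast
  then show ?thesis
    unfolding Quotient_alt_def3 cr_padic_def
    using rep_padic by (metis (no_types, lifting))
qed

setup_lifting Quotient_padic

instantiation padic :: (prime_type) field
begin

lift_definition zero_padic :: "'a padic" is "\<lambda>_. 0"
  by (simp add: padicrel_def padic_null_def)

lift_definition one_padic :: "'a padic" is "\<lambda>_. 1"
  by (simp add: padicrel_def padic_null_def)

lift_definition plus_padic :: "'a padic \<Rightarrow> 'a padic \<Rightarrow> 'a padic" is "\<lambda>X Y n. X n + Y n"
  unfolding padicrel_def add_diff_add
  by (simp add: prime_CARD padic_cauchy_add padic_null_add)

lift_definition uminus_padic :: "'a padic \<Rightarrow> 'a padic" is "\<lambda>X n. - X n"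
  unfolding padicrel_def minus_diff_minus
  by (simp only: prime_CARD padic_cauchy_minus padic_null_minus simp_thms)

lift_definition times_padic :: "'a padic \<Rightarrow> 'a padic \<Rightarrow> 'a padic" is "\<lambda>X Y n. X n * Y n"
proof -
  fix X X' Y Y' :: "nat \<Rightarrow> rat"
  assume "padicrel CARD('a) X X'" "padicrel CARD('a) Y Y'"
  then have X: "padic_cauchy CARD('a) X" "padic_cauchy CARD('a) X'" "padic_null CARD('a) (\<lambda>n. X n - X' n)"
    and Y: "padic_cauchy CARD('a) Y" "padic_cauchy CARD('a) Y'" "padic_null CARD('a) (\<lambda>n. Y n - Y' n)"
    by (simp_all add: padicrel_def)
  obtain A where A: "\<And>n. padic_abs CARD('a) (X n) \<le> A"
    using padic_cauchy_bounded[OF prime_CARD X(1)] by blast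
  obtain B where B: "\<And>n. padic_abs CARD('a) (Y' n) \<le> B"
    using padic_cauchy_bounded[OF prime_CARD Y(2)] by blast
  have "padic_null CARD('a) (\<lambda>n. X n * (Y n - Y' n) + Y' n * (X n - X' n))"
    by (intro padic_null_add padic_null_mult_bounded[OF prime_CARD A]
        padic_null_mult_bounded[OF prime_CARD B] prime_CARD X Y)
  then show "padicrel CARD('a) (\<lambda>n. X n * Y n) (\<lambda>n. X' n * Y' n)"
    using X Y by (simp add: padicrel_def padic_cauchy_mult prime_CARD mult_diff_mult mult.commute)
qed

lift_definition inverse_padic :: "'a padic \<Rightarrow> 'a padic"
  is "\<lambda>X. if padic_null CARD('a) X then (\<lambda>_. 0) else (\<lambda>n. inverse (X n))"
proof -
  fix X Y :: "nat \<Rightarrow> rat"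
  assume "padicrel CARD('a) X Y"
  then have XY: "padic_cauchy CARD('a) X" "padic_cauchy CARD('a) Y" "padic_null CARD('a) (\<lambda>n. X n - Y n)"
    by (simp_all add: padicrel_def)
  have "padic_null CARD('a) X \<longleftrightarrow> padic_null CARD('a) Y"
    by (rule padic_null_cong[OF prime_CARD XY(3)])
  then show "?thesis X Y"
    using XY by (auto simp: padicrel_def padic_cauchy_inverse padic_null_diff_inverse prime_CARD padic_null_def[of _ "\<lambda>_. 0"])
qed

definition "x - y = x + - y" for x y :: "'a padic"

definition "x div y = x * inverse y" for x y :: "'a padic"

instance
proof
  have null0: "padic_null CARD('a) (\<lambda>_. 0)" by (simp add: padic_null_def)
  note [simp] = prime_CARD padicrel_def null0 padic_cauchy_add padic_cauchy_minus padic_cauchy_mult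
  fix a b c :: "'a padic"
  show "a + b = b + a"
    by transfer (simp add: ac_simps)
  show "(a + b) + c = a + (b + c)"
    by transfer (simp add: ac_simps)
  show "0 + a = a"
    by transfer simp
  show "- a + a = 0"
    by transfer simp
  show "a - b = a + - b"
    by (rule minus_padic_def)
  show "(a * b) * c = a * (b * c)"
    by transfer (simp add: ac_simps)
  show "a * b = b * a"
    by transfer (simp add: ac_simps)
  show "1 * a = a"
    by transfer simp
  show "(a + b) * c = a * c + b * c"
    by transfer (simp add: distrib_right)
  show "(0::'a padic) \<noteq> 1"
    by transfer (simp add: padic_null_def LIMSEQ_const_iff)
  have "padic_null CARD('a) (\<lambda>n. inverse (X n) * X n - 1)"
    if X: "padic_cauchy CARD('a) X" "\<not> padic_null CARD('a) X" for X
  proof -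
    obtain b N where b: "b > 0" "\<And>n. n \<ge> N \<Longrightarrow> b < padic_abs CARD('a) (X n)"
      using padic_nonnull_bound[OF prime_CARD X] by blast
    then have "X n \<noteq> 0" if "n \<ge> N" for n using that by force
    then show ?thesis
      unfolding padic_null_def
      by (intro tendsto_eventually eventually_sequentiallyI[of N]) auto
  qed
  then show "a \<noteq> 0 \<Longrightarrow> inverse a * a = 1"
    by transfer (simp add: padic_cauchy_inverse)
  show "a div b = a * inverse b"
    by (rule divide_padic_def)
  show "inverse (0::'a padic) = 0"
    by transfer simp
qed

end

text \<open>The overloaded \<open>norm\<close> of the library is restricted to real normed vector spaces,
  hence a separate constant.\<close>

lift_definition padic_norm :: "'p::prime_type padic \<Rightarrow> real"
  is "\<lambda>X. lim (\<lambda>n. padic_abs CARD('p) (X n))"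
proof -
  fix X Y :: "nat \<Rightarrow> rat"
  assume "padicrel CARD('p) X Y"
  then have XY: "padic_cauchy CARD('p) X" "padic_cauchy CARD('p) Y" "padic_null CARD('p) (\<lambda>n. X n - Y n)"
    by (simp_all add: padicrel_def)
  have "(\<lambda>n. padic_abs CARD('p) (X n) - padic_abs CARD('p) (Y n)) \<longlonglongrightarrow> 0"
    by (rule Lim_null_comparison[OF _ XY(3)[unfolded padic_null_def]])
       (simp add: padic_abs_diff_le prime_CARD)
  moreover have "(\<lambda>n. padic_abs CARD('p) (Y n)) \<longlonglongrightarrow> lim (\<lambda>n. padic_abs CARD('p) (Y n))"
    using padic_cauchy_convergent[OF prime_CARD XY(2)] by (simp add: convergent_LIMSEQ_iff)
  ultimately have "(\<lambda>n. padic_abs CARD('p) (X n)) \<longlonglongrightarrow> lim (\<lambda>n. padic_abs CARD('p) (Y n))"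
    using tendsto_add by fastforce
  then show "lim (\<lambda>n. padic_abs CARD('p) (X n)) = lim (\<lambda>n. padic_abs CARD('p) (Y n))"
    by (rule limI)
qed

lemma padic_abs_LIMSEQ_lim:
  "padic_cauchy CARD('p::prime_type) X \<Longrightarrow>
    (\<lambda>n. padic_abs CARD('p) (X n)) \<longlonglongrightarrow> lim (\<lambda>n. padic_abs CARD('p) (X n))"
  using padic_cauchy_convergent[OF prime_CARD, of X] by (simp add: convergent_LIMSEQ_iff)

lemma padic_norm_0 [simp]: "padic_norm 0 = 0"
  by transfer (simp add: limI)

lemma padic_norm_1 [simp]: "padic_norm 1 = 1"
  by transfer (simp add: limI prime_CARD)

lemma padic_norm_nonneg [simp]: "0 \<le> padic_norm x"
  by transfer (rule LIMSEQ_le_const[OF padic_abs_LIMSEQ_lim], auto simp: padicrel_def)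

lemma padic_norm_minus [simp]: "padic_norm (- x) = padic_norm x"
  by transfer simp

lemma padic_norm_eq_0_iff [simp]: "padic_norm x = 0 \<longleftrightarrow> x = 0"
proof
  show "padic_norm x = 0 \<Longrightarrow> x = 0"
  proof transfer
    fix X :: "nat \<Rightarrow> rat"
    assume X: "padicrel CARD('a) X X" "lim (\<lambda>n. padic_abs CARD('a) (X n)) = 0"
    then show "padicrel CARD('a) X (\<lambda>_. 0)"
      using padic_abs_LIMSEQ_lim[where 'p='a, of X] by (simp add: padicrel_def padic_null_def prime_CARD)
  qed
qed simp

lemma padic_norm_mult: "padic_norm (x * y) = padic_norm x * padic_norm y"
proof transfer
  fix X Y :: "nat \<Rightarrow> rat"
  assume "padicrel CARD('a) X X" "padicrel CARD('a) Y Y"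
  then show "lim (\<lambda>n. padic_abs CARD('a) (X n * Y n)) =
      lim (\<lambda>n. padic_abs CARD('a) (X n)) * lim (\<lambda>n. padic_abs CARD('a) (Y n))"
    by (intro limI) (auto simp: padicrel_def padic_abs_mult prime_CARD intro!: tendsto_mult padic_abs_LIMSEQ_lim)
qed

lemma padic_norm_ultra: "padic_norm (x + y) \<le> max (padic_norm x) (padic_norm y)"
proof transfer
  fix X Y :: "nat \<Rightarrow> rat"
  assume "padicrel CARD('a) X X" "padicrel CARD('a) Y Y"
  then have c: "padic_cauchy CARD('a) X" "padic_cauchy CARD('a) Y" "padic_cauchy CARD('a) (\<lambda>n. X n + Y n)"
    by (auto simp: padicrel_def padic_cauchy_add prime_CARD)
  show "lim (\<lambda>n. padic_abs CARD('a) (X n + Y n))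
      \<le> max (lim (\<lambda>n. padic_abs CARD('a) (X n))) (lim (\<lambda>n. padic_abs CARD('a) (Y n)))"
    by (rule LIMSEQ_le[OF padic_abs_LIMSEQ_lim[OF c(3)]
          tendsto_max[OF padic_abs_LIMSEQ_lim[OF c(1)] padic_abs_LIMSEQ_lim[OF c(2)]]])
       (auto intro: padic_abs_ultra prime_CARD)
qed

instantiation padic :: (prime_type) metric_space
begin

definition dist_padic :: "'a padic \<Rightarrow> 'a padic \<Rightarrow> real" where
  "dist_padic x y = padic_norm (x - y)"

definition uniformity_padic :: "('a padic \<times> 'a padic) filter" where
  "uniformity_padic = (INF e\<in>{0<..}. principal {(x, y). dist x y < e})"

definition open_padic :: "'a padic set \<Rightarrow> bool" where
  "open_padic U \<longleftrightarrow> (\<forall>x\<in>U. eventually (\<lambda>(x', y). x' = x \<longrightarrow> y \<in> U) uniformity)"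

instance
proof
  fix x y z :: "'a padic"
  show "dist x y = 0 \<longleftrightarrow> x = y"
    by (simp add: dist_padic_def)
  have "padic_norm ((x - z) + (z - y)) \<le> max (padic_norm (x - z)) (padic_norm (z - y))"
    by (rule padic_norm_ultra)
  also have "padic_norm (z - y) = padic_norm (y - z)"
    using padic_norm_minus[of "y - z"] by simp
  also have "max (padic_norm (x - z)) (padic_norm (y - z)) \<le> padic_norm (x - z) + padic_norm (y - z)"
    by simp
  finally show "dist x y \<le> dist x z + dist y z"
    by (simp add: dist_padic_def)
qed (simp_all add: uniformity_padic_def open_padic_def)

end


section \<open>Matrices over the p-adic numbers\<close>

definition integral_matrices :: "('p::prime_type padic ^ 'm ^ 'm) set" where
  "integral_matrices = {A. \<forall>i j. padic_norm (A $ i $ j) \<le> 1}"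

definition GL_integral :: "('p::prime_type padic ^ 'm ^ 'm) set" where
  "GL_integral =
     {A \<in> integral_matrices. \<exists>B\<in>integral_matrices. A ** B = mat 1 \<and> B ** A = mat 1}"

definition block_matrix ::
    "'a ^ 'n ^ 'n \<Rightarrow> 'a ^ 'n ^ 'n \<Rightarrow> 'a ^ 'n ^ 'n \<Rightarrow> 'a ^ 'n ^ 'n \<Rightarrow> 'a ^ ('n + 'n) ^ ('n + 'n)" where
  "block_matrix a b c d = (\<chi> i j.
     case i of
       Inl i' \<Rightarrow> (case j of Inl j' \<Rightarrow> a $ i' $ j' | Inr j' \<Rightarrow> b $ i' $ j')
     | Inr i' \<Rightarrow> (case j of Inl j' \<Rightarrow> c $ i' $ j' | Inr j' \<Rightarrow> d $ i' $ j'))"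

text \<open>The exponents of the diagonal normal form are integers or minus infinity; the latter is
  rendered as \<^const>\<open>None\<close>. Both the diagonal matrix with entries \<open>p\<close> to the power
  \<open>- k\<^sub>j\<close> and the normal form are taken without sorting the exponents: an arbitrary finite index
  type carries no order, permutation matrices lie in \<^const>\<open>GL_integral\<close>, and the product that
  defines \<open>\<gamma>\<close> is symmetric.\<close>

definition diag_powers :: "('n \<Rightarrow> int option) \<Rightarrow> 'p::prime_type padic ^ 'n ^ 'n" where
  "diag_powers k = (\<chi> i j.
     if i = j then (case k i of None \<Rightarrow> 0 | Some m \<Rightarrow> of_nat CARD('p) powi (- m)) else 0)"

definition gamma :: "'p::prime_type padic ^ 'n ^ 'n \<Rightarrow> real" where
  "gamma z = (THE x. \<exists>A\<in>GL_integral. \<exists>B\<in>GL_integral. \<exists>k :: 'n \<Rightarrow> int option.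
     z = A ** diag_powers k ** B \<and>
     x = (\<Prod>j \<in> {j. \<exists>m>0. k j = Some m}. real CARD('p) powi the (k j)))"

section \<open>The measures\<close>

text \<open>The Borel sets are those of the product topology on the matrix entries, each carrying the
  topology of the p-adic metric.\<close>

definition is_normalized_haar :: "('p::prime_type padic ^ 'n ^ 'n) measure \<Rightarrow> bool" where
  "is_normalized_haar vol \<longleftrightarrow>
     sets vol = sets borel \<and>
     (\<forall>B\<in>sets borel. \<forall>x. emeasure vol ((\<lambda>z. x + z) ` B) = emeasure vol B) \<and>
     emeasure vol integral_matrices = 1"

definition hua_const :: "('p::prime_type padic ^ 'n ^ 'n) measure \<Rightarrow> real \<Rightarrow> ennreal" where
  "hua_const vol \<alpha> = (\<integral>\<^sup>+ z. ennreal (gamma z powr (- \<alpha>)) \<partial>vol)"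

definition hua_measure ::
    "('p::prime_type padic ^ 'n ^ 'n) measure \<Rightarrow> real \<Rightarrow> ('p padic ^ 'n ^ 'n) measure" where
  "hua_measure vol s =
     density vol (\<lambda>z. inverse (hua_const vol (s + 2 * real CARD('n)))
                      * ennreal (gamma z powr (- s - 2 * real CARD('n))))"

definition linear_fractional ::
    "'a::field ^ 'n ^ 'n \<Rightarrow> 'a ^ 'n ^ 'n \<Rightarrow> 'a ^ 'n ^ 'n \<Rightarrow> 'a ^ 'n ^ 'n \<Rightarrow> 'a ^ 'n ^ 'n \<Rightarrow> 'a ^ 'n ^ 'n" where
  "linear_fractional a b c d z = matrix_inv (a + z ** c) ** (b + z ** d)"

text \<open>The identity \<open>d\<nu>(z * g) = h(z) d\<nu>(z)\<close> for the transformation with blocks \<open>a, b, c, d\<close>;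
  \<open>h\<close> takes nonnegative values.\<close>

definition transforms_with ::
    "('p::prime_type padic ^ 'n ^ 'n) measure \<Rightarrow> 'p padic ^ 'n ^ 'n \<Rightarrow> 'p padic ^ 'n ^ 'n \<Rightarrow>
     'p padic ^ 'n ^ 'n \<Rightarrow> 'p padic ^ 'n ^ 'n \<Rightarrow> ('p padic ^ 'n ^ 'n \<Rightarrow> real) \<Rightarrow> bool" where
  "transforms_with \<nu> a b c d h \<longleftrightarrow>
     (\<forall>B\<in>sets borel. B \<subseteq> {z. det (a + z ** c) \<noteq> 0} \<longrightarrow>
        emeasure \<nu> (linear_fractional a b c d ` B) = (\<integral>\<^sup>+ z\<in>B. ennreal (h z) \<partial>\<nu>))"

end

theory Submission
  imports Defs
begin

text \<open>\<open>\<gamma>(z)\<close> is the index of \<open>O\<^sup>n\<close> in the lattice \<open>(1 z) O\<^sup>2\<^sup>n = O\<^sup>n + z O\<^sup>n\<close>. An element \<open>g\<close> of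
  \<open>GL(2n, O)\<close> preserves \<open>O\<^sup>2\<^sup>n\<close> and \<open>(1 z) g = (a + zc) (1 z*g)\<close>, whence \<open>\<gamma>(z) = |det(a + zc)| \<gamma>(z*g)\<close>.
  Near \<open>z\<close>, with \<open>A = a + zc\<close> and \<open>D = d - c (z*g)\<close>, the transformation maps small balls around \<open>z\<close> onto
  \<open>z*g + A\<^sup>-\<^sup>1 p\<^sup>k Mat(n, O) D\<close>; as \<open>|det A| |det D| = 1\<close>, its Jacobian is \<open>|det A|\<close> to the power \<open>- 2n\<close>.
  Together these give (a).

  The integral of \<open>\<gamma>\<close> to the power \<open>- \<alpha>\<close> is bounded by releasing one column of \<open>z\<close> at a time from
  integrality: summing over the classes of this column modulo \<open>O\<^sup>n\<close> costs a convergent geometric series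
  in \<open>p\<^sup>n\<^sup>-\<^sup>\<alpha>\<close> and lowers \<open>\<alpha>\<close> by one, so that \<open>\<alpha> > 2n - 1\<close> suffices.

  For (b), integral translations determine \<open>\<nu>\<close> on \<open>Mat(n, O)\<close> up to a factor, and every matrix has
  the form \<open>0*g\<close>, so the transformation law determines \<open>\<nu>\<close> near every point up to the same factor.\<close>

section \<open>The ring of p-adic integers\<close>

text \<open>Lattice indices are never handled as such. A matrix in \<open>column_lattice z\<close>
  has n columns, so this set has volume \<open>gamma z ^ n\<close>; comparing volumes shows both
  that the description in the definition of \<open>gamma\<close> determines a value and every
  inequality between values of \<open>gamma\<close>. All this rests on how \<open>vol\<close>
  behaves under z -> X z Y, which Smith normal form reduces to diagonal matrices. The relation |det
  A| |det D| = 1 comes out of the same comparison: with w = z*g, the inclusion of lattices gives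
  |det A| gamma(w) <= gamma(z), its transposed version gives |det D| gamma(z) <= gamma(w), and the
  inverse of g turns both into equalities. The exponent s + 2n is dictated by (a): passing from
  gamma(z) to gamma(z) / |det A| and multiplying by the Jacobian leaves |det A|^s for exactly this
  power. At alpha = s + 2n the convergence condition reads s > -1. In (b) no mass is divided out
  beforehand. With x and y the masses of Mat(n, O) under nu and mu, the equation y nu = x mu is
  proved everywhere; total mass one then gives x = y, so only mu has to charge Mat(n, O).\<close>

lemma CARD_gt_1: "CARD('p::prime_type) > 1"
  using prime_CARD prime_gt_1_nat by blast

lemma CARD_powi_pos [simp]: "real CARD('p::prime_type) powi k > 0"
  by simp

lemma CARD_powi_le_iff [simp]:
  "real CARD('p::prime_type) powi k \<le> real CARD('p) powi l \<longleftrightarrow> k \<le> l"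
proof -
  have "real CARD('p) > 1" using CARD_gt_1[where 'p='p] by simp
  then show ?thesis by (metis not_le power_int_increasing less_imp_le power_int_strict_increasing)
qed

lemma CARD_powi_less_iff [simp]:
  "real CARD('p::prime_type) powi k < real CARD('p) powi l \<longleftrightarrow> k < l"
  by (meson CARD_powi_le_iff not_le)

lemma padicrel_const: "padicrel CARD('p::prime_type) (\<lambda>_. r) (\<lambda>_. r)"
  by (simp add: padicrel_def padic_null_def)

lemma padic_norm_Padic_const: "padic_norm (Padic (\<lambda>_. r) :: 'p::prime_type padic) = padic_abs CARD('p) r"
  by (simp add: padic_norm.abs_eq[OF padicrel_const] limI)

lemma Padic_const_diff:
  "(Padic (\<lambda>_. r) - Padic (\<lambda>_. s) :: 'p::prime_type padic) = Padic (\<lambda>_. r - s)"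
  by (simp add: minus_padic_def uminus_padic.abs_eq[OF padicrel_const] plus_padic.abs_eq padicrel_const)

lemma of_nat_eq_Padic: "(of_nat m :: 'p::prime_type padic) = Padic (\<lambda>_. of_nat m)"
proof (induction m)
  case 0
  show ?case by (simp add: zero_padic.abs_eq)
next
  case (Suc m)
  then show ?case by (simp add: one_padic.abs_eq plus_padic.abs_eq padicrel_const)
qed

lemma of_int_eq_Padic: "(of_int i :: 'p::prime_type padic) = Padic (\<lambda>_. of_int i)"
  by (cases i rule: int_diff_cases) (simp add: of_nat_eq_Padic Padic_const_diff)

lemma padic_norm_of_int: "padic_norm (of_int i :: 'p::prime_type padic) = padic_abs CARD('p) (of_int i)"
  by (simp add: of_int_eq_Padic padic_norm_Padic_const)

lemma padic_abs_of_int: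
  assumes "i \<noteq> 0"
  shows "padic_abs CARD('p::prime_type) (of_int i) = real CARD('p) powi (- int (multiplicity (int CARD('p)) i))"
  using padic_abs_divide_int[OF prime_CARD[where 'a='p], of i 1] assms by simp

lemma padic_norm_divide: "padic_norm (x / y) = padic_norm x / padic_norm (y :: 'p::prime_type padic)"
proof (cases "y = 0")
  case False
  then have "padic_norm (x / y) * padic_norm y = padic_norm x"
    by (simp flip: padic_norm_mult)
  then show ?thesis using False by (simp add: field_simps)
qed simp

lemma padic_norm_power_int: "padic_norm (x powi k) = padic_norm (x :: 'p::prime_type padic) powi k"
proof -
  have n: "padic_norm (x ^ m) = padic_norm x ^ m" for m
    by (induction m) (auto simp: padic_norm_mult)
  show ?thesis using padic_norm_divide[of 1 "x ^ nat (- k)"]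
    by (auto simp: power_int_def n inverse_eq_divide power_one_over)
qed

definition unif :: "'p::prime_type padic" where
  "unif = of_nat CARD('p)"

lemma padic_norm_unif: "padic_norm (unif :: 'p::prime_type padic) = real CARD('p) powi (-1)"
proof -
  have "padic_norm (unif :: 'p padic) = padic_abs CARD('p) (of_int (int CARD('p)))"
    unfolding unif_def by (simp add: of_nat_eq_Padic padic_norm_Padic_const)
  also have "\<dots> = real CARD('p) powi (- int (multiplicity (int CARD('p)) (int CARD('p))))"
    by (rule padic_abs_of_int) simp
  also have "multiplicity (int CARD('p)) (int CARD('p)) = 1"
    using prime_CARD[where 'a='p] by (intro multiplicity_self) (auto simp: prime_int_nat_transfer)
  finally show ?thesis by simp
qed

lemma unif_nz [simp]: "(unif :: 'p::prime_type padic) \<noteq> 0"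
proof
  assume "(unif :: 'p padic) = 0"
  then have "padic_norm (unif :: 'p padic) = 0" by simp
  then show False unfolding padic_norm_unif by simp
qed

lemma padic_norm_unif_powi:
  "padic_norm (unif powi k :: 'p::prime_type padic) = real CARD('p) powi (- k)"
proof -
  have "real CARD('p) powi (-1 * k) = (real CARD('p) powi -1) powi k" by (rule power_int_mult)
  then show ?thesis unfolding padic_norm_power_int padic_norm_unif by simp
qed

lemma padic_norm_diff: "padic_norm (x - y) \<le> max (padic_norm x) (padic_norm y)"
  using padic_norm_ultra[of x "- y"] by simp

lemma padic_norm_add_eq: "padic_norm y < padic_norm x \<Longrightarrow> padic_norm (x + y) = padic_norm x"
  using padic_norm_ultra[of x y] padic_norm_diff[of "x + y" y] by auto

text \<open>A late term of a Cauchy representative, taken as a constant sequence, approximates the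
  class. The Cauchy condition is used with \<open>e / 2\<close> because a limit preserves only the
  weak inequality.\<close>

lemma padic_dense:
  fixes x :: "'p::prime_type padic"
  assumes "e > 0"
  obtains r where "padic_norm (x - Padic (\<lambda>_. r)) < e"
proof -
  define X where "X = rep_padic x"
  have X: "padicrel CARD('p) X X" "Padic X = x"
    using rep_padic[of x] by (auto simp: X_def)
  then obtain N where N: "\<And>m n. m \<ge> N \<Longrightarrow> n \<ge> N \<Longrightarrow> padic_abs CARD('p) (X m - X n) < e / 2"
    using assms unfolding padicrel_def padic_cauchy_def by (meson half_gt_zero)
  have "x - Padic (\<lambda>_. X N) = Padic (\<lambda>n. X n - X N)"
    unfolding minus_padic_def uminus_padic.abs_eq[OF padicrel_const] X(2)[symmetric]
    by (subst plus_padic.abs_eq) (simp_all only: X(1) padicrel_const diff_conv_add_uminus)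
  moreover have c: "padic_cauchy CARD('p) (\<lambda>n. X n - X N)"
    using X by (simp add: padicrel_def padic_cauchy_def)
  then have "padicrel CARD('p) (\<lambda>n. X n - X N) (\<lambda>n. X n - X N)"
    by (simp add: padicrel_def padic_null_def)
  ultimately have "padic_norm (x - Padic (\<lambda>_. X N)) = lim (\<lambda>n. padic_abs CARD('p) (X n - X N))"
    by (simp add: padic_norm.abs_eq)
  also have "\<dots> \<le> e / 2"
    using padic_abs_LIMSEQ_lim[OF c] by (rule LIMSEQ_le_const2) (use N in \<open>auto intro!: exI[of _ N] less_imp_le\<close>)
  finally show ?thesis using that[of "X N"] assms by simp
qed

lemma countable_dense_padic:
  obtains D :: "'p::prime_type padic set" where "countable D" "\<And>x e. e > 0 \<Longrightarrow> \<exists>d\<in>D. padic_norm (x - d) < e"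
proof (rule that[of "range (\<lambda>r. Padic (\<lambda>_. r))"])
  show "\<exists>d\<in>range (\<lambda>r. Padic (\<lambda>_. r)). padic_norm (x - d) < e" if "e > 0" for x :: "'p padic" and e
    using padic_dense[OF that, of x] by (metis rangeI)
qed auto

text \<open>A rational closer to \<open>x\<close> than the norm of \<open>x\<close> has the same
  norm, by the ultrametric inequality, and for rationals the norm is a power of p by
  definition.\<close>

lemma padic_norm_eq_powi:
  fixes x :: "'p::prime_type padic"
  assumes "x \<noteq> 0"
  obtains k where "padic_norm x = real CARD('p) powi k"
proof -
  have "padic_norm x > 0" using assms by (simp add: less_le)
  then obtain r where r: "padic_norm (x - Padic (\<lambda>_. r)) < padic_norm x"
    using padic_dense by metis
  have "padic_norm (x + - (x - Padic (\<lambda>_. r))) = padic_norm x"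
    by (rule padic_norm_add_eq) (use r in \<open>simp only: padic_norm_minus\<close>)
  then have e: "padic_norm x = padic_abs CARD('p) r"
    by (simp add: padic_norm_Padic_const)
  then have "r \<noteq> 0" using assms by auto
  then show ?thesis using that e by (simp add: padic_abs_def)
qed

section \<open>Fractional ideals and residues modulo p\<close>

text \<open>The fractional ideal \<open>p\<^sup>k O\<close> of the ring \<open>O\<close> of p-adic integers.\<close>

definition pideal :: "int \<Rightarrow> 'p::prime_type padic set" where
  "pideal k = {x. padic_norm x \<le> real CARD('p) powi (- k)}"

lemma pideal_0_iff: "x \<in> pideal 0 \<longleftrightarrow> padic_norm x \<le> 1"
  by (simp add: pideal_def)

lemma zero_in_pideal [simp]: "0 \<in> pideal k"
  by (simp add: pideal_def)

lemma one_in_pideal [simp]: "1 \<in> pideal 0"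
  by (simp add: pideal_def)

lemma pideal_add: "x \<in> pideal k \<Longrightarrow> y \<in> pideal k \<Longrightarrow> x + y \<in> pideal k"
  using padic_norm_ultra[of x y] by (auto simp: pideal_def)

lemma pideal_minus [simp]: "- x \<in> pideal k \<longleftrightarrow> x \<in> pideal k"
  by (simp add: pideal_def)

lemma pideal_diff: "x \<in> pideal k \<Longrightarrow> y \<in> pideal k \<Longrightarrow> x - y \<in> pideal k"
  using padic_norm_diff[of x y] by (auto simp: pideal_def)

lemma pideal_diff_commute: "x - y \<in> pideal k \<longleftrightarrow> y - x \<in> pideal k"
  by (metis minus_diff_eq pideal_minus)

lemma pideal_sum: "(\<And>i. i \<in> A \<Longrightarrow> f i \<in> pideal k) \<Longrightarrow> sum f A \<in> pideal k"
  by (induction A rule: infinite_finite_induct) (auto intro: pideal_add)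

lemma pideal_mult: "x \<in> pideal k \<Longrightarrow> y \<in> pideal l \<Longrightarrow> x * y \<in> pideal (k + l)"
  unfolding pideal_def padic_norm_mult mem_Collect_eq minus_add_distrib
  by (subst power_int_add) (auto intro: mult_mono)

lemma pideal_mult_left: "x \<in> pideal 0 \<Longrightarrow> y \<in> pideal k \<Longrightarrow> x * y \<in> pideal k"
  using pideal_mult[of x 0 y k] by simp

lemma pideal_mult_right: "x \<in> pideal k \<Longrightarrow> y \<in> pideal 0 \<Longrightarrow> x * y \<in> pideal k"
  using pideal_mult[of x k y 0] by simp

lemma pideal_prod: "(\<And>i. i \<in> A \<Longrightarrow> f i \<in> pideal 0) \<Longrightarrow> prod f A \<in> pideal 0"
  by (induction A rule: infinite_finite_induct) (auto intro: pideal_mult_left)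

lemma pideal_mono: "x \<in> pideal k \<Longrightarrow> l \<le> k \<Longrightarrow> x \<in> pideal l"
  unfolding pideal_def mem_Collect_eq by (erule order_trans) simp

lemma of_int_in_pideal [simp]: "(of_int i :: 'p::prime_type padic) \<in> pideal 0"
proof (cases "i = 0")
  case False
  then have "padic_norm (of_int i :: 'p padic) \<le> real CARD('p) powi (- 0)"
    unfolding padic_norm_of_int padic_abs_of_int[OF False] CARD_powi_le_iff by simp
  then show ?thesis unfolding pideal_def by blast
qed simp

lemma of_nat_in_pideal [simp]: "of_nat i \<in> pideal 0"
  using of_int_in_pideal[of "int i"] by simp

lemma unif_powi_in_pideal: "unif powi k \<in> pideal k"
  by (simp add: pideal_def padic_norm_unif_powi)

lemma unif_powi_mult_in_pideal_iff: "unif powi k * x \<in> pideal (k + l) \<longleftrightarrow> x \<in> pideal l"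
proof
  assume "unif powi k * x \<in> pideal (k + l)"
  then have "unif powi (- k) * (unif powi k * x) \<in> pideal (- k + (k + l))"
    by (rule pideal_mult[OF unif_powi_in_pideal])
  moreover have "unif powi (- k) * (unif powi k * x) = x"
    by (simp add: power_int_minus flip: mult.assoc)
  ultimately show "x \<in> pideal l" by (simp only: minus_add_cancel)
qed (intro pideal_mult unif_powi_in_pideal)

lemma in_some_pideal:
  fixes x :: "'p::prime_type padic"
  obtains N :: nat where "x \<in> pideal (- int N)"
proof (cases "x = 0")
  case False
  then obtain k where k: "padic_norm x = real CARD('p) powi k" by (rule padic_norm_eq_powi)
  show ?thesis by (rule that[of "nat k"]) (simp add: pideal_def k)
qed (use that in simp)

text \<open>The norm takes only powers of p as nonzero values, so below 1 the next value is
  1/p.\<close>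

lemma padic_norm_less_1_iff: "padic_norm (x :: 'p::prime_type padic) < 1 \<longleftrightarrow> x \<in> pideal 1"
proof (cases "x = 0")
  case False
  then obtain k where k: "padic_norm x = real CARD('p) powi k" by (rule padic_norm_eq_powi)
  have "real CARD('p) powi k < real CARD('p) powi 0 \<longleftrightarrow> real CARD('p) powi k \<le> real CARD('p) powi (-1)"
    unfolding CARD_powi_less_iff CARD_powi_le_iff by auto
  then show ?thesis by (simp add: pideal_def k)
qed (simp)

lemma of_int_in_pideal_iff: "(of_int i :: 'p::prime_type padic) \<in> pideal (int k) \<longleftrightarrow> int CARD('p) ^ k dvd i"
proof (cases "i = 0")
  case False
  have "\<not> is_unit (int CARD('p))" using CARD_gt_1[where 'p='p] by auto
  then have "int CARD('p) ^ k dvd i \<longleftrightarrow> k \<le> multiplicity (int CARD('p)) i"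
    using False by (simp add: power_dvd_iff_le_multiplicity)
  then show ?thesis using False
    by (simp add: pideal_def padic_norm_of_int padic_abs_of_int del: power_int_of_nat)
qed simp

text \<open>The residue field of O is that of the integers. Modulo \<open>pideal 1\<close> one may
  replace \<open>x\<close> by a rational in lowest terms; being integral, it has a denominator prime
  to p, which can be inverted modulo p.\<close>

lemma residue_exists:
  fixes x :: "'p::prime_type padic"
  assumes "x \<in> pideal 0"
  obtains c :: nat where "c < CARD('p)" "x - of_nat c \<in> pideal 1"
proof -
  obtain r where r: "padic_norm (x - Padic (\<lambda>_. r)) < 1" using padic_dense[of 1 x] by auto
  define y where "y = (Padic (\<lambda>_. r) :: 'p padic)"
  have xy: "x - y \<in> pideal 1" using r by (simp add: y_def padic_norm_less_1_iff)
  then have "y \<in> pideal 0"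
    using pideal_diff[OF assms, of "x - y"] pideal_mono[of "x - y" 1 0] by simp
  obtain a b where ab: "quotient_of r = (a, b)" by (cases "quotient_of r")
  have b: "b > 0" and cop: "coprime a b" and req: "r = of_int a / of_int b"
    using ab quotient_of_denom_pos quotient_of_coprime quotient_of_div by blast+
  have pp: "prime (int CARD('p))" using prime_CARD by simp
  have yb: "y * of_int b = of_int a"
    unfolding y_def of_int_eq_Padic using b by (simp add: times_padic.abs_eq padicrel_const req)
  have "\<not> int CARD('p) dvd b"
  proof
    assume d: "int CARD('p) dvd b"
    then have "(of_int b :: 'p padic) \<in> pideal (int 1)" by (simp only: of_int_in_pideal_iff power_one_right)
    then have "(of_int a :: 'p padic) \<in> pideal (int 1)"
      using pideal_mult_left[OF \<open>y \<in> pideal 0\<close>] yb by metis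
    then have "int CARD('p) dvd a" by (simp only: of_int_in_pideal_iff power_one_right)
    then show False using d cop pp by (meson coprime_common_divisor not_prime_unit)
  qed
  then have "coprime b (int CARD('p))" using prime_imp_coprime[OF pp] by (simp add: coprime_commute)
  then obtain u v where v: "u * int CARD('p) + v * b = 1"
    using bezout_int[of "int CARD('p)" b] by (metis coprime_commute coprime_iff_gcd_eq_1)
  \<comment> \<open>By Bezout \<open>v\<close> inverts the denominator \<open>b\<close> modulo p, so
    \<open>a * v\<close> is an integer congruent to \<open>a / b\<close>; \<open>c\<close> is its
    residue.\<close>
  define c where "c = nat ((a * v) mod int CARD('p))"
  have cI: "int c = (a * v) mod int CARD('p)" by (simp add: c_def)
  have "b * v - 1 = int CARD('p) * - u" using v by (simp add: algebra_simps)
  then have "int CARD('p) dvd b * v - 1" by (metis dvd_triv_left)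
  then have 1: "(of_int (b * v - 1) :: 'p padic) \<in> pideal (int 1)" by (simp only: of_int_in_pideal_iff power_one_right)
  have "int CARD('p) dvd a * v - int c" unfolding cI by (rule dvd_minus_mod)
  then have 2: "(of_int (a * v - int c) :: 'p padic) \<in> pideal (int 1)" by (simp only: of_int_in_pideal_iff power_one_right)
  have e: "y - of_nat c = of_int (a * v - int c) - y * of_int (b * v - 1)"
    using yb by (simp add: algebra_simps)
  have "y - of_nat c \<in> pideal 1"
    using pideal_diff[OF 2 pideal_mult_left[OF \<open>y \<in> pideal 0\<close> 1]] unfolding e[symmetric] by simp
  then have "x - of_nat c \<in> pideal 1" using pideal_add[OF xy, of "y - of_nat c"] by simp
  moreover have "c < CARD('p)"
    using cI CARD_gt_1[where 'p='p] by (metis of_nat_0_less_iff of_nat_less_iff pos_mod_bound zero_less_card_finite)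
  ultimately show ?thesis by (rule that[rotated])
qed

lemma residue_unique:
  fixes c d :: nat
  assumes "c < CARD('p)" "d < CARD('p)" "(of_nat c - of_nat d :: 'p::prime_type padic) \<in> pideal 1"
  shows "c = d"
proof -
  have "(of_int (int c - int d) :: 'p padic) \<in> pideal (int 1)" using assms(3) by simp
  then have "int CARD('p) dvd int c - int d" by (simp only: of_int_in_pideal_iff power_one_right)
  then show ?thesis
    using assms(1,2) zdvd_not_zless[of "int c - int d" "int CARD('p)"] zdvd_not_zless[of "int d - int c" "int CARD('p)"]
      dvd_diff_commute[of "int CARD('p)" "int c" "int d"]
    by (cases c d rule: linorder_cases) auto
qed

lemma residue_exists_scaled:
  fixes x :: "'p::prime_type padic"
  assumes "x \<in> pideal k"
  obtains c :: nat where "c < CARD('p)" "x - of_nat c * unif powi k \<in> pideal (k + 1)"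
proof -
  have "unif powi (- k) * x \<in> pideal (- k + k)" using assms by (intro pideal_mult unif_powi_in_pideal)
  then obtain c :: nat where c: "c < CARD('p)" "unif powi (- k) * x - of_nat c \<in> pideal 1"
    using residue_exists by auto
  then have "unif powi k * (unif powi (- k) * x - of_nat c) \<in> pideal (k + 1)"
    by (intro pideal_mult unif_powi_in_pideal)
  then show ?thesis using c(1) by (intro that[of c]) (simp_all add: algebra_simps power_int_minus)
qed

section \<open>Integral matrices\<close>

definition mideal :: "int \<Rightarrow> ('p::prime_type padic ^ 'n ^ 'm) set" where
  "mideal k = {A. \<forall>i j. A $ i $ j \<in> pideal k}"

lemma integral_matrices_eq_mideal: "integral_matrices = mideal 0"
  by (simp add: integral_matrices_def mideal_def pideal_0_iff)

lemma zero_in_mideal [simp]: "0 \<in> mideal k"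
  by (simp add: mideal_def)

lemma mat_1_in_mideal [simp]: "mat 1 \<in> mideal 0"
  by (simp add: mideal_def mat_def)

lemma mideal_add: "A \<in> mideal k \<Longrightarrow> B \<in> mideal k \<Longrightarrow> A + B \<in> mideal k"
  by (simp add: mideal_def pideal_add)

lemma mideal_diff: "A \<in> mideal k \<Longrightarrow> B \<in> mideal k \<Longrightarrow> A - B \<in> mideal k"
  by (simp add: mideal_def pideal_diff)

lemma mideal_minus [simp]: "- A \<in> mideal k \<longleftrightarrow> A \<in> mideal k"
  by (simp add: mideal_def)

lemma mideal_mono: "A \<in> mideal k \<Longrightarrow> l \<le> k \<Longrightarrow> A \<in> mideal l"
  by (auto simp: mideal_def intro: pideal_mono)

lemma mideal_mult:
  fixes A :: "'p::prime_type padic ^ 'n::finite ^ 'm"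
  shows "A \<in> mideal k \<Longrightarrow> B \<in> mideal l \<Longrightarrow> A ** B \<in> mideal (k + l)"
  by (auto simp: mideal_def matrix_matrix_mult_def intro!: pideal_sum pideal_mult)

lemma mideal_mult_left:
  fixes A :: "'p::prime_type padic ^ 'n::finite ^ 'm"
  shows "A \<in> mideal 0 \<Longrightarrow> B \<in> mideal k \<Longrightarrow> A ** B \<in> mideal k"
  using mideal_mult[of A 0 B k] by simp

lemma mideal_mult_right:
  fixes A :: "'p::prime_type padic ^ 'n::finite ^ 'm"
  shows "A \<in> mideal k \<Longrightarrow> B \<in> mideal 0 \<Longrightarrow> A ** B \<in> mideal k"
  using mideal_mult[of A k B 0] by simp

lemma in_some_mideal:
  fixes A :: "'p::prime_type padic ^ 'n::finite ^ 'm::finite"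
  obtains N :: nat where "A \<in> mideal (- int N)"
proof -
  have "\<exists>N::nat. A $ i $ j \<in> pideal (- int N)" for i j using in_some_pideal by metis
  then obtain f where f: "\<And>i j. A $ i $ j \<in> pideal (- int (f i j :: nat))" by metis
  define N where "N = (\<Sum>i\<in>UNIV. \<Sum>j\<in>UNIV. f i j)"
  have "A $ i $ j \<in> pideal (- int N)" for i j
  proof (rule pideal_mono[OF f])
    have "f i j \<le> (\<Sum>j\<in>UNIV. f i j)" by (rule member_le_sum) auto
    also have "\<dots> \<le> (\<Sum>i\<in>UNIV. \<Sum>j\<in>UNIV. f i j)"
      by (rule member_le_sum[of i UNIV "\<lambda>i. \<Sum>j\<in>UNIV. f i j"]) auto
    finally show "- int N \<le> - int (f i j)" unfolding N_def by linarith
  qed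
  then show ?thesis by (intro that[of N]) (auto simp: mideal_def)
qed

lemma det_in_pideal: "A \<in> mideal 0 \<Longrightarrow> det A \<in> pideal 0"
  unfolding det_def mideal_def by (intro pideal_sum pideal_mult_left pideal_prod) auto

lemma prod_diff_in_pideal:
  assumes "\<And>i. i \<in> S \<Longrightarrow> f i \<in> pideal 0" "\<And>i. i \<in> S \<Longrightarrow> g i \<in> pideal 0"
    "\<And>i. i \<in> S \<Longrightarrow> f i - g i \<in> pideal k"
  shows "prod f S - prod g S \<in> pideal k"
  using assms
proof (induction S rule: infinite_finite_induct)
  case (insert x S)
  have "f x * prod f S - g x * prod g S = f x * (prod f S - prod g S) + (f x - g x) * prod g S"
    by (simp add: algebra_simps)
  also have "\<dots> \<in> pideal k"
    using insert.prems insert.IH by (intro pideal_add pideal_mult_left pideal_mult_right pideal_prod) auto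
  finally show ?case using insert.hyps by simp
qed auto

text \<open>The determinant is a polynomial with integer coefficients, hence respects congruences
  modulo \<open>pideal k\<close> between integral matrices.\<close>

lemma det_diff_in_pideal:
  assumes "A \<in> mideal 0" "B \<in> mideal 0" "A - B \<in> mideal k"
  shows "det A - det B \<in> pideal k"
proof -
  have "det A - det B = (\<Sum>p\<in>{p. p permutes UNIV}. of_int (sign p) *
      ((\<Prod>i\<in>UNIV. A $ i $ p i) - (\<Prod>i\<in>UNIV. B $ i $ p i)))"
    by (simp add: det_def right_diff_distrib sum_subtractf)
  also have "\<dots> \<in> pideal k"
    using assms by (intro pideal_sum pideal_mult_left prod_diff_in_pideal) (auto simp: mideal_def)
  finally show ?thesis .
qed

lemma matrix_inv_det:
  fixes A :: "'a::field ^ 'n ^ 'n"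
  assumes "det A \<noteq> 0"
  shows "A ** matrix_inv A = mat 1" "matrix_inv A ** A = mat 1"
proof -
  have "\<exists>B. A ** B = mat 1 \<and> B ** A = mat 1"
    using assms invertible_det_nz[of A] by (simp add: invertible_def)
  then have "A ** matrix_inv A = mat 1 \<and> matrix_inv A ** A = mat 1"
    unfolding matrix_inv_def by (rule someI_ex)
  then show "A ** matrix_inv A = mat 1" "matrix_inv A ** A = mat 1" by auto
qed

lemma matrix_inverse_det:
  fixes A B :: "'a::field ^ 'n ^ 'n"
  assumes "A ** B = mat 1"
  shows "det A \<noteq> 0" "det B \<noteq> 0" "B ** A = mat 1" "matrix_inv A = B"
proof -
  have "det A * det B = 1" using arg_cong[OF assms, of det] by (simp add: det_mul)
  then show d: "det A \<noteq> 0" "det B \<noteq> 0" by auto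
  show e: "matrix_inv A = B"
    by (metis assms d(1) matrix_inv_det(2) matrix_mul_assoc matrix_mul_lid matrix_mul_rid)
  show "B ** A = mat 1" using matrix_inv_det(2)[OF d(1)] e by simp
qed

text \<open>From left to right, two integral determinants with product 1 are units. Conversely
  Cramer's rule writes each entry of the inverse as an integral determinant divided by the unit
  \<open>det A\<close>.\<close>

lemma GL_integral_iff:
  fixes A :: "'p::prime_type padic ^ 'n ^ 'n"
  shows "A \<in> GL_integral \<longleftrightarrow> A \<in> mideal 0 \<and> padic_norm (det A) = 1"
proof
  assume "A \<in> GL_integral"
  then obtain B where B: "A \<in> mideal 0" "B \<in> mideal 0" "A ** B = mat 1"
    by (auto simp: GL_integral_def integral_matrices_eq_mideal)
  have "det A * det B = 1" using arg_cong[OF B(3), of det] by (simp add: det_mul)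
  then have "padic_norm (det A) * padic_norm (det B) = 1" by (metis padic_norm_1 padic_norm_mult)
  moreover have "padic_norm (det A) \<le> 1" "padic_norm (det B) \<le> 1"
    using B det_in_pideal pideal_0_iff by blast+
  ultimately have "padic_norm (det A) = 1"
    by (smt (verit) mult_left_le padic_norm_nonneg)
  then show "A \<in> mideal 0 \<and> padic_norm (det A) = 1" using B(1) by simp
next
  assume A: "A \<in> mideal 0 \<and> padic_norm (det A) = 1"
  then have nz: "det A \<noteq> 0" by auto
  define B where "B = matrix_inv A"
  have AB: "A ** B = mat 1" "B ** A = mat 1" using matrix_inv_det[OF nz] by (auto simp: B_def)
  have "B $ k $ l \<in> pideal 0" for k l
  proof -
    define e where "e = (\<chi> i. (mat 1 :: 'p padic ^ 'n ^ 'n) $ i $ l)"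
    have "A *v (\<chi> i. B $ i $ l) = e"
      using AB(1) by (auto simp: e_def matrix_vector_mult_def matrix_matrix_mult_def vec_eq_iff)
    then have "(\<chi> i. B $ i $ l) = (\<chi> k. det (\<chi> i j. if j = k then e $ i else A $ i $ j) / det A)"
      using cramer[OF nz] by blast
    then have "B $ k $ l = det (\<chi> i j. if j = k then e $ i else A $ i $ j) / det A"
      by (simp add: vec_eq_iff)
    moreover have "det (\<chi> i j. if j = k then e $ i else A $ i $ j) \<in> pideal 0"
      by (rule det_in_pideal) (use A in \<open>auto simp: mideal_def mat_def e_def\<close>)
    ultimately show ?thesis
      using A by (simp add: pideal_0_iff padic_norm_divide)
  qed
  then show "A \<in> GL_integral"
    using AB A by (auto simp: GL_integral_def integral_matrices_eq_mideal mideal_def)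
qed

lemma GL_integral_D:
  fixes A :: "'p::prime_type padic ^ 'n ^ 'n"
  assumes "A \<in> GL_integral"
  shows "A \<in> mideal 0" "padic_norm (det A) = 1" "det A \<noteq> 0" "matrix_inv A \<in> GL_integral"
    "A ** matrix_inv A = mat 1" "matrix_inv A ** A = mat 1"
proof -
  show 1: "A \<in> mideal 0" "padic_norm (det A) = 1" using assms by (auto simp: GL_integral_iff)
  then show 2: "det A \<noteq> 0" by auto
  show 3: "A ** matrix_inv A = mat 1" "matrix_inv A ** A = mat 1" by (rule matrix_inv_det[OF 2])+
  obtain B where B: "B \<in> integral_matrices" "A ** B = mat 1" "B ** A = mat 1"
    using assms by (auto simp: GL_integral_def)
  then have "matrix_inv A = B" by (metis matrix_inverse_det(4))
  then show "matrix_inv A \<in> GL_integral"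
    using B assms by (auto simp: GL_integral_def)
qed

lemma mat_1_in_GL_integral [simp]: "mat 1 \<in> GL_integral"
  by (simp add: GL_integral_iff)

lemma GL_integral_mult: "A \<in> GL_integral \<Longrightarrow> B \<in> GL_integral \<Longrightarrow> A ** B \<in> GL_integral"
  by (simp add: GL_integral_iff mideal_mult_left det_mul padic_norm_mult)

lemma padic_norm_1_cong: "padic_norm y = 1" if "padic_norm x = 1" "x - y \<in> pideal 1"
proof -
  have "padic_norm (x + - (x - y)) = padic_norm x"
    by (rule padic_norm_add_eq) (use that in \<open>simp only: padic_norm_minus padic_norm_less_1_iff\<close>)
  then show ?thesis using that by simp
qed

lemma mat_1_plus_in_GL_integral:
  fixes A :: "'p::prime_type padic ^ 'n ^ 'n"
  assumes "A \<in> mideal 1"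
  shows "mat 1 + A \<in> GL_integral"
proof -
  have I: "mat 1 + A \<in> mideal 0" using assms mideal_mono[of A 1 0] by (intro mideal_add) auto
  have "det (mat 1 :: 'p padic ^ 'n ^ 'n) - det (mat 1 + A) \<in> pideal 1"
    by (rule det_diff_in_pideal) (use I assms in auto)
  then show ?thesis using I padic_norm_1_cong[of "det (mat 1 :: 'p padic ^ 'n ^ 'n)"] by (auto simp: GL_integral_iff)
qed

lemma matrix_minus_ldistrib: "A ** (B - C) = A ** B - A ** (C :: 'a::ring_1 ^ 'n ^ 'm)"
  by (simp add: matrix_matrix_mult_def vec_eq_iff right_diff_distrib sum_subtractf)

lemma matrix_minus_rdistrib: "(B - C) ** A = B ** A - (C :: 'a::ring_1 ^ 'n ^ 'm) ** A"
  by (simp add: matrix_matrix_mult_def vec_eq_iff left_diff_distrib sum_subtractf)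

lemma matrix_add_rdistrib: "(B + C) ** A = B ** A + (C :: 'a::semiring_1 ^ 'n ^ 'm) ** A"
  by (simp add: matrix_matrix_mult_def vec_eq_iff distrib_right sum.distrib)

section \<open>Balls and Borel measures\<close>

text \<open>Balls for the supremum of the entrywise norms: these are cosets of the subgroup
  \<open>mideal (int k)\<close>. Balls of the Euclidean product metric of the library need not be
  cosets.\<close>

definition mball :: "'p::prime_type padic ^ 'n ^ 'm \<Rightarrow> nat \<Rightarrow> ('p padic ^ 'n ^ 'm) set" where
  "mball z k = {w. w - z \<in> mideal (int k)}"

lemma mball_center [simp]: "z \<in> mball z k"
  by (simp add: mball_def)

lemma mball_sub: "w \<in> mball z k \<Longrightarrow> k \<le> l \<Longrightarrow> mball w l \<subseteq> mball z k"
  unfolding mball_def using mideal_add[of _ "int k"] mideal_mono[of _ "int l" "int k"]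
  by (smt (verit, ccfv_SIG) diff_add_cancel diff_add_eq mem_Collect_eq of_nat_mono subsetI add_diff_eq)

lemma mball_sym: "w \<in> mball z k \<longleftrightarrow> z \<in> mball w k"
  unfolding mball_def by (metis mem_Collect_eq mideal_minus minus_diff_eq)

lemma mball_eq: "w \<in> mball z k \<Longrightarrow> mball w k = mball z k"
  using mball_sub[of w z k k] mball_sub[of z w k k] mball_sym[of w z k] by auto

lemma mball_nested:
  assumes "mball z k \<inter> mball w l \<noteq> {}" "k \<le> l"
  shows "mball w l \<subseteq> mball z k"
  using assms mball_eq mball_sub by blast

lemma mball_0: "mball 0 k = mideal (int k)"
  by (simp add: mball_def)

lemma mball_eq_image: "mball z k = (\<lambda>w. z + w) ` mideal (int k)"
proof -
  have "w \<in> (\<lambda>w. z + w) ` mideal (int k)" if "w - z \<in> mideal (int k)" for w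
    by (rule image_eqI[OF _ that]) simp
  then show ?thesis by (auto simp: mball_def)
qed

lemma CARD_powi_small:
  assumes "e > 0"
  obtains k :: nat where "real CARD('p::prime_type) powi (- int k) < e"
proof -
  have "inverse (real CARD('p)) < 1" using CARD_gt_1[where 'p='p] by (simp add: inverse_less_1_iff)
  then obtain k where "inverse (real CARD('p)) ^ k < e"
    using real_arch_pow_inv[OF assms] by blast
  then show ?thesis by (intro that[of k]) (simp add: power_int_minus power_inverse)
qed

text \<open>The topology comes with the Euclidean product metric; this is the passage to entrywise
  balls, used in all later openness and measurability arguments.\<close>

lemma open_matrix_iff:
  fixes S :: "('p::prime_type padic ^ 'n ^ 'm) set"
  shows "open S \<longleftrightarrow> (\<forall>z\<in>S. \<exists>k. mball z k \<subseteq> S)"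
proof safe
  fix z assume "open S" "z \<in> S"
  then obtain e where e: "e > 0" "\<And>w. dist w z < e \<Longrightarrow> w \<in> S"
    unfolding open_dist by blast
  \<comment> \<open>The number of entries: the Euclidean distance is at most the sum of the entry
    distances.\<close>
  let ?N = "real CARD('n) * real CARD('m)"
  obtain k where k: "real CARD('p) powi (- int k) < e / ?N"
    using CARD_powi_small[of "e / ?N"] e(1) by auto
  have "w \<in> S" if "w \<in> mball z k" for w
  proof (rule e)
    have *: "dist (w $ i $ j) (z $ i $ j) \<le> real CARD('p) powi (- int k)" for i j
      using that by (simp add: mball_def mideal_def pideal_def dist_padic_def)
    have "dist (w $ i) (z $ i) \<le> real CARD('n) * real CARD('p) powi (- int k)" for i
    proof -
      have "dist (w $ i) (z $ i) \<le> (\<Sum>j\<in>UNIV. dist (w $ i $ j) (z $ i $ j))"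
        unfolding dist_vec_def by (rule L2_set_le_sum) simp
      also have "\<dots> \<le> (\<Sum>j\<in>(UNIV::'n set). real CARD('p) powi (- int k))"
        by (rule sum_mono) (rule *)
      finally show ?thesis by simp
    qed
    moreover have "dist w z \<le> (\<Sum>i\<in>UNIV. dist (w $ i) (z $ i))"
      unfolding dist_vec_def[of w z] by (rule L2_set_le_sum) simp
    ultimately have "dist w z \<le> (\<Sum>i\<in>(UNIV::'m set). real CARD('n) * real CARD('p) powi (- int k))"
      by (meson order_trans sum_mono)
    also have "\<dots> = ?N * real CARD('p) powi (- int k)" by simp
    also have "\<dots> < e" using k by (simp add: pos_less_divide_eq mult.commute)
    finally show "dist w z < e" .
  qed
  then show "\<exists>k. mball z k \<subseteq> S" by blast
next
  assume S: "\<forall>z\<in>S. \<exists>k. mball z k \<subseteq> S"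
  show "open S" unfolding open_dist
  proof
    fix z assume "z \<in> S"
    then obtain k where k: "mball z k \<subseteq> S" using S by blast
    have "w \<in> S" if "dist w z < real CARD('p) powi (- int k)" for w
    proof -
      have "dist (w $ i $ j) (z $ i $ j) \<le> dist w z" for i j
        by (rule order_trans[OF dist_vec_nth_le dist_vec_nth_le])
      then have "w \<in> mball z k"
        using that by (auto simp: mball_def mideal_def pideal_def dist_padic_def intro: order_trans[OF _ less_imp_le])
      then show ?thesis using k by blast
    qed
    then show "\<exists>e>0. \<forall>w. dist w z < e \<longrightarrow> w \<in> S"
      by (intro exI[of _ "real CARD('p) powi (- int k)"]) auto
  qed
qed

lemma open_mball: "open (mball z k)"
  unfolding open_matrix_iff using mball_eq by blast

lemma mball_borel [measurable, simp]: "mball z k \<in> sets borel"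
  by (intro borel_open open_mball)

lemma countable_vec:
  assumes "countable D"
  shows "countable {v :: 'a ^ 'n. \<forall>i. v $ i \<in> D}"
proof (rule countable_subset)
  show "countable (vec_lambda ` (PiE (UNIV :: 'n set) (\<lambda>_. D)))"
    using assms by (intro countable_image countable_PiE) auto
  show "{v :: 'a ^ 'n. \<forall>i. v $ i \<in> D} \<subseteq> vec_lambda ` (PiE (UNIV :: 'n set) (\<lambda>_. D))"
  proof
    fix v :: "'a ^ 'n" assume "v \<in> {v. \<forall>i. v $ i \<in> D}"
    then show "v \<in> vec_lambda ` (PiE UNIV (\<lambda>_. D))"
      by (intro image_eqI[of _ _ "vec_nth v"]) auto
  qed
qed

lemma countable_dense_matrices:
  obtains D :: "('p::prime_type padic ^ 'n ^ 'm) set"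
  where "countable D" "\<And>z k. \<exists>d\<in>D. d \<in> mball z k"
proof -
  obtain E :: "'p padic set" where E: "countable E" "\<And>x e. e > 0 \<Longrightarrow> \<exists>d\<in>E. padic_norm (x - d) < e"
    by (rule countable_dense_padic) blast
  let ?D = "{v :: 'p padic ^ 'n ^ 'm. \<forall>i. v $ i \<in> {v. \<forall>j. v $ j \<in> E}}"
  show ?thesis
  proof (rule that[of ?D])
    show "countable ?D" by (intro countable_vec E)
    fix z :: "'p padic ^ 'n ^ 'm" and k :: nat
    have "\<forall>i j. \<exists>d\<in>E. padic_norm (z $ i $ j - d) < real CARD('p) powi (- int k)"
      using E(2) by (meson CARD_powi_pos)
    then obtain d where d: "\<And>i j. d i j \<in> E" "\<And>i j. padic_norm (z $ i $ j - d i j) < real CARD('p) powi (- int k)"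
      by metis
    have "d i j - z $ i $ j \<in> pideal (int k)" for i j
      using d(2)[of i j] by (subst pideal_diff_commute) (simp add: pideal_def)
    then have "(\<chi> i j. d i j) \<in> mball z k" by (simp add: mball_def mideal_def)
    then show "\<exists>d\<in>?D. d \<in> mball z k" using d(1) by (intro bexI[of _ "\<chi> i j. d i j"]) auto
  qed
qed

text \<open>The predicate \<open>good\<close> singles out, around every point of \<open>U\<close>, all sufficiently small
  balls; together with the Borel subsets of the complement of \<open>U\<close> they form a generator of
  the Borel sets that is stable under intersections.\<close>

lemma emeasure_eq_on_good_balls:
  fixes M N :: "('p::prime_type padic ^ 'n ^ 'm) measure"
  assumes sets: "sets M = sets borel" "sets N = sets borel"
    and ex: "\<And>z. z \<in> U \<Longrightarrow> \<exists>k. good z k"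
    and sub: "\<And>z k. good z k \<Longrightarrow> mball z k \<subseteq> U"
    and her: "\<And>z k w l. good z k \<Longrightarrow> w \<in> mball z k \<Longrightarrow> k \<le> l \<Longrightarrow> good w l"
    and eq: "\<And>z k. good z k \<Longrightarrow> emeasure M (mball z k) = emeasure N (mball z k)"
    and fin: "\<And>z k. good z k \<Longrightarrow> emeasure M (mball z k) \<noteq> \<infinity>"
    and B: "B \<in> sets borel" "B \<subseteq> U"
  shows "emeasure M B = emeasure N B"
proof -
  obtain D :: "('p padic ^ 'n ^ 'm) set" where D: "countable D" "\<And>z k. \<exists>d\<in>D. d \<in> mball z k"
    by (rule countable_dense_matrices) blast
  \<comment> \<open>Restricting the centers to a countable dense set loses no ball, since every
    point of an ultrametric ball is a center of it.\<close>
  define G where "G = {mball d k | d k. d \<in> D \<and> good d k}"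
  have G_sub: "G \<subseteq> (\<lambda>(d, k). mball d k) ` (D \<times> UNIV)" by (auto simp: G_def)
  have "countable G"
    by (rule countable_subset[OF G_sub]) (intro countable_image countable_SIGMA D(1) countableI_type)
  have G_ex: "\<exists>X\<in>G. z \<in> X \<and> X \<subseteq> mball z l" if "z \<in> U" for z l
  proof -
    have "\<exists>k. good z k" by (rule ex[OF that])
    then obtain k where k: "good z k" by blast
    define m where "m = max k l"
    have m: "good z m" using her[OF k, of z m] by (simp add: m_def)
    obtain d where d: "d \<in> D" "d \<in> mball z m" using D(2) by blast
    then have "mball d m \<in> G" using her[OF m, of d m] by (auto simp: G_def)
    moreover have "mball d m = mball z m" by (rule mball_eq[OF d(2)])
    moreover have "mball z m \<subseteq> mball z l" by (rule mball_sub) (auto simp: m_def)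
    ultimately show ?thesis using mball_center by metis
  qed
  have U_eq: "U = \<Union>G" using G_ex sub by (fastforce simp: G_def)
  have G_open: "open X" if "X \<in> G" for X using that open_mball by (auto simp: G_def)
  then have "open U" unfolding U_eq by blast
  then have Ub [measurable]: "U \<in> sets borel" by simp
  define E where "E = {mball z k | z k. good z k} \<union> {X \<in> sets borel. X \<subseteq> - U}"
  have empty: "{} \<in> E" by (simp add: E_def)
  have ball_Int: "mball z k \<inter> mball w l \<in> E" if "good z k" "good w l" for z k w l
  proof (cases "mball z k \<inter> mball w l = {}")
    case False
    then have "mball w l \<subseteq> mball z k \<or> mball z k \<subseteq> mball w l"
      using mball_nested[of z k w l] mball_nested[of w l z k] by (cases "k \<le> l") auto
    then have "mball z k \<inter> mball w l = mball w l \<or> mball z k \<inter> mball w l = mball z k" by blast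
    then show ?thesis using that by (auto simp: E_def)
  qed (use empty in simp)
  have stable: "Int_stable E"
  proof (rule Int_stableI)
    fix X Y assume XY: "X \<in> E" "Y \<in> E"
    consider "X \<subseteq> - U" "X \<in> sets borel" | "Y \<subseteq> - U" "Y \<in> sets borel"
      | z k w l where "X = mball z k" "good z k" "Y = mball w l" "good w l"
      using XY by (auto simp: E_def)
    then show "X \<inter> Y \<in> E"
    proof cases
      case 3
      then show ?thesis using ball_Int by simp
    qed (use XY in \<open>auto simp: E_def intro!: sets.Int\<close>)
  qed
  have E_borel: "E \<subseteq> sets borel" by (auto simp: E_def)
  have G_E: "G \<subseteq> E" by (auto simp: G_def E_def)
  interpret sig: sigma_algebra UNIV "sigma_sets UNIV E" by (rule sigma_algebra_sigma_sets) auto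
  have gen: "sets borel = sigma_sets UNIV E"
  proof
    show "sigma_sets UNIV E \<subseteq> sets (borel :: ('p padic ^ 'n ^ 'm) measure)"
      using sets.sigma_sets_subset[OF E_borel] by simp
    have "O' \<in> sigma_sets UNIV E" if "open O'" for O'
    proof -
      \<comment> \<open>The family \<open>G\<close> is countable and contains a neighborhood base at
        each point of \<open>U\<close>, so the part of an open set inside \<open>U\<close> is a
        countable union of balls. The rest belongs to the second kind of generator.\<close>
      have O': "O' = (O' - U) \<union> \<Union>{X \<in> G. X \<subseteq> O'}"
      proof
        show "O' \<subseteq> (O' - U) \<union> \<Union>{X \<in> G. X \<subseteq> O'}"
        proof
          fix z assume z: "z \<in> O'"
          obtain l where "mball z l \<subseteq> O'" using \<open>open O'\<close> z unfolding open_matrix_iff by blast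
          then show "z \<in> (O' - U) \<union> \<Union>{X \<in> G. X \<subseteq> O'}" using G_ex[of z l] z by blast
        qed
      qed auto
      have "O' - U \<in> sigma_sets UNIV E"
        using \<open>open O'\<close> by (intro sigma_sets.Basic) (auto simp: E_def)
      moreover have "\<Union>{X \<in> G. X \<subseteq> O'} \<in> sigma_sets UNIV E"
      proof (rule sig.countable_Union)
        show "countable {X \<in> G. X \<subseteq> O'}" using \<open>countable G\<close> by (rule countable_subset[rotated]) auto
        show "{X \<in> G. X \<subseteq> O'} \<subseteq> sigma_sets UNIV E" using G_E by (auto intro: sigma_sets.Basic)
      qed
      ultimately have "(O' - U) \<union> \<Union>{X \<in> G. X \<subseteq> O'} \<in> sigma_sets UNIV E"
        by (intro sig.Un)
      then show ?thesis by (simp only: flip: O')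
    qed
    then have "sigma_sets UNIV {S. open S} \<subseteq> sigma_sets UNIV E"
      by (intro sig.sigma_sets_subset) auto
    then show "sets borel \<subseteq> sigma_sets UNIV E"
      by (simp add: borel_def sets_measure_of)
  qed
  \<comment> \<open>Both measures are cut down to \<open>U\<close>, so that they vanish, and hence
    agree, on the generators outside \<open>U\<close>; uniqueness of measures then applies on the
    whole space.\<close>
  define M' where "M' = density M (indicator U)"
  define N' where "N' = density N (indicator U)"
  have ind [measurable]: "indicator U \<in> borel_measurable M" "indicator U \<in> borel_measurable N"
    using sets Ub by (simp_all add: borel_measurable_indicator_iff sets_eq_imp_space_eq)
  have M': "emeasure M' X = emeasure M (U \<inter> X)" if "X \<in> sets borel" for X
    using that sets Ub by (simp add: M'_def emeasure_restricted)
  have N': "emeasure N' X = emeasure N (U \<inter> X)" if "X \<in> sets borel" for X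
    using that sets Ub by (simp add: N'_def emeasure_restricted)
  have "M' = N'"
  proof (rule measure_eqI_generator_eq_countable[OF stable])
    show "E \<subseteq> Pow UNIV" by simp
    show "emeasure M' X = emeasure N' X" if "X \<in> E" for X
    proof -
      have "X \<in> sets borel" using that E_borel by blast
      moreover have "emeasure M (U \<inter> X) = emeasure N (U \<inter> X)"
      proof (cases "X \<subseteq> - U")
        case True
        then have "U \<inter> X = {}" by blast
        then show ?thesis by simp
      next
        case False
        then obtain z k where "X = mball z k" "good z k" using \<open>X \<in> E\<close> by (auto simp: E_def)
        then have "U \<inter> X = mball z k" "emeasure M (mball z k) = emeasure N (mball z k)"
          using sub eq by auto
        then show ?thesis by simp
      qed
      ultimately show ?thesis by (simp add: M' N')
    qed
    show "sets M' = sigma_sets UNIV E" "sets N' = sigma_sets UNIV E"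
      using gen sets by (simp_all add: M'_def N'_def)
    show "insert (- U) G \<subseteq> E" using G_E Ub by (auto simp: E_def)
    show "\<Union>(insert (- U) G) = UNIV"
      unfolding Union_insert U_eq[symmetric] by (rule Compl_partition2)
    show "countable (insert (- U) G)" using \<open>countable G\<close> by simp
    show "emeasure M' X \<noteq> \<infinity>" if X: "X \<in> insert (- U) G" for X
    proof (cases "X = - U")
      case True
      then show ?thesis using Ub by (simp add: M')
    next
      case False
      then obtain z k where "X = mball z k" "good z k" using X by (auto simp: G_def)
      then show ?thesis using sub[of z k] fin[of z k] by (simp add: M' Int_absorb1)
    qed
  qed
  then have "emeasure M' B = emeasure N' B" by simp
  moreover have "U \<inter> B = B" using B by blast
  ultimately show ?thesis using B by (simp add: M' N')
qed

section \<open>Haar measure\<close>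

text \<open>Each entry has its own exponent, because multiplication by diagonal matrices from both
  sides rescales the entries differently.\<close>

definition matbox :: "('m \<Rightarrow> 'n \<Rightarrow> int) \<Rightarrow> ('p::prime_type padic ^ 'n ^ 'm) set" where
  "matbox m = {w. \<forall>i j. w $ i $ j \<in> pideal (m i j)}"

lemma mideal_eq_matbox: "mideal k = matbox (\<lambda>_ _. k)"
  by (simp add: mideal_def matbox_def)

lemma matbox_add: "v \<in> matbox m \<Longrightarrow> w \<in> matbox m \<Longrightarrow> v + w \<in> matbox m"
  by (simp add: matbox_def pideal_add)

lemma matbox_supset_mideal:
  fixes m :: "'m::finite \<Rightarrow> 'n::finite \<Rightarrow> int"
  obtains k :: nat where "mideal (int k) \<subseteq> (matbox m :: ('p::prime_type padic ^ 'n ^ 'm) set)"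
proof -
  define k where "k = (\<Sum>i\<in>UNIV. \<Sum>j\<in>UNIV. nat (m i j))"
  have "m i j \<le> int k" for i j
  proof -
    have "nat (m i j) \<le> (\<Sum>j\<in>UNIV. nat (m i j))" by (rule member_le_sum) auto
    also have "\<dots> \<le> k" unfolding k_def by (rule member_le_sum[of i UNIV "\<lambda>i. \<Sum>j\<in>UNIV. nat (m i j)"]) auto
    finally show ?thesis by linarith
  qed
  then have "w $ i $ j \<in> pideal (m i j)" if "w \<in> mideal (int k)" for w :: "'p padic ^ 'n ^ 'm" and i j
    using that pideal_mono[of "w $ i $ j" "int k" "m i j"] by (simp add: mideal_def)
  then show ?thesis by (intro that[of k]) (auto simp: matbox_def)
qed

lemma open_matbox: "open (matbox m :: ('p::prime_type padic ^ 'n ^ 'm) set)"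
  unfolding open_matrix_iff
proof
  fix z :: "'p padic ^ 'n ^ 'm" assume z: "z \<in> matbox m"
  obtain k :: nat where k: "mideal (int k) \<subseteq> (matbox m :: ('p padic ^ 'n ^ 'm) set)"
    by (rule matbox_supset_mideal)
  have "mball z k \<subseteq> matbox m"
    using k z matbox_add by (fastforce simp: mball_eq_image)
  then show "\<exists>k. mball z k \<subseteq> matbox m" ..
qed

lemma matbox_borel [measurable, simp]: "matbox m \<in> sets borel"
  by (intro borel_open open_matbox)

lemma mideal_borel [measurable, simp]: "mideal m \<in> sets borel"
  by (simp add: mideal_eq_matbox)

lemma translate_image_eq: "(\<lambda>z. x + z) ` B = (\<lambda>z. z - x) -` (B :: 'a::ab_group_add set)"
proof -
  have "z \<in> (\<lambda>z. x + z) ` B" if "z - x \<in> B" for z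
    by (rule image_eqI[OF _ that]) simp
  then show ?thesis by auto
qed

lemma open_translate:
  fixes S :: "('p::prime_type padic ^ 'n ^ 'm) set"
  assumes "open S" shows "open ((\<lambda>z. x + z) ` S)"
  unfolding open_matrix_iff
proof safe
  fix z assume "z \<in> S"
  then obtain k where "mball z k \<subseteq> S" using assms unfolding open_matrix_iff by blast
  then have "mball (x + z) k \<subseteq> (\<lambda>z. x + z) ` S"
    unfolding translate_image_eq mball_def by (auto simp: algebra_simps subset_eq)
  then show "\<exists>k. mball (x + z) k \<subseteq> (\<lambda>z. x + z) ` S" ..
qed

lemma measurable_translate [measurable]:
  "(\<lambda>z. z - x) \<in> borel_measurable (borel :: ('p::prime_type padic ^ 'n ^ 'm) measure)"
proof (rule borel_measurableI)
  fix S :: "('p padic ^ 'n ^ 'm) set" assume "open S"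
  then show "(\<lambda>z. z - x) -` S \<inter> space borel \<in> sets borel"
    using open_translate[of S x] by (simp add: translate_image_eq)
qed

lemma translate_borel:
  fixes B :: "('p::prime_type padic ^ 'n ^ 'm) set"
  shows "B \<in> sets borel \<Longrightarrow> (\<lambda>z. x + z) ` B \<in> sets borel"
  unfolding translate_image_eq using measurable_sets[OF measurable_translate, of B x] by simp

text \<open>No normalization is imposed: the notion is applied to pushforwards of \<open>vol\<close>
  whose mass on \<open>mideal 0\<close> is still unknown.\<close>

definition translation_invariant :: "('p::prime_type padic ^ 'n ^ 'm) measure \<Rightarrow> bool" where
  "translation_invariant M \<longleftrightarrow> sets M = sets borel \<and>
     (\<forall>B\<in>sets borel. \<forall>x. emeasure M ((\<lambda>z. x + z) ` B) = emeasure M B)"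

definition single_entry :: "'m \<Rightarrow> 'n \<Rightarrow> 'a::zero \<Rightarrow> 'a ^ 'n ^ 'm" where
  "single_entry i j x = (\<chi> a b. if a = i \<and> b = j then x else 0)"

lemma single_entry_nth [simp]:
  "single_entry i j x $ a $ b = (if a = i \<and> b = j then x else 0)"
  by (simp add: single_entry_def)

text \<open>The fractional ideal p^x O is the disjoint union of the cosets of p^(x+1) O through
  \<open>of_nat c * unif powi x\<close> for c < p. Applied to entry (i, j), this splits the box into
  p translates of the smaller one.\<close>

lemma emeasure_matbox_step:
  fixes M :: "('p::prime_type padic ^ 'n ^ 'm) measure"
  assumes M: "translation_invariant M"
  shows "emeasure M (matbox (m(i := (m i)(j := x)))) =
    ennreal (real CARD('p)) * emeasure M (matbox (m(i := (m i)(j := x + 1))))"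
proof -
  let ?m = "m(i := (m i)(j := x))" and ?m' = "m(i := (m i)(j := x + 1))"
  define F where "F c = (\<lambda>z. single_entry i j (of_nat c * unif powi x) + z) `
      (matbox ?m' :: ('p padic ^ 'n ^ 'm) set)" for c :: nat
  have F_iff: "w \<in> F c \<longleftrightarrow> (\<forall>a b. (a, b) \<noteq> (i, j) \<longrightarrow> w $ a $ b \<in> pideal (m a b)) \<and>
      w $ i $ j - of_nat c * unif powi x \<in> pideal (x + 1)" for w c
    unfolding F_def translate_image_eq by (auto simp: matbox_def)
  have sets: "sets M = sets borel" and inv: "\<And>B x. B \<in> sets borel \<Longrightarrow> emeasure M ((\<lambda>z. x + z) ` B) = emeasure M B"
    using M by (auto simp: translation_invariant_def)
  have "matbox ?m = (\<Union>c\<in>{..<CARD('p)}. F c)"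
  proof (intro equalityI subsetI)
    fix w :: "'p padic ^ 'n ^ 'm" assume w: "w \<in> matbox ?m"
    then have "w $ i $ j \<in> pideal x" by (auto simp: matbox_def split: if_splits)
    then obtain c where "c < CARD('p)" "w $ i $ j - of_nat c * unif powi x \<in> pideal (x + 1)"
      using residue_exists_scaled by blast
    moreover have "w $ a $ b \<in> pideal (m a b)" if "(a, b) \<noteq> (i, j)" for a b
    proof -
      have "w $ a $ b \<in> pideal (?m a b)" using w by (simp only: matbox_def mem_Collect_eq)
      then show ?thesis using that by (auto split: if_splits)
    qed
    ultimately show "w \<in> (\<Union>c\<in>{..<CARD('p)}. F c)" by (auto simp: F_iff)
  next
    fix w assume "w \<in> (\<Union>c\<in>{..<CARD('p)}. F c)"
    then obtain c where c: "w \<in> F c" by blast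
    have "(w $ i $ j - of_nat c * unif powi x) + of_nat c * unif powi x \<in> pideal x"
      using c pideal_mono[of _ "x + 1" x]
      by (intro pideal_add pideal_mult_left unif_powi_in_pideal) (auto simp: F_iff)
    then show "w \<in> matbox ?m" using c by (auto simp: F_iff matbox_def)
  qed
  also have "emeasure M \<dots> = (\<Sum>c\<in>{..<CARD('p)}. emeasure M (F c))"
  proof (rule sum_emeasure[symmetric])
    show "disjoint_family_on F {..<CARD('p)}"
      unfolding disjoint_family_on_def
    proof (intro ballI impI)
      fix c d assume cd: "c \<in> {..<CARD('p)}" "d \<in> {..<CARD('p)}" "c \<noteq> d"
      show "F c \<inter> F d = {}"
      proof (rule ccontr)
        assume "F c \<inter> F d \<noteq> {}"
        then obtain w where w: "w \<in> F c" "w \<in> F d" by blast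
        have "(w $ i $ j - of_nat d * unif powi x) - (w $ i $ j - of_nat c * unif powi x) \<in> pideal (x + 1)"
          by (rule pideal_diff) (use w in \<open>auto simp: F_iff\<close>)
        then have "unif powi x * (of_nat c - of_nat d :: 'p padic) \<in> pideal (x + 1)"
          by (simp add: algebra_simps)
        then have "(of_nat c - of_nat d :: 'p padic) \<in> pideal 1"
          by (simp only: unif_powi_mult_in_pideal_iff)
        then show False using residue_unique cd by (metis lessThan_iff)
      qed
    qed
    show "F ` {..<CARD('p)} \<subseteq> sets M" unfolding sets F_def using translate_borel[OF matbox_borel] by blast
  qed auto
  also have "\<dots> = (\<Sum>c\<in>{..<CARD('p)}. emeasure M (matbox ?m'))"
    unfolding F_def by (intro sum.cong inv) auto
  finally show ?thesis by (simp add: ennreal_of_nat_eq_real_of_nat)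
qed

lemma emeasure_matbox:
  fixes M :: "('p::prime_type padic ^ 'n ^ 'm) measure"
  assumes M: "translation_invariant M"
  shows "emeasure M (matbox m) =
    ennreal (real CARD('p) powi (- (\<Sum>i\<in>UNIV. \<Sum>j\<in>UNIV. m i j))) * emeasure M (mideal 0)"
proof -
  define S where "S m = (\<Sum>i\<in>UNIV. \<Sum>j\<in>UNIV. m i j)" for m :: "'m \<Rightarrow> 'n \<Rightarrow> int"
  \<comment> \<open>The volume rescaled by its expected size. The previous lemma says that raising
    one exponent by one leaves \<open>f\<close> unchanged, so \<open>f\<close> is constant.\<close>
  define f where "f m = ennreal (real CARD('p) powi (S m)) * emeasure M (matbox m)" for m
  have S_upd: "S (m(i := (m i)(j := x))) = S m - m i j + x" for m i j x
  proof -
    have "(\<Sum>b\<in>UNIV. ((m i)(j := x)) b) = (\<Sum>b\<in>UNIV. m i b) - m i j + x" for i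
      by (subst (1 2) sum.remove[of _ j]) auto
    then show ?thesis unfolding S_def by (subst (1 2) sum.remove[of _ i]) auto
  qed
  have p0: "real CARD('p) \<noteq> 0" by simp
  have step: "f (m(i := (m i)(j := x + 1))) = f (m(i := (m i)(j := x)))" for m i j x
    unfolding f_def emeasure_matbox_step[OF M, of m i j x] S_upd
    using power_int_add_1[of "real CARD('p)" "S m - m i j + x"] p0
    by (simp add: ennreal_mult mult.assoc add.assoc)
  have const: "f (m(i := (m i)(j := x))) = f m" for m i j x
  proof -
    have "f (m(i := (m i)(j := x))) = f (m(i := (m i)(j := 0)))" for x
    proof (induction x rule: int_induct[where k = 0])
      case (step1 x)
      then show ?case by (simp only: step)
    next
      case (step2 x)
      then show ?case using step[of m i j "x - 1"] by (simp only: diff_add_cancel)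
    qed simp
    from this[of x] this[of "m i j"] show ?thesis by (simp only: fun_upd_triv)
  qed
  \<comment> \<open>The exponents are switched from 0 to their values one position at a time,
    \<open>T\<close> being the set of positions already switched.\<close>
  have "f (\<lambda>i j. if (i, j) \<in> T then m i j else 0) = f (\<lambda>_ _. 0)" if "finite T" for T
    using that
  proof (induction T)
    case (insert t T)
    obtain i j where t: "t = (i, j)" by fastforce
    let ?g = "\<lambda>a b. if (a, b) \<in> T then m a b else 0"
    have "(\<lambda>a b. if (a, b) \<in> insert t T then m a b else 0) = ?g(i := (?g i)(j := m i j))"
      by (auto simp: t fun_eq_iff)
    then show ?case using const[of ?g i j "m i j"] insert.IH by simp
  qed simp
  from this[of UNIV] have "f m = f (\<lambda>_ _. 0)" by simp
  then have "ennreal (real CARD('p) powi (S m)) * emeasure M (matbox m) = emeasure M (mideal 0)"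
    by (simp add: f_def S_def mideal_eq_matbox)
  then have "ennreal (real CARD('p) powi (- S m)) * emeasure M (mideal 0) =
     (ennreal (real CARD('p) powi (- S m)) * ennreal (real CARD('p) powi (S m))) * emeasure M (matbox m)"
    by (simp add: mult.assoc)
  also have "ennreal (real CARD('p) powi (- S m)) * ennreal (real CARD('p) powi (S m)) = 1"
    by (simp add: power_int_minus flip: ennreal_mult)
  finally show ?thesis by (simp add: S_def)
qed

text \<open>Every ball is a translate of some \<open>mideal (int k)\<close>, whose measure is a
  fixed multiple of that of \<open>mideal 0\<close>; so the two measures agree on balls up to the
  stated factor.\<close>

lemma translation_invariant_unique:
  fixes M N :: "('p::prime_type padic ^ 'n ^ 'm) measure"
  assumes M: "translation_invariant M" "emeasure M (mideal 0) \<noteq> \<infinity>"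
    and N: "translation_invariant N" "emeasure N (mideal 0) = 1"
    and B: "B \<in> sets borel"
  shows "emeasure M B = emeasure M (mideal 0) * emeasure N B"
proof -
  let ?N = "scale_measure (emeasure M (mideal 0)) N"
  have ball: "emeasure M (mball z k) = emeasure M (mideal (int k))"
    if "translation_invariant M" for M :: "('p padic ^ 'n ^ 'm) measure" and z k
    using that by (simp add: mball_eq_image translation_invariant_def)
  have mid: "emeasure M (mideal k) = ennreal (real CARD('p) powi (- (\<Sum>i\<in>(UNIV::'m set). \<Sum>j\<in>(UNIV::'n set). k))) * emeasure M (mideal 0)"
    if "translation_invariant M" for M :: "('p padic ^ 'n ^ 'm) measure" and k
    using emeasure_matbox[OF that, of "\<lambda>_ _. k"] by (simp only: mideal_eq_matbox[of k])
  have "emeasure M B = emeasure ?N B"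
  proof (rule emeasure_eq_on_good_balls[where U = UNIV and good = "\<lambda>_ _. True"])
    show "emeasure M (mball z k) = emeasure ?N (mball z k)" for z k
      by (simp add: ball M N mid[OF M(1), of "int k"] mid[OF N(1), of "int k"] mult.commute)
    show "emeasure M (mball z k) \<noteq> \<infinity>" for z k
      using M(2) by (simp add: ball[OF M(1)] mid[OF M(1), of "int k"] ennreal_mult_eq_top_iff)
  qed (use M N B in \<open>auto simp: translation_invariant_def\<close>)
  then show ?thesis by simp
qed

lemma image_inverse_eq_vimage:
  assumes "\<And>z. g (f z) = z" "\<And>w. f (g w) = w"
  shows "f ` B = g -` B"
  using assms by (auto simp: image_iff) metis

lemma two_sided_mult_inverse:
  fixes X Y :: "'a::field ^ 'n ^ 'n"
  assumes "det X \<noteq> 0" "det Y \<noteq> 0"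
  shows "matrix_inv X ** (X ** z ** Y) ** matrix_inv Y = z"
    "X ** (matrix_inv X ** w ** matrix_inv Y) ** Y = w"
proof -
  have "matrix_inv X ** (X ** z ** Y) ** matrix_inv Y = (matrix_inv X ** X) ** z ** (Y ** matrix_inv Y)"
    by (simp add: matrix_mul_assoc)
  then show "matrix_inv X ** (X ** z ** Y) ** matrix_inv Y = z" using assms by (simp add: matrix_inv_det)
  have "X ** (matrix_inv X ** w ** matrix_inv Y) ** Y = (X ** matrix_inv X) ** w ** (matrix_inv Y ** Y)"
    by (simp add: matrix_mul_assoc)
  then show "X ** (matrix_inv X ** w ** matrix_inv Y) ** Y = w" using assms by (simp add: matrix_inv_det)
qed

lemma measurable_two_sided_mult [measurable]:
  fixes X Y :: "'p::prime_type padic ^ 'n ^ 'n"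
  shows "(\<lambda>z. X ** z ** Y) \<in> borel_measurable borel"
proof (rule borel_measurableI)
  fix S :: "('p padic ^ 'n ^ 'n) set" assume "open S"
  have "open ((\<lambda>z. X ** z ** Y) -` S)"
    unfolding open_matrix_iff
  proof
    fix z assume "z \<in> (\<lambda>z. X ** z ** Y) -` S"
    then obtain k where k: "mball (X ** z ** Y) k \<subseteq> S"
      using \<open>open S\<close> unfolding open_matrix_iff by auto
    obtain N N' :: nat where N: "X \<in> mideal (- int N)" "Y \<in> mideal (- int N')"
      using in_some_mideal by metis
    have "X ** w ** Y \<in> mball (X ** z ** Y) k" if "w \<in> mball z (k + N + N')" for w
    proof -
      have "X ** (w - z) ** Y \<in> mideal (- int N + int (k + N + N') + - int N')"
        using that N by (intro mideal_mult) (auto simp: mball_def)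
      then show ?thesis by (simp add: mball_def matrix_minus_ldistrib matrix_minus_rdistrib)
    qed
    then have "mball z (k + N + N') \<subseteq> (\<lambda>z. X ** z ** Y) -` S" using k by auto
    then show "\<exists>k. mball z k \<subseteq> (\<lambda>z. X ** z ** Y) -` S" ..
  qed
  then show "(\<lambda>z. X ** z ** Y) -` S \<inter> space borel \<in> sets borel" by simp
qed

locale padic_haar =
  fixes vol :: "('p::prime_type padic ^ 'n::finite ^ 'n) measure"
  assumes haar: "is_normalized_haar vol"
begin

lemma sets_vol [measurable_cong, simp]: "sets vol = sets borel"
  and space_vol [simp]: "space vol = UNIV"
  using haar sets_eq_imp_space_eq[of vol borel] by (auto simp: is_normalized_haar_def)

lemma vol_translation_invariant: "translation_invariant vol"
  using haar by (auto simp: is_normalized_haar_def translation_invariant_def)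

lemma vol_translate: "B \<in> sets borel \<Longrightarrow> emeasure vol ((\<lambda>z. x + z) ` B) = emeasure vol B"
  using haar by (auto simp: is_normalized_haar_def)

lemma vol_mideal_0 [simp]: "emeasure vol (mideal 0) = 1"
  using haar by (auto simp: is_normalized_haar_def integral_matrices_eq_mideal)

lemma vol_matbox:
  "emeasure vol (matbox m) = ennreal (real CARD('p) powi (- (\<Sum>i\<in>UNIV. \<Sum>j\<in>UNIV. m i j)))"
  using emeasure_matbox[OF vol_translation_invariant, of m] by simp

lemma vol_mideal_finite: "emeasure vol (mideal k) < \<infinity>"
  by (simp add: mideal_eq_matbox vol_matbox)

text \<open>The measure of the image under z -> X z Y is again translation invariant in the set,
  hence a multiple of \<open>vol\<close>. The multiple is left as the volume of the image of
  \<open>mideal 0\<close>; its value is found after Smith normal form.\<close>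

lemma vol_two_sided_mult_aux:
  fixes X Y :: "'p padic ^ 'n ^ 'n"
  assumes X: "det X \<noteq> 0" and Y: "det Y \<noteq> 0" and B: "B \<in> sets borel"
  shows "(\<lambda>z. X ** z ** Y) ` B \<in> sets borel"
    and "emeasure vol ((\<lambda>z. X ** z ** Y) ` B) = emeasure vol ((\<lambda>z. X ** z ** Y) ` mideal 0) * emeasure vol B"
proof -
  let ?f = "\<lambda>z. X ** z ** Y" and ?g = "\<lambda>z. matrix_inv X ** z ** matrix_inv Y"
  have im: "?f ` S = ?g -` S" for S
    by (rule image_inverse_eq_vimage) (rule two_sided_mult_inverse[OF X Y])+
  show "?f ` B \<in> sets borel"
    unfolding im using measurable_sets[OF measurable_two_sided_mult B, of "matrix_inv X" "matrix_inv Y"] by simp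
  define M where "M = distr vol borel ?g"
  have M: "emeasure M S = emeasure vol (?f ` S)" if "S \<in> sets borel" for S
    unfolding M_def im using that by (subst emeasure_distr) auto
  have "emeasure M B = emeasure M (mideal 0) * emeasure vol B"
  proof (rule translation_invariant_unique)
    have "?f ` ((\<lambda>z. x + z) ` S) = (\<lambda>z. ?f x + z) ` (?f ` S)" for x S
      by (simp add: image_image matrix_add_ldistrib matrix_add_rdistrib)
    moreover have "?f ` S \<in> sets borel" if "S \<in> sets borel" for S
      unfolding im using measurable_sets[OF measurable_two_sided_mult that, of "matrix_inv X" "matrix_inv Y"] by simp
    moreover have "sets M = sets borel" by (simp add: M_def)
    ultimately show "translation_invariant M"
      unfolding translation_invariant_def by (simp add: M translate_borel vol_translate)
    \<comment> \<open>Bounding the denominators of \<open>X\<close> and \<open>Y\<close> places the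
      image of \<open>mideal 0\<close> inside a set of finite volume.\<close>
    obtain N N' :: nat where N: "X \<in> mideal (- int N)" "Y \<in> mideal (- int N')"
      using in_some_mideal by metis
    have "?f z \<in> mideal (- int N + 0 + - int N')" if "z \<in> mideal 0" for z
      using that N by (intro mideal_mult)
    then have "?f ` mideal 0 \<subseteq> mideal (- int N + 0 + - int N')" by blast
    then have "emeasure vol (?f ` mideal 0) \<le> emeasure vol (mideal (- int N + 0 + - int N'))"
      by (intro emeasure_mono) auto
    then show "emeasure M (mideal 0) \<noteq> \<infinity>"
      using vol_mideal_finite[of "- int N + 0 + - int N'"] by (auto simp: M top_unique)
  qed (use B vol_translation_invariant in auto)
  then show "emeasure vol (?f ` B) = emeasure vol (?f ` mideal 0) * emeasure vol B"
    using B by (simp add: M)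
qed

end

lemma GL_integral_image_mideal:
  fixes A B :: "'p::prime_type padic ^ 'n ^ 'n"
  assumes "A \<in> GL_integral" "B \<in> GL_integral"
  shows "(\<lambda>z. A ** z ** B) ` mideal k = mideal k"
proof -
  have 1: "A ** z ** B \<in> mideal k"
    if "A \<in> GL_integral" "B \<in> GL_integral" "z \<in> mideal k" for A B z :: "'p padic ^ 'n ^ 'n"
    by (intro mideal_mult_right[OF mideal_mult_left] GL_integral_D(1) that)
  show ?thesis
  proof (intro equalityI subsetI)
    fix w :: "'p padic ^ 'n ^ 'n" assume "w \<in> mideal k"
    then have "matrix_inv A ** w ** matrix_inv B \<in> mideal k"
      using 1 GL_integral_D(4)[OF assms(1)] GL_integral_D(4)[OF assms(2)] by blast
    then show "w \<in> (\<lambda>z. A ** z ** B) ` mideal k"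
      using two_sided_mult_inverse(2)[OF GL_integral_D(3)[OF assms(1)] GL_integral_D(3)[OF assms(2)], of w]
      by (intro image_eqI[of _ _ "matrix_inv A ** w ** matrix_inv B"]) auto
  qed (use 1 assms in auto)
qed

section \<open>Smith normal form\<close>

text \<open>The rank-one matrix squares to zero, so 1 minus it and 1 plus it are inverse to each
  other. These are the elementary row and column operations used below.\<close>

lemma rank_one_update_in_GL_integral:
  fixes u v :: "'n::finite \<Rightarrow> 'p::prime_type padic"
  assumes "\<And>i. u i \<in> pideal 0" "\<And>j. v j \<in> pideal 0" "(\<Sum>i\<in>UNIV. u i * v i) = 0"
  shows "mat 1 - (\<chi> i j. u i * v j) \<in> (GL_integral :: ('p padic ^ 'n ^ 'n) set)"
proof -
  let ?E = "(\<chi> i j. u i * v j) :: 'p padic ^ 'n ^ 'n"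
  have "?E ** ?E = (\<chi> i j. u i * (\<Sum>k\<in>UNIV. u k * v k) * v j)"
    by (simp add: matrix_matrix_mult_def vec_eq_iff sum_distrib_left sum_distrib_right mult_ac)
  then have EE: "?E ** ?E = 0" using assms(3) by (simp add: vec_eq_iff)
  have "(mat 1 - ?E) ** (mat 1 + ?E) = mat 1" "(mat 1 + ?E) ** (mat 1 - ?E) = mat 1"
    by (simp_all add: matrix_minus_rdistrib matrix_minus_ldistrib matrix_add_ldistrib matrix_add_rdistrib EE)
  moreover have "?E \<in> mideal 0" using assms by (simp add: mideal_def pideal_mult_left)
  then have "mat 1 + ?E \<in> mideal 0" "mat 1 - ?E \<in> mideal 0" by (simp_all add: mideal_add mideal_diff)
  ultimately show ?thesis by (auto simp: GL_integral_def integral_matrices_eq_mideal)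
qed

lemma permutation_matrix_in_GL_integral:
  "(\<chi> i j. if j = Transposition.transpose a b i then 1 else 0) \<in> (GL_integral :: ('p::prime_type padic ^ 'n ^ 'n) set)"
proof -
  let ?P = "(\<chi> i j. if j = Transposition.transpose a b i then 1 else 0) :: 'p padic ^ 'n ^ 'n"
  have "(?P ** ?P) $ i $ j = mat 1 $ i $ j" for i j
    by (auto simp: matrix_matrix_mult_def mat_def if_distrib[of "\<lambda>x. x * _"] cong: if_cong)
  then have "?P ** ?P = mat 1" by (simp add: vec_eq_iff)
  moreover have "?P \<in> mideal 0" by (simp add: mideal_def)
  ultimately show ?thesis by (auto simp: GL_integral_def integral_matrices_eq_mideal)
qed

text \<open>One round of Gaussian elimination over O. An entry of maximal norm outside the rows and
  columns in \<open>S\<close> is moved to position (l, l); it divides all the other entries there,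
  so its row and column are cleared by integral operations.\<close>

lemma diagonal_reduction_step:
  fixes Y :: "'p::prime_type padic ^ 'n ^ 'n"
  assumes Y: "\<And>i j. i \<noteq> j \<Longrightarrow> i \<in> S \<or> j \<in> S \<Longrightarrow> Y $ i $ j = 0" and l: "l \<notin> S"
  shows "\<exists>A\<in>GL_integral. \<exists>B\<in>GL_integral. \<forall>i j. i \<noteq> j \<longrightarrow> i \<in> insert l S \<or> j \<in> insert l S \<longrightarrow>
    (A ** Y ** B) $ i $ j = 0"
proof (cases "\<forall>i\<in>-S. \<forall>j\<in>-S. Y $ i $ j = 0")
  case True
  then have "\<forall>i j. i \<noteq> j \<longrightarrow> i \<in> insert l S \<or> j \<in> insert l S \<longrightarrow> (mat 1 ** Y ** mat 1) $ i $ j = 0"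
    using Y l by (metis ComplI insert_iff matrix_mul_lid matrix_mul_rid)
  then show ?thesis using mat_1_in_GL_integral by blast
next
  case False
  define V where "V = (\<lambda>(i, j). padic_norm (Y $ i $ j)) ` ((- S) \<times> (- S))"
  have V: "finite V" "V \<noteq> {}" using l by (auto simp: V_def)
  then have "Max V \<in> V" by (rule Max_in)
  then obtain i0 j0 where i0: "i0 \<notin> S" "j0 \<notin> S" "padic_norm (Y $ i0 $ j0) = Max V"
    by (auto simp: V_def)
  have max: "padic_norm (Y $ i $ j) \<le> padic_norm (Y $ i0 $ j0)" if "i \<notin> S" "j \<notin> S" for i j
    unfolding i0(3) using that V by (intro Max_ge) (auto simp: V_def)
  have nz: "Y $ i0 $ j0 \<noteq> 0"
  proof
    assume "Y $ i0 $ j0 = 0"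
    then have "padic_norm (Y $ i $ j) \<le> 0" if "i \<notin> S" "j \<notin> S" for i j using max[OF that] by simp
    then have "Y $ i $ j = 0" if "i \<notin> S" "j \<notin> S" for i j
      using that padic_norm_nonneg padic_norm_eq_0_iff by (metis antisym)
    then show False using False by auto
  qed
  \<comment> \<open>Neither transposition moves an index of \<open>S\<close>, since
    \<open>l\<close>, \<open>i0\<close> and \<open>j0\<close> lie outside; the part already
    diagonalized survives.\<close>
  let ?s = "Transposition.transpose l i0" and ?t = "Transposition.transpose l j0"
  define P where "P = ((\<chi> i j. if j = ?s i then 1 else 0) :: 'p padic ^ 'n ^ 'n)"
  define Q where "Q = ((\<chi> i j. if j = ?t i then 1 else 0) :: 'p padic ^ 'n ^ 'n)"
  define Z where "Z = P ** Y ** Q"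
  have PQ: "P \<in> GL_integral" "Q \<in> GL_integral"
    by (simp_all add: P_def Q_def permutation_matrix_in_GL_integral)
  have PY: "(P ** Y) $ i $ j = Y $ ?s i $ j" for i j
    by (simp add: P_def matrix_matrix_mult_def if_distrib[of "\<lambda>x. x * _"] cong: if_cong)
  have t_eq: "j = ?t k \<longleftrightarrow> k = ?t j" for j k by (metis transpose_involutory)
  have Z: "Z $ i $ j = Y $ ?s i $ ?t j" for i j
  proof -
    have "Z $ i $ j = (\<Sum>k\<in>UNIV. (P ** Y) $ i $ k * (if k = ?t j then 1 else 0))"
      unfolding Z_def Q_def matrix_matrix_mult_def[of "P ** Y"] using t_eq by simp
    also have "\<dots> = (P ** Y) $ i $ ?t j"
      by (simp add: if_distrib[of "\<lambda>x. _ * x"] cong: if_cong)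
    finally show ?thesis by (simp add: PY)
  qed
  have sS: "?s i \<in> S \<longleftrightarrow> i \<in> S" "?t i \<in> S \<longleftrightarrow> i \<in> S" "i \<in> S \<Longrightarrow> ?s i = i" "i \<in> S \<Longrightarrow> ?t i = i" for i
    using l i0 by (auto simp: Transposition.transpose_def)
  have Z0: "Z $ i $ j = 0" if "i \<noteq> j" "i \<in> S \<or> j \<in> S" for i j
    unfolding Z using that sS by (intro Y) metis+
  have Zl: "Z $ l $ l = Y $ i0 $ j0" by (simp add: Z)
  have Zmax: "Z $ i $ j / Z $ l $ l \<in> pideal 0" if "i \<notin> S" "j \<notin> S" for i j
  proof -
    have "padic_norm (Y $ ?s i $ ?t j) \<le> padic_norm (Y $ i0 $ j0)"
      by (rule max) (use that sS in auto)
    moreover have "padic_norm (Y $ i0 $ j0) > 0" using nz by (simp add: less_le)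
    ultimately show ?thesis unfolding Zl unfolding Z by (simp add: pideal_0_iff padic_norm_divide)
  qed
  \<comment> \<open>Quotients by the pivot, integral by maximality. \<open>E\<close> subtracts
    \<open>u i\<close> times row \<open>l\<close> from row \<open>i\<close>, and \<open>F\<close>
    subtracts \<open>v j\<close> times column \<open>l\<close> from column \<open>j\<close>.\<close>
  define u where "u i = (if i = l then 0 else Z $ i $ l / Z $ l $ l)" for i
  define v where "v j = (if j = l then 0 else Z $ l $ j / Z $ l $ l)" for j
  define e where "e i = (if i = l then 1 else 0 :: 'p padic)" for i
  define E where "E = mat 1 - (\<chi> i j. u i * e j)"
  define F where "F = mat 1 - (\<chi> i j. e i * v j)"
  have uv: "u i \<in> pideal 0" "v i \<in> pideal 0" "e i \<in> pideal 0" for i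
  proof -
    show "u i \<in> pideal 0" using Zmax[of i l] Z0[of i l] l by (cases "i \<in> S") (auto simp: u_def)
    show "v i \<in> pideal 0" using Zmax[of l i] Z0[of l i] l by (cases "i \<in> S") (auto simp: v_def)
  qed (simp add: e_def)
  have EF: "E \<in> GL_integral" "F \<in> GL_integral"
    unfolding E_def F_def
    by (rule rank_one_update_in_GL_integral; use uv in \<open>simp add: u_def v_def e_def if_distrib cong: if_cong\<close>)+
  have sum_e: "(\<Sum>k\<in>UNIV. e k * f k) = f l" "(\<Sum>k\<in>UNIV. f k * e k) = f l" for f
    by (simp_all add: e_def if_distrib[of "\<lambda>x. _ * x"] if_distrib[of "\<lambda>x. x * _"] cong: if_cong)
  have EZ: "(E ** Z) $ i $ j = Z $ i $ j - u i * Z $ l $ j" for i j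
  proof -
    have "(E ** Z) $ i $ j = Z $ i $ j - (\<Sum>k\<in>UNIV. u i * (e k * Z $ k $ j))"
      unfolding E_def matrix_minus_rdistrib by (simp add: matrix_matrix_mult_def[of "\<chi> i j. u i * e j"] mult.assoc)
    also have "\<dots> = Z $ i $ j - u i * Z $ l $ j"
      unfolding sum_distrib_left[symmetric] sum_e ..
    finally show ?thesis .
  qed
  have EZF: "(E ** Z ** F) $ i $ j = (E ** Z) $ i $ j - (E ** Z) $ i $ l * v j" for i j
  proof -
    have "(E ** Z ** F) $ i $ j = (E ** Z) $ i $ j - (\<Sum>k\<in>UNIV. (E ** Z) $ i $ k * e k * v j)"
      unfolding F_def matrix_minus_ldistrib by (simp add: matrix_matrix_mult_def[of "E ** Z"] mult.assoc)
    also have "\<dots> = (E ** Z) $ i $ j - (E ** Z) $ i $ l * v j"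
      unfolding sum_distrib_right[symmetric] sum_e ..
    finally show ?thesis .
  qed
  have lnz: "Z $ l $ l \<noteq> 0" using nz Zl by simp
  have "(E ** Z ** F) $ i $ j = 0" if ij: "i \<noteq> j" "i \<in> insert l S \<or> j \<in> insert l S" for i j
  proof -
    have "u i = 0" if "i \<in> S" for i using Z0[of i l] that l by (auto simp: u_def)
    moreover have "v j = 0" if "j \<in> S" for j using Z0[of l j] that l by (auto simp: v_def)
    moreover have "(E ** Z) $ i $ l = (if i = l then Z $ l $ l else 0)" for i
      unfolding EZ using lnz by (simp add: u_def)
    moreover have "(E ** Z) $ l $ j = Z $ l $ j" unfolding EZ by (simp add: u_def)
    moreover have "Z $ l $ j = 0" if "j \<in> S" for j using Z0[of l j] that l by auto
    ultimately show ?thesis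
      using ij Z0[of i j] lnz unfolding EZF by (auto simp: EZ v_def)
  qed
  moreover have "E ** Z ** F = (E ** P) ** Y ** (Q ** F)" by (simp add: Z_def matrix_mul_assoc)
  ultimately show ?thesis
    using GL_integral_mult[OF EF(1) PQ(1)] GL_integral_mult[OF PQ(2) EF(2)]
    by (intro bexI[of _ "E ** P"] bexI[of _ "Q ** F"]) auto
qed

lemma GL_integral_equivalent_diagonal:
  fixes z :: "'p::prime_type padic ^ 'n ^ 'n"
  assumes "finite S"
  shows "\<exists>A\<in>GL_integral. \<exists>B\<in>GL_integral. \<forall>i j. i \<noteq> j \<longrightarrow> i \<in> S \<or> j \<in> S \<longrightarrow> (A ** z ** B) $ i $ j = 0"
  using assms
proof (induction S)
  case empty
  show ?case using mat_1_in_GL_integral by blast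
next
  case (insert l S)
  then obtain A B where AB: "A \<in> GL_integral" "B \<in> GL_integral"
    "\<And>i j. i \<noteq> j \<Longrightarrow> i \<in> S \<or> j \<in> S \<Longrightarrow> (A ** z ** B) $ i $ j = 0" by blast
  obtain C D where CD: "C \<in> GL_integral" "D \<in> GL_integral"
    "\<And>i j. i \<noteq> j \<Longrightarrow> i \<in> insert l S \<or> j \<in> insert l S \<Longrightarrow> (C ** (A ** z ** B) ** D) $ i $ j = 0"
    using diagonal_reduction_step[OF AB(3) insert.hyps(2)] by blast
  have "C ** (A ** z ** B) ** D = (C ** A) ** z ** (B ** D)" by (simp add: matrix_mul_assoc)
  then show ?case using CD AB GL_integral_mult by metis
qed

lemma diag_powers_nth:
  "(diag_powers k :: 'p::prime_type padic ^ 'n ^ 'n) $ i $ j =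
     (if i = j then (case k i of None \<Rightarrow> 0 | Some m \<Rightarrow> unif powi (- m)) else 0)"
  by (simp add: diag_powers_def unif_def split: option.split)

lemma diagonal_mult_nth:
  fixes D :: "'a::semiring_1 ^ 'n ^ 'n"
  assumes "\<And>i j. i \<noteq> j \<Longrightarrow> D $ i $ j = 0"
  shows "(D ** X) $ i $ j = D $ i $ i * X $ i $ j" "(X ** D) $ i $ j = X $ i $ j * D $ j $ j"
proof -
  have "(\<Sum>k\<in>UNIV. D $ i $ k * X $ k $ j) = (\<Sum>k\<in>{i}. D $ i $ k * X $ k $ j)"
    by (rule sum.mono_neutral_right) (use assms in auto)
  then show "(D ** X) $ i $ j = D $ i $ i * X $ i $ j" by (simp add: matrix_matrix_mult_def)
  have "(\<Sum>k\<in>UNIV. X $ i $ k * D $ k $ j) = (\<Sum>k\<in>{j}. X $ i $ k * D $ k $ j)"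
    by (rule sum.mono_neutral_right) (use assms in auto)
  then show "(X ** D) $ i $ j = X $ i $ j * D $ j $ j" by (simp add: matrix_matrix_mult_def)
qed

text \<open>After diagonalization each nonzero diagonal entry is a unit times a power of
  \<open>unif\<close>, and a zero entry gets the exponent \<open>None\<close>. The units form a
  diagonal matrix in \<open>GL_integral\<close>, which is absorbed into the left factor.\<close>

theorem smith_normal_form:
  fixes z :: "'p::prime_type padic ^ 'n ^ 'n"
  obtains A B k where "A \<in> GL_integral" "B \<in> GL_integral" "z = A ** diag_powers k ** B"
proof -
  obtain A B where AB: "A \<in> GL_integral" "B \<in> GL_integral" "\<And>i j. i \<noteq> j \<Longrightarrow> (A ** z ** B) $ i $ j = 0"
    using GL_integral_equivalent_diagonal[of UNIV z] by auto
  define Y where "Y = A ** z ** B"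
  have "\<exists>m u. padic_norm u = 1 \<and> Y $ i $ i = u * (case m of None \<Rightarrow> 0 | Some m \<Rightarrow> unif powi (- m))" for i
  proof (cases "Y $ i $ i = 0")
    case True
    then show ?thesis by (intro exI[of _ None] exI[of _ 1]) auto
  next
    case False
    then obtain m where m: "padic_norm (Y $ i $ i) = real CARD('p) powi m" by (rule padic_norm_eq_powi)
    have "padic_norm (Y $ i $ i / unif powi (- m)) = 1"
      by (simp add: padic_norm_divide m padic_norm_unif_powi)
    then show ?thesis by (intro exI[of _ "Some m"] exI[of _ "Y $ i $ i / unif powi (- m)"]) auto
  qed
  then obtain k u where ku: "\<And>i. padic_norm (u i) = 1"
    "\<And>i. Y $ i $ i = u i * (case k i of None \<Rightarrow> 0 | Some m \<Rightarrow> unif powi (- m))" by metis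
  define U where "U = ((\<chi> i j. if i = j then u i else 0) :: 'p padic ^ 'n ^ 'n)"
  have "det U = (\<Prod>i\<in>UNIV. u i)" unfolding U_def by (subst det_diagonal) auto
  then have "padic_norm (det U) = 1"
  proof -
    have "padic_norm (\<Prod>i\<in>T. u i) = 1" if "finite T" for T
      using that by (induction T) (auto simp: padic_norm_mult ku)
    then show ?thesis using \<open>det U = _\<close> by simp
  qed
  then have U: "U \<in> GL_integral"
    using ku by (auto simp: GL_integral_iff U_def mideal_def pideal_0_iff)
  have "Y $ i $ j = (U ** diag_powers k) $ i $ j" for i j
    using ku(2)[of i] AB(3)[of i j]
    by (subst diagonal_mult_nth(1)) (auto simp: U_def diag_powers_nth Y_def)
  then have "Y = U ** diag_powers k" by (simp add: vec_eq_iff)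
  then have "matrix_inv A ** (U ** diag_powers k) ** matrix_inv B = z"
    using two_sided_mult_inverse(1)[OF GL_integral_D(3)[OF AB(1)] GL_integral_D(3)[OF AB(2)], of z]
    by (simp add: Y_def)
  then show ?thesis
    using that[of "matrix_inv A ** U" "matrix_inv B" k] GL_integral_mult[OF _ U] GL_integral_D(4)[OF AB(1)]
      GL_integral_D(4)[OF AB(2)] by (simp add: matrix_mul_assoc)
qed


lemma det_diag_powers_Some:
  "padic_norm (det (diag_powers (\<lambda>i. Some (m i)) :: 'p::prime_type padic ^ 'n ^ 'n)) =
    real CARD('p) powi (\<Sum>i\<in>UNIV. m i)"
proof -
  have "padic_norm (\<Prod>i\<in>T. unif powi (- m i) :: 'p padic) = real CARD('p) powi (\<Sum>i\<in>T. m i)" if "finite T" for T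
    using that
    by (induction T) (auto simp: padic_norm_mult padic_norm_unif_powi power_int_add)
  then show ?thesis by (subst det_diagonal) (auto simp: diag_powers_nth)
qed

lemma smith_normal_form_invertible:
  fixes z :: "'p::prime_type padic ^ 'n ^ 'n"
  assumes "det z \<noteq> 0"
  obtains A B m where "A \<in> GL_integral" "B \<in> GL_integral" "z = A ** diag_powers (\<lambda>i. Some (m i)) ** B"
    "padic_norm (det z) = real CARD('p) powi (\<Sum>i\<in>UNIV. m i)"
proof -
  obtain A B k where z: "A \<in> GL_integral" "B \<in> GL_integral" "z = A ** diag_powers k ** B"
    by (rule smith_normal_form)
  have "det (diag_powers k :: 'p padic ^ 'n ^ 'n) \<noteq> 0" using assms z(3) by (auto simp: det_mul)
  moreover have "det (diag_powers k :: 'p padic ^ 'n ^ 'n) =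
      (\<Prod>i\<in>UNIV. case k i of None \<Rightarrow> 0 | Some m \<Rightarrow> unif powi (- m))"
    by (subst det_diagonal) (auto simp: diag_powers_nth)
  ultimately have "((case k i of None \<Rightarrow> 0 | Some m \<Rightarrow> unif powi (- m)) :: 'p padic) \<noteq> 0" for i by auto
  then have "k i \<noteq> None" for i by (metis option.simps(4))
  then have k: "k = (\<lambda>i. Some (the (k i)))" by auto
  show ?thesis
  proof (rule that[OF z(1,2)])
    show "z = A ** diag_powers (\<lambda>i. Some (the (k i))) ** B" using z(3) k by simp
    then show "padic_norm (det z) = real CARD('p) powi (\<Sum>i\<in>UNIV. the (k i))"
      using det_diag_powers_Some[where 'p='p and 'n='n, of "\<lambda>i. the (k i)"] GL_integral_D(2)[OF z(1)] GL_integral_D(2)[OF z(2)]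
      by (simp add: det_mul padic_norm_mult)
  qed
qed

lemma matbox_image_diag_powers:
  "(\<lambda>z. diag_powers (\<lambda>i. Some (k i)) ** z ** diag_powers (\<lambda>i. Some (l i))) `
    (matbox m :: ('p::prime_type padic ^ 'n ^ 'n) set) = matbox (\<lambda>i j. m i j - k i - l j)"
    (is "?f ` _ = _")
proof -
  have f: "?f z $ i $ j = unif powi (- k i - l j) * z $ i $ j" for z i j
    by (simp add: diagonal_mult_nth diag_powers_nth power_int_diff power_int_minus field_simps)
  have iff: "unif powi (- k i - l j) * x \<in> pideal (m i j - k i - l j) \<longleftrightarrow> x \<in> pideal (m i j)"
    for x :: "'p padic" and i j
    using unif_powi_mult_in_pideal_iff[of "- k i - l j" x "m i j"] by (simp add: algebra_simps)
  show ?thesis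
  proof (intro equalityI subsetI)
    fix w :: "'p padic ^ 'n ^ 'n" assume w: "w \<in> matbox (\<lambda>i j. m i j - k i - l j)"
    define z :: "'p padic ^ 'n ^ 'n" where "z = (\<chi> i j. unif powi (k i + l j) * w $ i $ j)"
    have e: "unif powi (- k i - l j) * (unif powi (k i + l j) * x) = x" for x :: "'p padic" and i j
      using power_int_add[of "unif :: 'p padic" "- k i - l j" "k i + l j"] by (simp flip: mult.assoc)
    have "?f z = w" by (simp add: vec_eq_iff f e z_def)
    moreover have "z \<in> matbox m"
      unfolding matbox_def
    proof safe
      fix i j
      show "z $ i $ j \<in> pideal (m i j)"
        unfolding iff[symmetric] z_def vec_lambda_beta e using w by (simp add: matbox_def)
    qed
    ultimately show "w \<in> ?f ` matbox m" by blast
  qed (auto simp: matbox_def f iff)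
qed

text \<open>Only the image of \<open>mideal 0\<close> has to be measured. With Smith forms of
  \<open>X\<close> and \<open>Y\<close> the inner \<open>GL_integral\<close> factors preserve
  \<open>mideal 0\<close>, and the diagonal ones map it to a box with exponent - k i - l j at (i,
  j). Each k i and l j occurs n times in the total, which yields the power n.\<close>

lemma (in padic_haar) vol_two_sided_mult:
  fixes X Y :: "'p padic ^ 'n ^ 'n"
  assumes X: "det X \<noteq> 0" and Y: "det Y \<noteq> 0" and B: "B \<in> sets borel"
  shows "emeasure vol ((\<lambda>z. X ** z ** Y) ` B) =
    ennreal ((padic_norm (det X) * padic_norm (det Y)) ^ CARD('n)) * emeasure vol B"
proof -
  obtain A1 A2 k where X': "A1 \<in> GL_integral" "A2 \<in> GL_integral" "X = A1 ** diag_powers (\<lambda>i. Some (k i)) ** A2"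
    "padic_norm (det X) = real CARD('p) powi (\<Sum>i\<in>UNIV. k i)"
    by (rule smith_normal_form_invertible[OF X])
  obtain B1 B2 l where Y': "B1 \<in> GL_integral" "B2 \<in> GL_integral" "Y = B1 ** diag_powers (\<lambda>i. Some (l i)) ** B2"
    "padic_norm (det Y) = real CARD('p) powi (\<Sum>i\<in>UNIV. l i)"
    by (rule smith_normal_form_invertible[OF Y])
  let ?D = "diag_powers (\<lambda>i. Some (k i)) :: 'p padic ^ 'n ^ 'n" and ?E = "diag_powers (\<lambda>i. Some (l i)) :: 'p padic ^ 'n ^ 'n"
  have "(\<lambda>z. X ** z ** Y) ` mideal 0 =
      (\<lambda>z. A1 ** z ** B2) ` (\<lambda>z. ?D ** z ** ?E) ` (\<lambda>z. A2 ** z ** B1) ` mideal 0"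
    by (simp add: image_image X'(3) Y'(3) matrix_mul_assoc)
  also have "(\<lambda>z. A2 ** z ** B1) ` mideal 0 = mideal 0"
    by (rule GL_integral_image_mideal[OF X'(2) Y'(1)])
  also have "(\<lambda>z. ?D ** z ** ?E) ` mideal 0 = matbox (\<lambda>i j. - k i - l j)"
    by (simp add: mideal_eq_matbox matbox_image_diag_powers)
  \<comment> \<open>The outer factors also preserve \<open>mideal 0\<close>, so their multiple in
    the previous form of the result is 1.\<close>
  also have "emeasure vol ((\<lambda>z. A1 ** z ** B2) ` matbox (\<lambda>i j. - k i - l j)) =
      emeasure vol (matbox (\<lambda>i j. - k i - l j))"
    using X'(1) Y'(2)
    by (subst vol_two_sided_mult_aux(2)) (auto simp: GL_integral_D GL_integral_image_mideal)
  also have "\<dots> = ennreal (real CARD('p) powi (int CARD('n) * (\<Sum>i\<in>UNIV. k i) + int CARD('n) * (\<Sum>i\<in>UNIV. l i)))"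
    by (simp add: vol_matbox sum.distrib sum_subtractf sum_negf sum_distrib_left add.commute)
  also have "real CARD('p) powi (int CARD('n) * (\<Sum>i\<in>UNIV. k i) + int CARD('n) * (\<Sum>i\<in>UNIV. l i)) =
      (padic_norm (det X) * padic_norm (det Y)) ^ CARD('n)"
    unfolding X'(4) Y'(4)
    by (simp add: power_int_add power_int_mult_distrib power_int_mult mult.commute[of "int _"] flip: power_int_of_nat)
  finally have "emeasure vol ((\<lambda>z. X ** z ** Y) ` mideal 0) =
      ennreal ((padic_norm (det X) * padic_norm (det Y)) ^ CARD('n))" .
  then show ?thesis using vol_two_sided_mult_aux(2)[OF X Y B] by simp
qed

section \<open>The function gamma\<close>

text \<open>Matrices whose columns lie in the lattice \<open>O\<^sup>n + z O\<^sup>n\<close>, which contains \<open>O\<^sup>n\<close> with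
  index \<open>\<gamma>(z)\<close>.\<close>

definition column_lattice :: "'p::prime_type padic ^ 'n ^ 'n \<Rightarrow> ('p padic ^ 'n ^ 'n) set" where
  "column_lattice z = {X + z ** Y | X Y. X \<in> mideal 0 \<and> Y \<in> mideal 0}"

text \<open>The contribution of one diagonal entry to the logarithm of \<open>gamma\<close> in base
  p.\<close>

definition pos_exponent :: "('n \<Rightarrow> int option) \<Rightarrow> 'n \<Rightarrow> int" where
  "pos_exponent k i = (case k i of None \<Rightarrow> 0 | Some m \<Rightarrow> max m 0)"

lemma pos_exponent_nonneg [simp]: "pos_exponent k i \<ge> 0"
  by (simp add: pos_exponent_def split: option.split)

definition diag_entry :: "('n \<Rightarrow> int option) \<Rightarrow> 'n \<Rightarrow> 'p::prime_type padic" where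
  "diag_entry k i = (case k i of None \<Rightarrow> 0 | Some m \<Rightarrow> unif powi (- m))"

lemma diag_powers_nth': "diag_powers k $ i $ j = (if i = j then diag_entry k i else 0)"
  by (simp add: diag_powers_nth diag_entry_def)

lemma diag_powers_mult_nth:
  "(diag_powers k ** X) $ i $ j = diag_entry k i * X $ i $ j"
  "(X ** diag_powers k) $ i $ j = X $ i $ j * diag_entry k j"
  by (simp_all add: diagonal_mult_nth diag_powers_nth')

lemma diag_entry_in_pideal: "diag_entry k i \<in> pideal (- pos_exponent k i)"
  by (cases "k i") (auto simp: diag_entry_def pos_exponent_def intro: pideal_mono[OF unif_powi_in_pideal])

lemma pideal_pos_exponent_split:
  fixes x :: "'p::prime_type padic"
  assumes "x \<in> pideal (- pos_exponent k i)"
  shows "\<exists>a\<in>pideal 0. \<exists>b\<in>pideal 0. x = a + diag_entry k i * b"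
proof (cases "pos_exponent k i = 0")
  case True
  then show ?thesis using assms by (intro bexI[of _ x] bexI[of _ 0]) auto
next
  case False
  then obtain m where m: "k i = Some m" "m > 0" "pos_exponent k i = m"
    by (auto simp: pos_exponent_def split: option.splits)
  have "unif powi m * x \<in> pideal (m + - m)"
    using assms m by (intro pideal_mult unif_powi_in_pideal) auto
  moreover have "x = 0 + diag_entry k i * (unif powi m * x)"
    using m by (simp add: diag_entry_def power_int_minus flip: mult.assoc)
  ultimately show ?thesis by (intro bexI[of _ 0] bexI[of _ "unif powi m * x"]) auto
qed

text \<open>The factor \<open>B\<close> disappears because it permutes the integral matrices, and
  \<open>A\<close> can be pulled out because it preserves them. What is left is O + p^(-k) O, which
  is p^(-k) O for k > 0 and O otherwise. The harmless \<open>** mat 1\<close> gives the map the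
  two-sided shape of the volume formula.\<close>

lemma column_lattice_smith:
  fixes A B :: "'p::prime_type padic ^ 'n ^ 'n"
  assumes A: "A \<in> GL_integral" and B: "B \<in> GL_integral"
  shows "column_lattice (A ** diag_powers k ** B) =
    (\<lambda>z. A ** z ** mat 1) ` matbox (\<lambda>i j. - pos_exponent k i)"
proof (intro equalityI subsetI)
  fix w :: "'p padic ^ 'n ^ 'n" assume "w \<in> column_lattice (A ** diag_powers k ** B)"
  then obtain X Y where XY: "X \<in> mideal 0" "Y \<in> mideal 0" "w = X + A ** diag_powers k ** B ** Y"
    by (auto simp: column_lattice_def)
  define v where "v = matrix_inv A ** X + diag_powers k ** (B ** Y)"
  have X': "matrix_inv A ** X \<in> mideal 0" and Y': "B ** Y \<in> mideal 0"
    using XY A B GL_integral_D(1,4) mideal_mult_left by blast+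
  have "v $ i $ j \<in> pideal (- pos_exponent k i)" for i j
  proof -
    have "(matrix_inv A ** X) $ i $ j + diag_entry k i * (B ** Y) $ i $ j \<in> pideal (- pos_exponent k i)"
      using X' Y'
      by (intro pideal_add pideal_mult_right diag_entry_in_pideal pideal_mono[of _ 0 "- pos_exponent k i"])
         (auto simp: mideal_def)
    then show ?thesis by (simp add: v_def diag_powers_mult_nth)
  qed
  moreover have "w = A ** v ** mat 1"
    using GL_integral_D(5)[OF A] by (simp add: XY(3) v_def matrix_add_ldistrib matrix_mul_assoc)
  ultimately show "w \<in> (\<lambda>z. A ** z ** mat 1) ` matbox (\<lambda>i j. - pos_exponent k i)"
    by (intro image_eqI[of _ _ v]) (auto simp: matbox_def)
next
  fix w :: "'p padic ^ 'n ^ 'n" assume "w \<in> (\<lambda>z. A ** z ** mat 1) ` matbox (\<lambda>i j. - pos_exponent k i)"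
  then obtain v where v: "w = A ** v" "v \<in> matbox (\<lambda>i j. - pos_exponent k i)" by auto
  then have "\<exists>a b. a \<in> pideal 0 \<and> b \<in> pideal 0 \<and> v $ i $ j = a + diag_entry k i * b" for i j
    using pideal_pos_exponent_split[of "v $ i $ j" k i] unfolding matbox_def by blast
  then obtain f g where fg: "\<And>i j. f i j \<in> pideal 0" "\<And>i j. g i j \<in> pideal 0"
    "\<And>i j. v $ i $ j = f i j + diag_entry k i * g i j" by metis
  define X where "X = (\<chi> i j. f i j)"
  define Y where "Y = (\<chi> i j. g i j)"
  have XY: "X \<in> mideal 0" "Y \<in> mideal 0" using fg by (auto simp: X_def Y_def mideal_def)
  have "v $ i $ j = (X + diag_powers k ** Y) $ i $ j" for i j
    unfolding vector_add_component diag_powers_mult_nth fg(3) by (simp add: X_def Y_def)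
  then have "v = X + diag_powers k ** Y" by (simp add: vec_eq_iff)
  also have "Y = B ** (matrix_inv B ** Y)"
    using GL_integral_D(5)[OF B] by (simp add: matrix_mul_assoc)
  finally have "w = A ** X + A ** diag_powers k ** B ** (matrix_inv B ** Y)"
    unfolding v by (simp add: matrix_add_ldistrib matrix_mul_assoc)
  moreover have "A ** X \<in> mideal 0" "matrix_inv B ** Y \<in> mideal 0"
    using XY A B GL_integral_D(1,4) mideal_mult_left by blast+
  ultimately show "w \<in> column_lattice (A ** diag_powers k ** B)" by (auto simp: column_lattice_def)
qed

lemma prod_positive_exponents:
  fixes k :: "'n::finite \<Rightarrow> int option"
  shows "(\<Prod>j \<in> {j. \<exists>m>0. k j = Some m}. real CARD('p::prime_type) powi the (k j)) =
    real CARD('p) powi (\<Sum>j\<in>UNIV. pos_exponent k j)"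
proof -
  have "(\<Prod>j\<in>T. real CARD('p) powi f j) = real CARD('p) powi (\<Sum>j\<in>T. f j)"
    if "finite T" for T :: "'n set" and f :: "'n \<Rightarrow> int"
    using that by (induction T) (auto simp: power_int_add)
  then have "(\<Prod>j \<in> {j. \<exists>m>0. k j = Some m}. real CARD('p) powi the (k j)) =
      real CARD('p) powi (\<Sum>j \<in> {j. \<exists>m>0. k j = Some m}. the (k j))" by simp
  also have "(\<Sum>j \<in> {j. \<exists>m>0. k j = Some m}. the (k j)) = (\<Sum>j\<in>UNIV. pos_exponent k j)"
    by (rule sum.mono_neutral_cong_left) (auto simp: pos_exponent_def split: option.split)
  finally show ?thesis .
qed

context padic_haar
begin

lemma vol_column_lattice_smith:
  assumes "A \<in> GL_integral" "B \<in> GL_integral"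
  shows "column_lattice (A ** diag_powers k ** B) \<in> sets borel"
    "emeasure vol (column_lattice (A ** diag_powers k ** B)) =
      ennreal ((real CARD('p) powi (\<Sum>j\<in>UNIV. pos_exponent k j)) ^ CARD('n))"
proof -
  show "column_lattice (A ** diag_powers k ** B) \<in> sets borel"
    unfolding column_lattice_smith[OF assms]
    by (rule vol_two_sided_mult_aux(1)) (use GL_integral_D(3)[OF assms(1)] in auto)
  have "emeasure vol (column_lattice (A ** diag_powers k ** B)) = emeasure vol (matbox (\<lambda>i j. - pos_exponent k i))"
    unfolding column_lattice_smith[OF assms] using assms
    by (subst vol_two_sided_mult) (auto simp: GL_integral_D)
  then show "emeasure vol (column_lattice (A ** diag_powers k ** B)) =
      ennreal ((real CARD('p) powi (\<Sum>j\<in>UNIV. pos_exponent k j)) ^ CARD('n))"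
    by (simp add: vol_matbox sum_negf sum_distrib_left power_int_mult mult.commute[of "int _"]
        flip: power_int_of_nat sum_distrib_right)
qed

text \<open>The volume of the column lattice depends on the matrix alone and is the n-th power of
  the product of positive exponents, so two Smith forms of one matrix give the same product. Thus
  the definite description in \<open>gamma\<close> is legitimate.\<close>

lemma gamma_smith:
  fixes A B :: "'p padic ^ 'n ^ 'n"
  assumes "A \<in> GL_integral" "B \<in> GL_integral"
  shows "gamma (A ** diag_powers k ** B) = real CARD('p) powi (\<Sum>j\<in>UNIV. pos_exponent k j)"
  unfolding gamma_def prod_positive_exponents
proof (rule the_equality)
  show "\<exists>C\<in>GL_integral. \<exists>D\<in>GL_integral. \<exists>l. A ** diag_powers k ** B = C ** diag_powers l ** D \<and>
      real CARD('p) powi (\<Sum>j\<in>UNIV. pos_exponent k j) = real CARD('p) powi (\<Sum>j\<in>UNIV. pos_exponent l j)"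
    using assms by blast
next
  fix x assume "\<exists>C\<in>GL_integral. \<exists>D\<in>GL_integral. \<exists>l. A ** diag_powers k ** B = C ** diag_powers l ** D \<and>
      x = real CARD('p) powi (\<Sum>j\<in>UNIV. pos_exponent l j)"
  then obtain C D l where *: "C \<in> GL_integral" "D \<in> GL_integral" "A ** diag_powers k ** B = C ** diag_powers l ** D"
    "x = real CARD('p) powi (\<Sum>j\<in>UNIV. pos_exponent l j)" by blast
  have "ennreal (x ^ CARD('n)) = ennreal ((real CARD('p) powi (\<Sum>j\<in>UNIV. pos_exponent k j)) ^ CARD('n))"
    using vol_column_lattice_smith(2)[OF assms, of k] vol_column_lattice_smith(2)[OF *(1,2), of l] *(3,4) by simp
  then have "x ^ CARD('n) = (real CARD('p) powi (\<Sum>j\<in>UNIV. pos_exponent k j)) ^ CARD('n)"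
    by (subst (asm) ennreal_inj) (auto simp: *(4))
  then show "x = real CARD('p) powi (\<Sum>j\<in>UNIV. pos_exponent k j)"
    by (rule power_eq_imp_eq_base) (auto simp: *(4))
qed

lemma vol_column_lattice: "emeasure vol (column_lattice z) = ennreal (gamma z ^ CARD('n))"
  and column_lattice_borel: "column_lattice z \<in> sets borel"
  and gamma_ge_1: "gamma z \<ge> 1"
proof -
  obtain A B k where z: "A \<in> GL_integral" "B \<in> GL_integral" "z = A ** diag_powers k ** B"
    by (rule smith_normal_form)
  show "emeasure vol (column_lattice z) = ennreal (gamma z ^ CARD('n))" "column_lattice z \<in> sets borel"
    unfolding z(3) using vol_column_lattice_smith[OF z(1,2)] gamma_smith[OF z(1,2)] by auto
  have "real CARD('p) powi 0 \<le> real CARD('p) powi (\<Sum>j\<in>UNIV. pos_exponent k j)"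
    unfolding CARD_powi_le_iff by (rule sum_nonneg) simp
  then show "gamma z \<ge> 1" using z gamma_smith by simp
qed

text \<open>Transposition exchanges columns and rows and does not act on
  \<open>column_lattice\<close>; the invariance is read off the Smith form, whose transpose is a
  Smith form with the same exponents.\<close>

lemma gamma_transpose:
  fixes z :: "'p padic ^ 'n ^ 'n"
  shows "gamma (Finite_Cartesian_Product.transpose z) = gamma z"
proof -
  let ?T = "Finite_Cartesian_Product.transpose :: 'p padic ^ 'n ^ 'n \<Rightarrow> _"
  obtain A B k where z: "A \<in> GL_integral" "B \<in> GL_integral" "z = A ** diag_powers k ** B"
    by (rule smith_normal_form)
  have GL: "?T A \<in> GL_integral" if "A \<in> GL_integral" for A
    using that by (simp add: GL_integral_iff mideal_def transpose_def det_transpose[unfolded transpose_def])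
  have "?T (diag_powers k) = diag_powers k"
    by (simp add: vec_eq_iff transpose_def diag_powers_nth)
  then have "?T z = ?T B ** diag_powers k ** ?T A"
    unfolding z(3) by (simp add: matrix_transpose_mul matrix_mul_assoc)
  then show ?thesis using gamma_smith z GL by metis
qed

lemma gamma_pos [simp]: "gamma (z :: 'p padic ^ 'n ^ 'n) > 0"
  using gamma_ge_1[of z] by simp

text \<open>An integral summand of z changes z Y by an integral matrix, so the column lattice stays
  the same.\<close>

lemma gamma_add_integral:
  fixes z X :: "'p padic ^ 'n ^ 'n"
  assumes "X \<in> mideal 0"
  shows "gamma (z + X) = gamma z"
proof -
  have sub: "column_lattice (z + X) \<subseteq> column_lattice z" if X: "X \<in> mideal 0" for z X :: "'p padic ^ 'n ^ 'n"
  proof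
    fix w assume "w \<in> column_lattice (z + X)"
    then obtain U Y where UY: "U \<in> mideal 0" "Y \<in> mideal 0" "w = U + (z + X) ** Y"
      by (auto simp: column_lattice_def)
    then have "w = (U + X ** Y) + z ** Y" by (simp add: matrix_add_rdistrib)
    moreover have "U + X ** Y \<in> mideal 0" using UY X by (intro mideal_add mideal_mult_left)
    ultimately show "w \<in> column_lattice z" using UY(2) by (auto simp: column_lattice_def)
  qed
  have "column_lattice (z + X) = column_lattice z"
    using sub[OF assms, of z] sub[of "- X" "z + X"] assms by auto
  then have "ennreal (gamma (z + X) ^ CARD('n)) = ennreal (gamma z ^ CARD('n))"
    by (simp flip: vol_column_lattice)
  then have "gamma (z + X) ^ CARD('n) = gamma z ^ CARD('n)"
    by (subst (asm) ennreal_inj) (auto intro: less_imp_le)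
  then show ?thesis by (rule power_eq_imp_eq_base) (auto intro: less_imp_le)
qed

lemma gamma_integral: "z \<in> mideal 0 \<Longrightarrow> gamma (z :: 'p padic ^ 'n ^ 'n) = 1"
proof -
  have "gamma (mat 1 ** diag_powers (\<lambda>_. None) ** mat 1 :: 'p padic ^ 'n ^ 'n) = 1"
    by (subst gamma_smith) (auto simp: pos_exponent_def)
  moreover have "(diag_powers (\<lambda>_. None) :: 'p padic ^ 'n ^ 'n) = 0"
    by (simp add: vec_eq_iff diag_powers_nth)
  ultimately have "gamma (0 :: 'p padic ^ 'n ^ 'n) = 1" by simp
  then show "gamma z = 1" if "z \<in> mideal 0" for z :: "'p padic ^ 'n ^ 'n"
    using gamma_add_integral[OF that, of 0] by simp
qed

lemma gamma_measurable [measurable]: "gamma \<in> borel_measurable (borel :: ('p padic ^ 'n ^ 'n) measure)"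
proof (rule borel_measurableI)
  fix S :: "real set"
  have "open (gamma -` S :: ('p padic ^ 'n ^ 'n) set)"
    unfolding open_matrix_iff
  proof
    fix z :: "'p padic ^ 'n ^ 'n" assume "z \<in> gamma -` S"
    then have "mball z 0 \<subseteq> gamma -` S" by (auto simp: mball_eq_image gamma_add_integral)
    then show "\<exists>k. mball z k \<subseteq> gamma -` S" ..
  qed
  then show "gamma -` S \<inter> space borel \<in> sets (borel :: ('p padic ^ 'n ^ 'n) measure)" by simp
qed

text \<open>Multiplication by \<open>X\<close> from the left scales volumes by the n-th power of
  |det X|; volumes of the two lattices are compared and n-th roots taken.\<close>

lemma gamma_le_of_column_lattice:
  fixes X w z :: "'p padic ^ 'n ^ 'n"
  assumes "(\<lambda>u. X ** u ** mat 1) ` column_lattice w \<subseteq> column_lattice z" "det X \<noteq> 0"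
  shows "padic_norm (det X) * gamma w \<le> gamma z"
proof -
  have "ennreal ((padic_norm (det X) * gamma w) ^ CARD('n)) = emeasure vol ((\<lambda>u. X ** u ** mat 1) ` column_lattice w)"
    using assms(2) column_lattice_borel
    by (subst vol_two_sided_mult) (auto simp: vol_column_lattice power_mult_distrib ennreal_mult less_imp_le)
  also have "\<dots> \<le> emeasure vol (column_lattice z)"
    using assms(1) column_lattice_borel by (intro emeasure_mono) auto
  finally have "ennreal ((padic_norm (det X) * gamma w) ^ CARD('n)) \<le> ennreal (gamma z ^ CARD('n))"
    by (simp add: vol_column_lattice)
  then have "(padic_norm (det X) * gamma w) ^ CARD('n) \<le> gamma z ^ CARD('n)"
    by (subst (asm) ennreal_le_iff) (auto intro: less_imp_le)
  then show ?thesis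
    by (subst (asm) power_mono_iff) (auto intro!: mult_nonneg_nonneg intro: less_imp_le)
qed

end

section \<open>Linear-fractional transformations\<close>

text \<open>A matrix of \<open>GL_integral\<close> in size 2n together with its inverse, unfolded
  into blocks so that all further calculation takes place with n x n matrices.\<close>

definition block_inverses ::
  "'p::prime_type padic ^ 'n ^ 'n \<Rightarrow> 'p padic ^ 'n ^ 'n \<Rightarrow> 'p padic ^ 'n ^ 'n \<Rightarrow> 'p padic ^ 'n ^ 'n \<Rightarrow>
   'p padic ^ 'n ^ 'n \<Rightarrow> 'p padic ^ 'n ^ 'n \<Rightarrow> 'p padic ^ 'n ^ 'n \<Rightarrow> 'p padic ^ 'n ^ 'n \<Rightarrow> bool" where
  "block_inverses a b c d a' b' c' d' \<longleftrightarrow>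
     {a, b, c, d, a', b', c', d'} \<subseteq> mideal 0 \<and>
     a ** a' + b ** c' = mat 1 \<and> a ** b' + b ** d' = 0 \<and> c ** a' + d ** c' = 0 \<and> c ** b' + d ** d' = mat 1 \<and>
     a' ** a + b' ** c = mat 1 \<and> a' ** b + b' ** d = 0 \<and> c' ** a + d' ** c = 0 \<and> c' ** b + d' ** d = mat 1"

lemma block_inverses_sym:
  "block_inverses a b c d a' b' c' d' \<Longrightarrow> block_inverses a' b' c' d' a b c d"
  by (auto simp: block_inverses_def)

lemma sum_UNIV_Plus: "(\<Sum>k\<in>UNIV. f k) = (\<Sum>k\<in>UNIV. f (Inl k)) + (\<Sum>k\<in>UNIV. f (Inr k))"
  for f :: "'n::finite + 'm::finite \<Rightarrow> 'a::comm_monoid_add"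
  using sum.Plus[of "UNIV :: 'n set" "UNIV :: 'm set" f] by (simp add: UNIV_Plus_UNIV comp_def)

lemma block_matrix_mult:
  fixes a b c d a' b' c' d' :: "'a::semiring_1 ^ 'n ^ 'n"
  shows "block_matrix a b c d ** block_matrix a' b' c' d' =
    block_matrix (a ** a' + b ** c') (a ** b' + b ** d') (c ** a' + d ** c') (c ** b' + d ** d')"
proof -
  have "(block_matrix a b c d ** block_matrix a' b' c' d') $ i $ j =
    block_matrix (a ** a' + b ** c') (a ** b' + b ** d') (c ** a' + d ** c') (c ** b' + d ** d') $ i $ j" for i j
    by (cases i; cases j) (simp_all add: matrix_matrix_mult_def block_matrix_def sum_UNIV_Plus)
  then show ?thesis by (simp add: vec_eq_iff)
qed

lemma block_matrix_mat_1: "block_matrix (mat 1) 0 0 (mat 1) = (mat 1 :: 'a::semiring_1 ^ ('n::finite + 'n) ^ ('n + 'n))"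
  by (auto simp: vec_eq_iff block_matrix_def mat_def split: sum.split)

lemma block_matrix_eq_iff:
  "block_matrix a b c d = block_matrix a' b' c' d' \<longleftrightarrow> a = a' \<and> b = b' \<and> c = c' \<and> d = d'"
proof
  assume eq: "block_matrix a b c d = block_matrix a' b' c' d'"
  have "block_matrix a b c d $ i $ j = block_matrix a' b' c' d' $ i $ j" for i j using eq by simp
  from this[of "Inl i" "Inl j" for i j] this[of "Inl i" "Inr j" for i j]
    this[of "Inr i" "Inl j" for i j] this[of "Inr i" "Inr j" for i j]
  show "a = a' \<and> b = b' \<and> c = c' \<and> d = d'" by (simp add: block_matrix_def vec_eq_iff)
qed simp

lemma block_matrix_in_mideal:
  "block_matrix a b c d \<in> mideal k \<longleftrightarrow> {a, b, c, d} \<subseteq> mideal k"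
proof
  assume *: "block_matrix a b c d \<in> mideal k"
  have "block_matrix a b c d $ i $ j \<in> pideal k" for i j using * by (simp add: mideal_def)
  from this[of "Inl i" "Inl j" for i j] this[of "Inl i" "Inr j" for i j]
    this[of "Inr i" "Inl j" for i j] this[of "Inr i" "Inr j" for i j]
  show "{a, b, c, d} \<subseteq> mideal k" by (simp add: block_matrix_def mideal_def)
qed (auto simp: block_matrix_def mideal_def split: sum.split)

lemma block_matrix_cases:
  obtains a b c d where "M = block_matrix a b c d"
proof (rule that)
  show "M = block_matrix (\<chi> i j. M $ Inl i $ Inl j) (\<chi> i j. M $ Inl i $ Inr j)
      (\<chi> i j. M $ Inr i $ Inl j) (\<chi> i j. M $ Inr i $ Inr j)"
    by (auto simp: vec_eq_iff block_matrix_def split: sum.split)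
qed

lemma block_matrix_in_GL_integral_iff:
  "block_matrix a b c d \<in> GL_integral \<longleftrightarrow> (\<exists>a' b' c' d'. block_inverses a b c d a' b' c' d')"
proof
  assume "block_matrix a b c d \<in> GL_integral"
  then obtain M where M: "block_matrix a b c d \<in> mideal 0" "M \<in> mideal 0"
    "block_matrix a b c d ** M = mat 1" "M ** block_matrix a b c d = mat 1"
    by (auto simp: GL_integral_def integral_matrices_eq_mideal)
  obtain a' b' c' d' where M': "M = block_matrix a' b' c' d'" by (rule block_matrix_cases)
  have "block_inverses a b c d a' b' c' d'"
    using M unfolding M' block_matrix_in_mideal block_matrix_mult block_matrix_mat_1[symmetric] block_matrix_eq_iff
    by (auto simp: block_inverses_def)
  then show "\<exists>a' b' c' d'. block_inverses a b c d a' b' c' d'" by blast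
next
  assume "\<exists>a' b' c' d'. block_inverses a b c d a' b' c' d'"
  then obtain a' b' c' d' where g: "block_inverses a b c d a' b' c' d'" by blast
  have "block_matrix a b c d ** block_matrix a' b' c' d' = mat 1"
    "block_matrix a' b' c' d' ** block_matrix a b c d = mat 1"
    unfolding block_matrix_mult block_matrix_mat_1[symmetric] block_matrix_eq_iff
    using g by (auto simp: block_inverses_def)
  then show "block_matrix a b c d \<in> GL_integral"
    unfolding GL_integral_def integral_matrices_eq_mideal
    using g by (auto simp: block_inverses_def block_matrix_in_mideal intro!: bexI[of _ "block_matrix a' b' c' d'"])
qed

lemma linear_fractional_eqI:
  fixes a c z :: "'a::field ^ 'n ^ 'n"
  assumes "det (a + z ** c) \<noteq> 0" "(a + z ** c) ** w = b + z ** d"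
  shows "linear_fractional a b c d z = w"
  unfolding linear_fractional_def assms(2)[symmetric]
  using assms(1) by (simp add: matrix_mul_assoc matrix_inv_det)

lemma linear_fractional_mult:
  fixes a c z :: "'a::field ^ 'n ^ 'n"
  assumes "det (a + z ** c) \<noteq> 0"
  shows "(a + z ** c) ** linear_fractional a b c d z = b + z ** d"
  unfolding linear_fractional_def
  using assms by (simp add: matrix_mul_assoc matrix_inv_det)

text \<open>With A = a + z c and A w = b + z d, multiplying a' + w c' and b' + w d' by A reproduces
  the block equations of the product of the two matrices, with results 1 and z. The first result is
  the cocycle property for g and its inverse.\<close>

lemma linear_fractional_inverse:
  assumes g: "block_inverses a b c d a' b' c' d'" and nz: "det (a + z ** c) \<noteq> 0"
    and w: "w = linear_fractional a b c d z"
  shows "(a + z ** c) ** (a' + w ** c') = mat 1" "det (a' + w ** c') \<noteq> 0"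
    "linear_fractional a' b' c' d' w = z"
proof -
  have Aw: "(a + z ** c) ** w = b + z ** d"
    unfolding w by (rule linear_fractional_mult[OF nz])
  have "(a + z ** c) ** (a' + w ** c') = (a ** a' + b ** c') + z ** (c ** a' + d ** c')"
    unfolding matrix_add_ldistrib matrix_mul_assoc Aw
    by (simp add: matrix_add_rdistrib matrix_mul_assoc)
  then show 1: "(a + z ** c) ** (a' + w ** c') = mat 1"
    using g by (simp add: block_inverses_def)
  then show nz': "det (a' + w ** c') \<noteq> 0" by (rule matrix_inverse_det)
  have "(a + z ** c) ** (b' + w ** d') = (a ** b' + b ** d') + z ** (c ** b' + d ** d')"
    unfolding matrix_add_ldistrib matrix_mul_assoc Aw
    by (simp add: matrix_add_rdistrib matrix_mul_assoc)
  then have 2: "(a + z ** c) ** (b' + w ** d') = z"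
    using g by (simp add: block_inverses_def)
  have "(a' + w ** c') ** z = (a' + w ** c') ** (a + z ** c) ** (b' + w ** d')"
    using 2 by (simp flip: matrix_mul_assoc)
  also have "\<dots> = b' + w ** d'" using matrix_inverse_det(3)[OF 1] by simp
  finally show "linear_fractional a' b' c' d' w = z"
    by (rule linear_fractional_eqI[OF nz'])
qed

context padic_haar
begin

text \<open>Multiplication by A = a + z c maps the lattice of w into that of z: A (X + w Y) = (a X +
  b Y) + z (c X + d Y), with integral matrices in both places.\<close>

lemma gamma_transform_le:
  fixes z w :: "'p padic ^ 'n ^ 'n"
  assumes I: "{a, b, c, d} \<subseteq> mideal 0" and nz: "det (a + z ** c) \<noteq> 0"
    and w: "(a + z ** c) ** w = b + z ** d"
  shows "padic_norm (det (a + z ** c)) * gamma w \<le> gamma z"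
proof (rule gamma_le_of_column_lattice[OF _ nz])
  show "(\<lambda>u. (a + z ** c) ** u ** mat 1) ` column_lattice w \<subseteq> column_lattice z"
  proof safe
    fix u assume "u \<in> column_lattice w"
    then obtain X Y where XY: "X \<in> mideal 0" "Y \<in> mideal 0" "u = X + w ** Y"
      by (auto simp: column_lattice_def)
    have "(a + z ** c) ** u = (a + z ** c) ** X + (b + z ** d) ** Y"
      unfolding XY(3) w[symmetric] by (simp add: matrix_add_ldistrib matrix_mul_assoc)
    also have "\<dots> = (a ** X + b ** Y) + z ** (c ** X + d ** Y)"
      by (simp add: matrix_add_ldistrib matrix_add_rdistrib matrix_mul_assoc)
    finally show "(a + z ** c) ** u ** mat 1 \<in> column_lattice z"
      using I XY by (auto simp: column_lattice_def intro!: exI mideal_add mideal_mult_left)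
  qed
qed

text \<open>The transpose of \<open>z (d - c w) = a w - b\<close> has the shape required in the previous lemma.\<close>

lemma gamma_transform_ge:
  fixes z w :: "'p padic ^ 'n ^ 'n"
  assumes I: "{a, b, c, d} \<subseteq> mideal 0" and nz: "det (d - c ** w) \<noteq> 0"
    and w: "(a + z ** c) ** w = b + z ** d"
  shows "padic_norm (det (d - c ** w)) * gamma z \<le> gamma w"
proof -
  let ?T = "Finite_Cartesian_Product.transpose :: 'p padic ^ 'n ^ 'n \<Rightarrow> _"
  have T: "?T (x - y) = ?T x - ?T y" "?T (- x) = - ?T x" for x y
    by (simp_all add: vec_eq_iff transpose_def)
  have D: "?T d + ?T w ** - ?T c = ?T (d - c ** w)"
    by (simp add: T matrix_transpose_mul) (simp add: vec_eq_iff matrix_matrix_mult_def sum_negf)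
  have "?T (d - c ** w) ** ?T z = ?T (z ** (d - c ** w))" by (rule matrix_transpose_mul[symmetric])
  also have "z ** (d - c ** w) = a ** w - b"
    using w by (simp add: matrix_minus_ldistrib matrix_add_rdistrib matrix_mul_assoc algebra_simps)
  also have "?T (a ** w - b) = - ?T b + ?T w ** ?T a" by (simp add: T matrix_transpose_mul)
  finally have "?T (d - c ** w) ** ?T z = - ?T b + ?T w ** ?T a" .
  moreover have "{?T d, - ?T b, - ?T c, ?T a} \<subseteq> mideal 0"
    using I by (simp add: mideal_def transpose_def)
  ultimately show ?thesis
    using gamma_transform_le[of "?T d" "- ?T b" "- ?T c" "?T a" "?T w" "?T z"] nz
    by (simp add: D gamma_transpose det_transpose)
qed

text \<open>The inequalities for g and for its inverse have factors that are inverse to each other,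
  so they are equalities. The two resulting relations, gamma(z) = |det A| gamma(w) and gamma(w) =
  |det D| gamma(z), force |det A| |det D| = 1 because \<open>gamma\<close> is positive.\<close>

lemma linear_fractional_gamma:
  fixes z w :: "'p padic ^ 'n ^ 'n"
  assumes g: "block_inverses a b c d a' b' c' d'" and nz: "det (a + z ** c) \<noteq> 0"
    and w: "w = linear_fractional a b c d z"
  shows "gamma z = padic_norm (det (a + z ** c)) * gamma w" "det (d - c ** w) \<noteq> 0"
    "padic_norm (det (a + z ** c)) * padic_norm (det (d - c ** w)) = 1"
proof -
  note inv = linear_fractional_inverse[OF g nz w]
  have Aw: "(a + z ** c) ** w = b + z ** d" unfolding w by (rule linear_fractional_mult[OF nz])
  have A'z: "(a' + w ** c') ** z = b' + w ** d'"
    using linear_fractional_mult[OF inv(2), of b' d'] inv(3) by simp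
  have "det (a + z ** c) * det (a' + w ** c') = 1"
    using arg_cong[OF inv(1), of det] by (simp add: det_mul)
  then have n1: "padic_norm (det (a + z ** c)) * padic_norm (det (a' + w ** c')) = 1"
    by (metis padic_norm_mult padic_norm_1)
  have I: "{a, b, c, d} \<subseteq> mideal 0" "{a', b', c', d'} \<subseteq> mideal 0"
    using g by (auto simp: block_inverses_def)
  have le1: "padic_norm (det (a + z ** c)) * gamma w \<le> gamma z"
    by (rule gamma_transform_le[OF I(1) nz Aw])
  have le2: "padic_norm (det (a' + w ** c')) * gamma z \<le> gamma w"
    by (rule gamma_transform_le[OF I(2) inv(2) A'z])
  then have "padic_norm (det (a + z ** c)) * (padic_norm (det (a' + w ** c')) * gamma z) \<le>
      padic_norm (det (a + z ** c)) * gamma w" by (intro mult_left_mono) auto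
  then have "gamma z \<le> padic_norm (det (a + z ** c)) * gamma w"
    using n1 by (simp flip: mult.assoc)
  then show eq: "gamma z = padic_norm (det (a + z ** c)) * gamma w" using le1 by simp
  \<comment> \<open>The defining equation of the inverse transformation, rearranged to show that d'
    - c' z is inverse to d - c w.\<close>
  have wD: "w ** (d' - c' ** z) = a' ** z - b'"
    using A'z by (simp add: matrix_minus_ldistrib matrix_add_rdistrib matrix_mul_assoc algebra_simps)
  have "(d - c ** w) ** (d' - c' ** z) = d ** (d' - c' ** z) - c ** (w ** (d' - c' ** z))"
    by (simp add: matrix_minus_rdistrib matrix_mul_assoc)
  also have "\<dots> = (c ** b' + d ** d') - (c ** a' + d ** c') ** z"
    unfolding wD by (simp add: matrix_minus_ldistrib matrix_add_rdistrib matrix_mul_assoc)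
  also have "\<dots> = mat 1" using g by (simp add: block_inverses_def)
  finally have D: "(d - c ** w) ** (d' - c' ** z) = mat 1" .
  then show nzD: "det (d - c ** w) \<noteq> 0" by (rule matrix_inverse_det)
  have nzD': "det (d' - c' ** z) \<noteq> 0" using D by (rule matrix_inverse_det)
  have "det (d - c ** w) * det (d' - c' ** z) = 1"
    using arg_cong[OF D, of det] by (simp add: det_mul)
  then have n2: "padic_norm (det (d - c ** w)) * padic_norm (det (d' - c' ** z)) = 1"
    by (metis padic_norm_mult padic_norm_1)
  have le3: "padic_norm (det (d - c ** w)) * gamma z \<le> gamma w"
    by (rule gamma_transform_ge[OF I(1) nzD Aw])
  have "padic_norm (det (d' - c' ** z)) * gamma w \<le> gamma z"
    by (rule gamma_transform_ge[OF I(2) nzD' A'z])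
  then have "padic_norm (det (d - c ** w)) * (padic_norm (det (d' - c' ** z)) * gamma w) \<le>
      padic_norm (det (d - c ** w)) * gamma z" by (intro mult_left_mono) auto
  then have "gamma w \<le> padic_norm (det (d - c ** w)) * gamma z"
    using n2 by (simp flip: mult.assoc)
  then have "gamma w = padic_norm (det (d - c ** w)) * gamma z" using le3 by simp
  then have "(padic_norm (det (a + z ** c)) * padic_norm (det (d - c ** w))) * gamma w = 1 * gamma w"
    unfolding eq by (simp only: mult_ac)
  then show "padic_norm (det (a + z ** c)) * padic_norm (det (d - c ** w)) = 1"
    using gamma_pos[of w] by (subst (asm) mult_cancel_right) auto
qed

end

section \<open>The shape of a linear-fractional transformation on small balls\<close>

text \<open>Balls on which \<open>z \<mapsto> a + z c\<close> is constant up to a left factor in \<open>1 + p Mat(n, O)\<close>.\<close>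

definition lf_ball :: "'p::prime_type padic ^ 'n ^ 'n \<Rightarrow> 'p padic ^ 'n ^ 'n \<Rightarrow> 'p padic ^ 'n ^ 'n \<Rightarrow> nat \<Rightarrow> bool" where
  "lf_ball a c z k \<longleftrightarrow> det (a + z ** c) \<noteq> 0 \<and> c ** matrix_inv (a + z ** c) \<in> mideal (1 - int k)"

lemma lf_ball_exists:
  assumes "det (a + z ** c) \<noteq> 0"
  shows "\<exists>k\<ge>l. lf_ball a c z k"
proof -
  obtain N :: nat where N: "c ** matrix_inv (a + z ** c) \<in> mideal (- int N)" by (rule in_some_mideal)
  then have "lf_ball a c z (l + N + 1)"
    unfolding lf_ball_def using assms mideal_mono[OF N, of "1 - int (l + N + 1)"] by simp
  then show ?thesis by (intro exI[of _ "l + N + 1"]) simp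
qed

text \<open>The exponent 1 - k in \<open>lf_ball\<close> is chosen so that k + (1 - k) = 1: the
  perturbation u c A^(-1) is divisible by p, hence 1 plus it is invertible over O.\<close>

lemma lf_ball_factor:
  assumes z: "lf_ball a c z k" and u: "u \<in> mideal (int k)"
  defines "G \<equiv> mat 1 + u ** (c ** matrix_inv (a + z ** c))"
  shows "G \<in> GL_integral" "a + (z + u) ** c = G ** (a + z ** c)"
proof -
  have "u ** (c ** matrix_inv (a + z ** c)) \<in> mideal (int k + (1 - int k))"
    using z u unfolding lf_ball_def by (intro mideal_mult) auto
  then show "G \<in> GL_integral" unfolding G_def by (intro mat_1_plus_in_GL_integral) simp
  have "G ** (a + z ** c) = (a + z ** c) + u ** c ** (matrix_inv (a + z ** c) ** (a + z ** c))"
    by (simp add: G_def matrix_add_rdistrib[of _ _ "a + z ** c"] matrix_mul_assoc)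
  also have "\<dots> = a + (z + u) ** c"
    using z by (simp add: lf_ball_def matrix_inv_det matrix_add_rdistrib)
  finally show "a + (z + u) ** c = G ** (a + z ** c)" by simp
qed

text \<open>Moving the center replaces a + z c by G (a + z c) with \<open>G\<close> in
  \<open>GL_integral\<close>. This leaves the norm of the determinant alone and changes c A^(-1) by
  an integral right factor.\<close>

lemma lf_ball_hereditary:
  assumes z: "lf_ball a c z k" and w: "w \<in> mball z k" and l: "k \<le> l"
  shows "lf_ball a c w l" "padic_norm (det (a + w ** c)) = padic_norm (det (a + z ** c))"
proof -
  define u where "u = w - z"
  have u: "u \<in> mideal (int k)" "w = z + u" using w by (auto simp: u_def mball_def)
  define G where "G = mat 1 + u ** (c ** matrix_inv (a + z ** c))"
  have G: "G \<in> GL_integral" "a + w ** c = G ** (a + z ** c)"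
    using lf_ball_factor[OF z u(1)] by (auto simp: G_def u(2))
  have nz: "det (a + z ** c) \<noteq> 0" using z by (simp add: lf_ball_def)
  show "padic_norm (det (a + w ** c)) = padic_norm (det (a + z ** c))"
    unfolding G(2) using GL_integral_D(2)[OF G(1)] by (simp add: det_mul padic_norm_mult)
  have "(a + w ** c) ** (matrix_inv (a + z ** c) ** matrix_inv G) =
      G ** ((a + z ** c) ** matrix_inv (a + z ** c)) ** matrix_inv G"
    unfolding G(2) by (simp add: matrix_mul_assoc)
  also have "\<dots> = mat 1" using nz GL_integral_D(5)[OF G(1)] by (simp add: matrix_inv_det)
  finally have inv: "(a + w ** c) ** (matrix_inv (a + z ** c) ** matrix_inv G) = mat 1" .
  have "c ** matrix_inv (a + w ** c) = c ** matrix_inv (a + z ** c) ** matrix_inv G"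
    unfolding matrix_inverse_det(4)[OF inv] by (simp add: matrix_mul_assoc)
  also have "\<dots> \<in> mideal (1 - int k)"
    by (rule mideal_mult_right) (use z GL_integral_D(1)[OF GL_integral_D(4)[OF G(1)]] in \<open>auto simp: lf_ball_def\<close>)
  finally show "lf_ball a c w l"
    unfolding lf_ball_def using matrix_inverse_det(1)[OF inv] l mideal_mono[of _ "1 - int k" "1 - int l"] by auto
qed

text \<open>With C = c A^(-1), the point z + u goes exactly to w + A^(-1) v (d - c w), where v = (1
  + u C)^(-1) u. The substitution u -> v is a bijection of \<open>mideal (int k)\<close>, so the
  nonlinearity does not affect the image of the ball.\<close>

lemma linear_fractional_image_ball:
  assumes z: "lf_ball a c z k" and w: "w = linear_fractional a b c d z"
  shows "linear_fractional a b c d ` mball z k =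
    (\<lambda>x. w + x) ` (\<lambda>v. matrix_inv (a + z ** c) ** v ** (d - c ** w)) ` mideal (int k)"
proof -
  let ?A = "a + z ** c"
  let ?C = "c ** matrix_inv ?A"
  have nz: "det ?A \<noteq> 0" using z by (simp add: lf_ball_def)
  have Aw: "?A ** w = b + z ** d" unfolding w by (rule linear_fractional_mult[OF nz])
  have eq: "linear_fractional a b c d (z + u) = w + matrix_inv ?A ** v ** (d - c ** w)"
    if u: "u \<in> mideal (int k)" and v: "(mat 1 + u ** ?C) ** v = u" for u v
  proof (rule linear_fractional_eqI)
    show "det (a + (z + u) ** c) \<noteq> 0"
      using lf_ball_hereditary(1)[OF z, of "z + u" k] u by (simp add: lf_ball_def mball_def)
    have "(a + (z + u) ** c) ** w = b + z ** d + u ** c ** w"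
      using Aw by (simp add: matrix_add_rdistrib matrix_mul_assoc algebra_simps)
    moreover have "(a + (z + u) ** c) ** (matrix_inv ?A ** v ** (d - c ** w)) = u ** d - u ** c ** w"
    proof -
      have "(a + (z + u) ** c) ** (matrix_inv ?A ** v ** (d - c ** w)) =
          (mat 1 + u ** ?C) ** (?A ** matrix_inv ?A) ** v ** (d - c ** w)"
        unfolding lf_ball_factor(2)[OF z u] by (simp add: matrix_mul_assoc)
      also have "\<dots> = u ** (d - c ** w)" using nz v by (simp add: matrix_inv_det)
      finally show ?thesis by (simp add: matrix_minus_ldistrib matrix_mul_assoc)
    qed
    ultimately show "(a + (z + u) ** c) ** (w + matrix_inv ?A ** v ** (d - c ** w)) = b + (z + u) ** d"
      by (simp add: matrix_add_ldistrib[of "a + (z + u) ** c"] matrix_add_rdistrib[of z u d])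
  qed
  show ?thesis
  proof (intro equalityI subsetI)
    fix x assume "x \<in> linear_fractional a b c d ` mball z k"
    then obtain u where u: "u \<in> mideal (int k)" "x = linear_fractional a b c d (z + u)"
      by (auto simp: mball_eq_image)
    let ?G = "mat 1 + u ** ?C"
    have G: "?G \<in> GL_integral" by (rule lf_ball_factor(1)[OF z u(1)])
    have "?G ** (matrix_inv ?G ** u) = u" using GL_integral_D(5)[OF G] by (simp add: matrix_mul_assoc)
    then have "x = w + matrix_inv ?A ** (matrix_inv ?G ** u) ** (d - c ** w)"
      unfolding u(2) by (rule eq[OF u(1)])
    moreover have "matrix_inv ?G ** u \<in> mideal (int k)"
      using GL_integral_D(1)[OF GL_integral_D(4)[OF G]] u(1) by (rule mideal_mult_left)
    ultimately show "x \<in> (\<lambda>x. w + x) ` (\<lambda>v. matrix_inv ?A ** v ** (d - c ** w)) ` mideal (int k)"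
      by blast
  next
    fix x assume "x \<in> (\<lambda>x. w + x) ` (\<lambda>v. matrix_inv ?A ** v ** (d - c ** w)) ` mideal (int k)"
    then obtain v where v: "v \<in> mideal (int k)" "x = w + matrix_inv ?A ** v ** (d - c ** w)" by auto
    \<comment> \<open>Solving (1 + u C) v = u for u gives u (1 - C v) = v, whence u = v (1 - C
      v)^(-1).\<close>
    let ?H = "mat 1 + - (?C ** v)"
    have "?C ** v \<in> mideal (1 - int k + int k)" using z v by (intro mideal_mult) (auto simp: lf_ball_def)
    then have H: "?H \<in> GL_integral" by (intro mat_1_plus_in_GL_integral) simp
    define u where "u = v ** matrix_inv ?H"
    have u: "u \<in> mideal (int k)"
      unfolding u_def using v(1) GL_integral_D(1)[OF GL_integral_D(4)[OF H]] by (rule mideal_mult_right)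
    have "u ** ?H = v" unfolding u_def using GL_integral_D(6)[OF H] by (simp flip: matrix_mul_assoc)
    then have "u - u ** (?C ** v) = v"
      by (simp add: matrix_minus_ldistrib flip: diff_conv_add_uminus)
    then have "(mat 1 + u ** ?C) ** v = u"
      by (simp add: matrix_add_rdistrib matrix_mul_assoc algebra_simps)
    then have "x = linear_fractional a b c d (z + u)" using eq[OF u] v(2) by simp
    then show "x \<in> linear_fractional a b c d ` mball z k" using u by (auto simp: mball_eq_image)
  qed
qed

lemma open_linear_fractional_vimage:
  fixes S :: "('p::prime_type padic ^ 'n ^ 'n) set"
  assumes "open S"
  shows "open {z. det (a + z ** c) \<noteq> 0 \<and> linear_fractional a b c d z \<in> S}"
  unfolding open_matrix_iff
proof safe
  fix z assume z: "det (a + z ** c) \<noteq> 0" "linear_fractional a b c d z \<in> S"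
  define w where "w = linear_fractional a b c d z"
  obtain l where l: "mball w l \<subseteq> S" using assms z(2) unfolding open_matrix_iff w_def by blast
  obtain N N' :: nat where N: "matrix_inv (a + z ** c) \<in> mideal (- int N)" "d - c ** w \<in> mideal (- int N')"
    using in_some_mideal by metis
  \<comment> \<open>The radius has to absorb the denominators of A^(-1) and of d - c w, bounded by
    \<open>N\<close> and \<open>N'\<close>.\<close>
  obtain k where k: "k \<ge> l + N + N'" "lf_ball a c z k" using lf_ball_exists[OF z(1)] by blast
  have "linear_fractional a b c d x \<in> mball w l" if x: "x \<in> mball z k" for x
  proof -
    have "linear_fractional a b c d x \<in> linear_fractional a b c d ` mball z k" using x by blast
    then obtain v where v: "v \<in> mideal (int k)" "linear_fractional a b c d x = w + matrix_inv (a + z ** c) ** v ** (d - c ** w)"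
      unfolding linear_fractional_image_ball[OF k(2) w_def] by auto
    have "matrix_inv (a + z ** c) ** v ** (d - c ** w) \<in> mideal (- int N + int k + - int N')"
      using v N by (intro mideal_mult)
    then have "matrix_inv (a + z ** c) ** v ** (d - c ** w) \<in> mideal (int l)"
      by (rule mideal_mono) (use k(1) in linarith)
    then show ?thesis by (simp add: mball_def v(2))
  qed
  moreover have "det (a + x ** c) \<noteq> 0" if "x \<in> mball z k" for x
    using lf_ball_hereditary(1)[OF k(2) that] by (auto simp: lf_ball_def)
  ultimately have "mball z k \<subseteq> {z. det (a + z ** c) \<noteq> 0 \<and> linear_fractional a b c d z \<in> S}"
    using l by blast
  then show "\<exists>k. mball z k \<subseteq> {z. det (a + z ** c) \<noteq> 0 \<and> linear_fractional a b c d z \<in> S}" ..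
qed

lemma measurable_linear_fractional [measurable]:
  fixes a b c d :: "'p::prime_type padic ^ 'n ^ 'n"
  shows "(\<lambda>z. if det (a + z ** c) \<noteq> 0 then linear_fractional a b c d z else 0) \<in> borel_measurable borel"
    (is "?F \<in> _")
proof (rule borel_measurableI)
  let ?V = "{z. det (a + z ** c) \<noteq> 0}"
  fix S :: "('p padic ^ 'n ^ 'n) set" assume "open S"
  then have o: "open {z. det (a + z ** c) \<noteq> 0 \<and> linear_fractional a b c d z \<in> S}"
    by (rule open_linear_fractional_vimage)
  have "open ?V" using open_linear_fractional_vimage[of UNIV a c] by simp
  then have "(if 0 \<in> S then - ?V else {}) \<in> sets borel" by simp
  then have "{z. det (a + z ** c) \<noteq> 0 \<and> linear_fractional a b c d z \<in> S} \<union> (if 0 \<in> S then - ?V else {}) \<in> sets borel"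
    by (rule sets.Un[OF borel_open[OF o]])
  moreover have "?F -` S = {z. det (a + z ** c) \<noteq> 0 \<and> linear_fractional a b c d z \<in> S} \<union> (if 0 \<in> S then - ?V else {})"
    by (auto split: if_splits)
  ultimately show "?F -` S \<inter> space borel \<in> sets borel" by simp
qed

section \<open>The transformation law of the Hua measure\<close>

context padic_haar
begin

lemma sets_hua_measure [measurable_cong, simp]: "sets (hua_measure vol s) = sets borel"
  and space_hua_measure [simp]: "space (hua_measure vol s) = UNIV"
  by (simp_all add: hua_measure_def)

text \<open>On Mat(n, O), a set of volume 1, the integrand is 1. This keeps the reciprocal of the
  constant finite.\<close>

lemma hua_const_ge_1: "hua_const vol \<alpha> \<ge> 1"
proof -
  have "1 = (\<integral>\<^sup>+ z. indicator (mideal 0) z \<partial>vol)" by (simp add: nn_integral_indicator)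
  also have "\<dots> \<le> hua_const vol \<alpha>"
    unfolding hua_const_def
    by (intro nn_integral_mono) (auto simp: gamma_integral split: split_indicator)
  finally show ?thesis .
qed

lemma inverse_hua_const_finite: "inverse (hua_const vol \<alpha>) < \<infinity>"
  using hua_const_ge_1[of \<alpha>] by (auto simp: less_top[symmetric] ennreal_inverse_eq_top_iff)

lemma emeasure_hua_measure_gamma_const:
  assumes "S \<in> sets borel" "\<And>z. z \<in> S \<Longrightarrow> gamma z = g"
  shows "emeasure (hua_measure vol s) S = inverse (hua_const vol (s + 2 * real CARD('n))) *
    ennreal (g powr (- s - 2 * real CARD('n))) * emeasure vol S"
proof -
  have "emeasure (hua_measure vol s) S = (\<integral>\<^sup>+ z. inverse (hua_const vol (s + 2 * real CARD('n))) *
      ennreal (gamma z powr (- s - 2 * real CARD('n))) * indicator S z \<partial>vol)"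
    unfolding hua_measure_def using assms(1) by (subst emeasure_density) auto
  also have "\<dots> = (\<integral>\<^sup>+ z. inverse (hua_const vol (s + 2 * real CARD('n))) *
      ennreal (g powr (- s - 2 * real CARD('n))) * indicator S z \<partial>vol)"
    by (intro nn_integral_cong) (auto simp: assms(2) split: split_indicator)
  finally show ?thesis using assms(1) by (simp add: nn_integral_cmult_indicator)
qed

text \<open>The image is a translate of A^(-1) p^k Mat(n, O) D. Both A^(-1) and D have determinant
  of norm |det A|^(-1), and each contributes it n times; hence the exponent - 2n.\<close>

lemma vol_linear_fractional_ball:
  assumes g: "block_inverses a b c d a' b' c' d'" and z: "lf_ball a c z k"
  shows "linear_fractional a b c d ` mball z k \<in> sets borel"
    and "emeasure vol (linear_fractional a b c d ` mball z k) =
      ennreal (padic_norm (det (a + z ** c)) powr (- 2 * real CARD('n))) * emeasure vol (mball z k)"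
proof -
  define w where "w = linear_fractional a b c d z"
  let ?A = "a + z ** c" and ?D = "d - c ** w"
  have nz: "det ?A \<noteq> 0" using z by (simp add: lf_ball_def)
  note D = linear_fractional_gamma(2,3)[OF g nz w_def]
  have nA: "padic_norm (det ?A) > 0" using nz by (simp add: less_le)
  have "det (matrix_inv ?A) * det ?A = 1"
    using arg_cong[OF matrix_inv_det(2)[OF nz], of det] by (simp add: det_mul)
  then have n1: "padic_norm (det (matrix_inv ?A)) * padic_norm (det ?A) = 1" "det (matrix_inv ?A) \<noteq> 0"
    by (metis padic_norm_mult padic_norm_1) (use \<open>det (matrix_inv ?A) * det ?A = 1\<close> in auto)
  have eq: "linear_fractional a b c d ` mball z k =
      (\<lambda>x. w + x) ` (\<lambda>v. matrix_inv ?A ** v ** ?D) ` mideal (int k)"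
    by (rule linear_fractional_image_ball[OF z w_def])
  have b: "(\<lambda>v. matrix_inv ?A ** v ** ?D) ` mideal (int k) \<in> sets borel"
    by (rule vol_two_sided_mult_aux(1)[OF n1(2) D(1)]) simp
  then show "linear_fractional a b c d ` mball z k \<in> sets borel"
    unfolding eq by (rule translate_borel)
  have powr_m1: "x = y powr (- 1)" if "x * y = 1" "y > 0" for x y :: real
    using that by (simp add: powr_minus_divide eq_divide_eq)
  have "emeasure vol (linear_fractional a b c d ` mball z k) =
      ennreal ((padic_norm (det (matrix_inv ?A)) * padic_norm (det ?D)) ^ CARD('n)) * emeasure vol (mideal (int k))"
    unfolding eq vol_translate[OF b] by (rule vol_two_sided_mult[OF n1(2) D(1)]) simp
  also have "padic_norm (det (matrix_inv ?A)) = padic_norm (det ?A) powr (- 1)"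
    by (rule powr_m1[OF n1(1) nA])
  also have "padic_norm (det ?D) = padic_norm (det ?A) powr (- 1)"
    using D(2) nA by (intro powr_m1) (simp_all add: mult.commute)
  also have "(padic_norm (det ?A) powr (- 1) * padic_norm (det ?A) powr (- 1)) ^ CARD('n) =
      padic_norm (det ?A) powr (- 2 * real CARD('n))"
  proof -
    have "padic_norm (det ?A) powr (- 1) * padic_norm (det ?A) powr (- 1) = padic_norm (det ?A) powr (- 2)"
      by (subst powr_add[symmetric]) simp
    moreover have "(padic_norm (det ?A) powr (- 2)) ^ CARD('n) = (padic_norm (det ?A) powr (- 2)) powr real CARD('n)"
      using nA by (subst powr_realpow) auto
    ultimately show ?thesis by (simp only: powr_powr)
  qed
  also have "emeasure vol (mideal (int k)) = emeasure vol (mball z k)"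
    by (simp add: mball_eq_image vol_translate)
  finally show "emeasure vol (linear_fractional a b c d ` mball z k) =
      ennreal (padic_norm (det ?A) powr (- 2 * real CARD('n))) * emeasure vol (mball z k)" .
qed

lemma abs_det_powr_measurable [measurable]:
  "(\<lambda>z. padic_norm (det (a + z ** c)) powr s) \<in> borel_measurable (borel :: ('p padic ^ 'n ^ 'n) measure)"
proof (rule borel_measurableI)
  let ?U = "{z. det (a + z ** c) \<noteq> 0}"
  let ?h = "\<lambda>z. padic_norm (det (a + z ** c)) powr s"
  fix S :: "real set"
  have "open ?U" using open_linear_fractional_vimage[of UNIV a c] by simp
  then have U: "- ?U \<in> sets borel" by simp
  have o: "open {z \<in> ?U. ?h z \<in> S}"
    unfolding open_matrix_iff
  proof safe
    fix z assume z: "det (a + z ** c) \<noteq> 0" "?h z \<in> S"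
    obtain k where k: "lf_ball a c z k" using lf_ball_exists[OF z(1)] by blast
    have "x \<in> {z \<in> ?U. ?h z \<in> S}" if "x \<in> mball z k" for x
      using lf_ball_hereditary[OF k that order_refl] z by (simp add: lf_ball_def)
    then have "mball z k \<subseteq> {z \<in> ?U. ?h z \<in> S}" by blast
    then show "\<exists>k. mball z k \<subseteq> {z \<in> ?U. ?h z \<in> S}" by (rule exI)
  qed
  have "z \<in> ?h -` S \<longleftrightarrow> z \<in> {z \<in> ?U. ?h z \<in> S} \<union> (if 0 powr s \<in> S then - ?U else {})" for z
    by (cases "det (a + z ** c) = 0") simp_all
  then have eq: "?h -` S = {z \<in> ?U. ?h z \<in> S} \<union> (if 0 powr s \<in> S then - ?U else {})" by blast
  have "(if 0 powr s \<in> S then - ?U else {}) \<in> sets borel" using U by simp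
  then have "?h -` S \<in> sets borel"
    unfolding eq by (rule sets.Un[OF borel_open[OF o]])
  then show "?h -` S \<inter> space borel \<in> sets borel" by simp
qed

text \<open>Both sides are measures in \<open>B\<close>, so balls suffice. On an
  \<open>lf_ball\<close> the functions gamma(z), |det(a + z c)| and gamma(z*g) are all constant, so
  each side is a constant times a volume.\<close>

theorem hua_measure_transforms:
  fixes a b c d a' b' c' d' :: "'p padic ^ 'n ^ 'n"
  assumes g: "block_inverses a b c d a' b' c' d'"
  shows "transforms_with (hua_measure vol s) a b c d (\<lambda>z. padic_norm (det (a + z ** c)) powr s)"
  unfolding transforms_with_def
proof (intro ballI impI)
  define U where "U = {z. det (a + z ** c) \<noteq> 0}"
  define V where "V = {w. det (a' + w ** c') \<noteq> 0}"
  let ?f = "linear_fractional a b c d" and ?f' = "linear_fractional a' b' c' d'"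
  let ?\<mu> = "hua_measure vol s"
  let ?h = "\<lambda>z. padic_norm (det (a + z ** c)) powr s"
  fix B :: "('p padic ^ 'n ^ 'n) set" assume B: "B \<in> sets borel" "B \<subseteq> {z. det (a + z ** c) \<noteq> 0}"
  have f: "?f z \<in> V" "?f' (?f z) = z" if "z \<in> U" for z
    using linear_fractional_inverse[OF g _ refl] that by (auto simp: U_def V_def)
  have f': "?f' w \<in> U" "?f (?f' w) = w" if "w \<in> V" for w
    using linear_fractional_inverse[OF block_inverses_sym[OF g] _ refl] that by (auto simp: U_def V_def)
  \<comment> \<open>The inverse transformation, with default 0 off \<open>V\<close>. In
    \<open>M\<close> the measure is first restricted to \<open>V\<close>, so the default value
    carries no mass and \<open>M\<close> gives a subset of \<open>U\<close> the measure of its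
    image.\<close>
  define F where "F w = (if w \<in> V then ?f' w else 0)" for w
  have "open V" using open_linear_fractional_vimage[of UNIV a' c'] by (simp add: V_def)
  then have Vb [measurable]: "V \<in> sets borel" by simp
  have F [measurable]: "F \<in> borel_measurable borel"
    unfolding F_def V_def using measurable_linear_fractional[of a' c' b' d'] by simp
  define M where "M = distr (density ?\<mu> (indicator V)) borel F"
  define N where "N = density ?\<mu> (\<lambda>z. ennreal (?h z))"
  have M: "emeasure M S = emeasure ?\<mu> (?f ` S)" if S: "S \<in> sets borel" "S \<subseteq> U" for S
  proof -
    have "F -` S \<in> sets borel" using measurable_sets[OF F S(1)] by simp
    then have "emeasure M S = emeasure ?\<mu> (V \<inter> F -` S)"
      unfolding M_def using S Vb by (simp add: emeasure_distr emeasure_restricted)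
    also have "V \<inter> F -` S = ?f ` S"
      using f f' S(2) by (auto simp: F_def image_iff) (metis)+
    finally show ?thesis .
  qed
  have "emeasure M B = emeasure N B"
  proof (rule emeasure_eq_on_good_balls[where U = U and good = "lf_ball a c"])
    show "sets M = sets borel" "sets N = sets borel" by (simp_all add: M_def N_def)
    show "\<exists>k. lf_ball a c z k" if "z \<in> U" for z
      using lf_ball_exists[of a z c 0] that by (auto simp: U_def)
    show sub: "mball z k \<subseteq> U" if "lf_ball a c z k" for z k
      using lf_ball_hereditary(1)[OF that] by (auto simp: U_def lf_ball_def)
    show "lf_ball a c w l" if "lf_ball a c z k" "w \<in> mball z k" "k \<le> l" for z k w l
      using lf_ball_hereditary(1)[OF that] .
    define C where "C = inverse (hua_const vol (s + 2 * real CARD('n)))"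
    fix z k assume z: "lf_ball a c z k"
    define \<delta> where "\<delta> = padic_norm (det (a + z ** c))"
    have nz: "det (a + z ** c) \<noteq> 0" using z by (simp add: lf_ball_def)
    then have \<delta>: "\<delta> > 0" by (simp add: \<delta>_def less_le)
    have gam: "gamma x = gamma z" if "x \<in> mball z k" for x
    proof -
      have "x - z \<in> mideal 0" using that mideal_mono[of "x - z" "int k" 0] by (simp add: mball_def)
      then show ?thesis using gamma_add_integral[of "x - z" z] by simp
    qed
    have det: "padic_norm (det (a + x ** c)) = \<delta>" if "x \<in> mball z k" for x
      unfolding \<delta>_def by (rule lf_ball_hereditary(2)[OF z that order_refl])
    have "gamma (?f x) = gamma z / \<delta>" if "x \<in> mball z k" for x
    proof -
      have "det (a + x ** c) \<noteq> 0" using sub[OF z] that by (auto simp: U_def)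
      then have "gamma x = \<delta> * gamma (?f x)" using linear_fractional_gamma(1)[OF g _ refl] det[OF that] by metis
      then show ?thesis using gam[OF that] \<delta> by (simp add: field_simps)
    qed
    then have "emeasure M (mball z k) = C * ennreal ((gamma z / \<delta>) powr (- s - 2 * real CARD('n))) *
        emeasure vol (?f ` mball z k)"
      unfolding M[OF mball_borel sub[OF z]] C_def
      by (intro emeasure_hua_measure_gamma_const vol_linear_fractional_ball(1)[OF g z]) auto
    also have "\<dots> = C * (ennreal ((gamma z / \<delta>) powr (- s - 2 * real CARD('n))) *
        ennreal (\<delta> powr (- 2 * real CARD('n)))) * emeasure vol (mball z k)"
      unfolding vol_linear_fractional_ball(2)[OF g z] \<delta>_def[symmetric] by (simp only: mult.assoc)
    also have "ennreal ((gamma z / \<delta>) powr (- s - 2 * real CARD('n))) * ennreal (\<delta> powr (- 2 * real CARD('n))) =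
        ennreal (\<delta> powr s) * ennreal (gamma z powr (- s - 2 * real CARD('n)))"
    proof -
      \<comment> \<open>Here the exponent s + 2n earns its form: (gamma / delta)^(-s-2n) delta^(-2n)
        = delta^s gamma^(-s-2n).\<close>
      have "\<delta> powr s = \<delta> powr (- 2 * real CARD('n)) / \<delta> powr (- s - 2 * real CARD('n))"
        by (simp flip: powr_diff)
      then have "(gamma z / \<delta>) powr (- s - 2 * real CARD('n)) * \<delta> powr (- 2 * real CARD('n)) =
          \<delta> powr s * gamma z powr (- s - 2 * real CARD('n))"
        using \<delta> gamma_pos[of z] by (simp add: powr_divide)
      then show ?thesis by (simp flip: ennreal_mult)
    qed
    finally have M_ball: "emeasure M (mball z k) = ennreal (\<delta> powr s) *
        (C * ennreal (gamma z powr (- s - 2 * real CARD('n))) * emeasure vol (mball z k))"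
      by (simp only: mult_ac)
    have "emeasure N (mball z k) = (\<integral>\<^sup>+ x. ennreal (\<delta> powr s) * indicator (mball z k) x \<partial>?\<mu>)"
      unfolding N_def by (subst emeasure_density) (auto intro!: nn_integral_cong simp: det split: split_indicator)
    also have "\<dots> = ennreal (\<delta> powr s) * emeasure ?\<mu> (mball z k)"
      by (simp add: nn_integral_cmult_indicator)
    also have "emeasure ?\<mu> (mball z k) = C * ennreal (gamma z powr (- s - 2 * real CARD('n))) * emeasure vol (mball z k)"
      unfolding C_def by (rule emeasure_hua_measure_gamma_const[OF mball_borel gam])
    finally show "emeasure M (mball z k) = emeasure N (mball z k)" using M_ball by simp
    have "emeasure vol (mball z k) < \<infinity>"
      using vol_mideal_finite[of "int k"] by (simp add: mball_eq_image vol_translate)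
    then show "emeasure M (mball z k) \<noteq> \<infinity>"
      using inverse_hua_const_finite[of "s + 2 * real CARD('n)"]
      unfolding M_ball C_def by (auto simp: ennreal_mult_eq_top_iff)
    qed (use B in \<open>auto simp: U_def\<close>)
  then show "emeasure ?\<mu> (?f ` B) = (\<integral>\<^sup>+ z\<in>B. ennreal (?h z) \<partial>?\<mu>)"
    using B M[OF B(1)] unfolding N_def U_def by (simp add: emeasure_density)
qed

end

section \<open>Finiteness of the normalizing constant\<close>

text \<open>A choice of one element in each class of the p-adic numbers modulo O. It depends on the
  class only, since equivalent \<open>x\<close> define the same predicate under
  \<open>SOME\<close>.\<close>

definition coset_rep :: "'p::prime_type padic \<Rightarrow> 'p padic" where
  "coset_rep x = (SOME y. y - x \<in> pideal 0)"

lemma coset_rep_diff: "coset_rep x - x \<in> pideal 0"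
  unfolding coset_rep_def by (rule someI[of _ x]) simp

lemma coset_rep_cong:
  assumes "x - y \<in> pideal 0"
  shows "coset_rep x = coset_rep y"
proof -
  have "z - x \<in> pideal 0 \<longleftrightarrow> z - y \<in> pideal 0" for z
    using pideal_add[OF _ assms, of "z - x"] pideal_diff[OF _ assms, of "z - y"] by auto
  then show ?thesis by (simp add: coset_rep_def)
qed

lemma coset_rep_eqI:
  assumes "coset_rep x - coset_rep y \<in> pideal 0"
  shows "coset_rep x = coset_rep y"
proof (rule coset_rep_cong)
  have "(coset_rep x - coset_rep y) - (coset_rep x - x) + (coset_rep y - y) \<in> pideal 0"
    by (rule pideal_add[OF pideal_diff[OF assms coset_rep_diff] coset_rep_diff])
  then show "x - y \<in> pideal 0" by (simp add: algebra_simps)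
qed

lemma countable_range_coset_rep: "countable (range (coset_rep :: 'p::prime_type padic \<Rightarrow> _))"
proof -
  obtain D :: "'p padic set" where D: "countable D" "\<And>x e. e > 0 \<Longrightarrow> \<exists>d\<in>D. padic_norm (x - d) < e"
    by (rule countable_dense_padic) blast
  have "coset_rep x \<in> coset_rep ` D" for x
  proof -
    obtain d where d: "d \<in> D" "padic_norm (x - d) < 1" using D(2)[of 1 x] by auto
    then have "x - d \<in> pideal 0" by (simp add: pideal_0_iff)
    then have "coset_rep x = coset_rep d" by (rule coset_rep_cong)
    then show ?thesis using d(1) by (rule image_eqI)
  qed
  then have "range coset_rep \<subseteq> coset_rep ` D" by blast
  then show ?thesis using D(1) by (intro countable_subset[of "range coset_rep" "coset_rep ` D"] countable_image)
qed

text \<open>Representatives of the translates of \<open>Mat(n, O)\<close> by matrices supported in column \<open>j\<close>.\<close>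

definition column_reps :: "'n \<Rightarrow> ('p::prime_type padic ^ 'n ^ 'n) set" where
  "column_reps j = {t. \<forall>i l. if l = j then t $ i $ l \<in> range coset_rep else t $ i $ l = 0}"

lemma countable_column_reps: "countable (column_reps j :: ('p::prime_type padic ^ 'n ^ 'n) set)"
proof (rule countable_subset)
  let ?f = "\<lambda>v :: 'p padic ^ 'n. (\<chi> i l. if l = j then v $ i else 0) :: 'p padic ^ 'n ^ 'n"
  show "countable (?f ` {v. \<forall>i. v $ i \<in> range coset_rep})"
    by (intro countable_image countable_vec countable_range_coset_rep)
  show "column_reps j \<subseteq> ?f ` {v. \<forall>i. v $ i \<in> range coset_rep}"
  proof
    fix t :: "'p padic ^ 'n ^ 'n" assume t: "t \<in> column_reps j"
    then have *: "if l = j then t $ i $ l \<in> range coset_rep else t $ i $ l = 0" for i l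
      by (simp add: column_reps_def)
    show "t \<in> ?f ` {v. \<forall>i. v $ i \<in> range coset_rep}"
    proof (rule image_eqI[of _ _ "\<chi> i. t $ i $ j"])
      show "t = ?f (\<chi> i. t $ i $ j)" using * by (auto simp: vec_eq_iff split: if_splits)
      show "(\<chi> i. t $ i $ j) \<in> {v. \<forall>i. v $ i \<in> range coset_rep}" using *[of j] by simp
    qed
  qed
qed

lemma column_reps_eqI:
  fixes t u :: "'p::prime_type padic ^ 'n ^ 'n"
  assumes "t \<in> column_reps j" "u \<in> column_reps j" "t - u \<in> mideal 0"
  shows "t = u"
proof -
  have "t $ i $ l = u $ i $ l" for i l
  proof (cases "l = j")
    case True
    then have "t $ i $ l \<in> range coset_rep" "u $ i $ l \<in> range coset_rep"
      using assms(1,2) by (auto simp: column_reps_def split: if_splits)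
    then obtain x y where "t $ i $ l = coset_rep x" "u $ i $ l = coset_rep y" by blast
    moreover have "t $ i $ l - u $ i $ l \<in> pideal 0" using assms(3) by (simp add: mideal_def)
    ultimately show ?thesis using coset_rep_eqI by metis
  next
    case False
    then show ?thesis using assms(1,2) by (auto simp: column_reps_def split: if_splits)
  qed
  then show ?thesis by (simp add: vec_eq_iff)
qed

text \<open>Right multiplication by this matrix unit keeps column \<open>j\<close> and erases the
  others, which turns conditions on one column into matrix identities.\<close>

definition unit_proj :: "'n \<Rightarrow> 'p::prime_type padic ^ 'n ^ 'n" where
  "unit_proj j = single_entry j j 1"

lemma mult_unit_proj_nth [simp]:
  fixes X :: "'p::prime_type padic ^ 'n ^ 'n"
  shows "(X ** unit_proj j) $ i $ l = (if l = j then X $ i $ l else 0)"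
  by (subst diagonal_mult_nth(2)) (auto simp: unit_proj_def)

lemma unit_proj_in_mideal [simp]: "unit_proj j \<in> mideal 0"
  by (simp add: unit_proj_def mideal_def)

lemma column_reps_unit_proj:
  fixes t :: "'p::prime_type padic ^ 'n ^ 'n"
  assumes "t \<in> column_reps j" shows "t ** unit_proj j = t"
proof -
  have "(t ** unit_proj j) $ i $ l = t $ i $ l" for i l
    using assms by (auto simp: column_reps_def split: if_splits)
  then show ?thesis by (simp add: vec_eq_iff)
qed

definition mscale :: "'p::prime_type padic \<Rightarrow> 'p padic ^ 'n ^ 'n \<Rightarrow> 'p padic ^ 'n ^ 'n" where
  "mscale c X = (\<chi> i j. c * X $ i $ j)"

lemma mscale_nth [simp]: "mscale c X $ i $ j = c * X $ i $ j"
  by (simp add: mscale_def)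

lemma mscale_mult:
  fixes X Y :: "'p::prime_type padic ^ 'n ^ 'n"
  shows "mscale c (X ** Y) = mscale c X ** Y" "mscale c (X ** Y) = X ** mscale c Y"
  by (simp_all add: vec_eq_iff matrix_matrix_mult_def sum_distrib_left mult_ac)

lemma mscale_mscale: "mscale c (mscale d X) = mscale (c * d) X"
  by (simp add: vec_eq_iff mult_ac)

lemma mscale_add: "mscale c (X + Y) = mscale c X + mscale c Y"
  by (simp add: vec_eq_iff algebra_simps)

lemma mscale_in_mideal: "c \<in> pideal 0 \<Longrightarrow> X \<in> mideal k \<Longrightarrow> mscale c X \<in> mideal k"
  by (simp add: mideal_def pideal_mult_left)

lemma column_lattice_add: "x \<in> column_lattice z \<Longrightarrow> y \<in> column_lattice z \<Longrightarrow> x + y \<in> column_lattice z"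
proof -
  assume "x \<in> column_lattice z" "y \<in> column_lattice z"
  then obtain X Y X' Y' where *: "X \<in> mideal 0" "Y \<in> mideal 0" "x = X + z ** Y"
    "X' \<in> mideal 0" "Y' \<in> mideal 0" "y = X' + z ** Y'" by (auto simp: column_lattice_def)
  then have "x + y = (X + X') + z ** (Y + Y')" by (simp add: matrix_add_ldistrib)
  then show "x + y \<in> column_lattice z" using * mideal_add unfolding column_lattice_def by blast
qed

lemma column_lattice_mscale:
  fixes z :: "'p::prime_type padic ^ 'n ^ 'n"
  assumes "c \<in> pideal 0" "x \<in> column_lattice z"
  shows "mscale c x \<in> column_lattice z"
proof -
  obtain X Y where *: "X \<in> mideal 0" "Y \<in> mideal 0" "x = X + z ** Y"
    using assms(2) by (auto simp: column_lattice_def)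
  then have "mscale c x = mscale c X + z ** mscale c Y" by (simp add: mscale_add mscale_mult(2))
  then show ?thesis using * mscale_in_mideal[OF assms(1)] unfolding column_lattice_def by blast
qed

lemma column_lattice_diff:
  fixes z :: "'p::prime_type padic ^ 'n ^ 'n"
  assumes "x \<in> column_lattice z" "y \<in> column_lattice z"
  shows "x - y \<in> column_lattice z"
proof -
  have "mscale (- 1) y = - y" by (simp add: vec_eq_iff)
  then show ?thesis
    using column_lattice_add[OF assms(1) column_lattice_mscale[of "- 1", OF _ assms(2)]] by simp
qed

lemma mideal_subset_column_lattice:
  fixes X z :: "'p::prime_type padic ^ 'n ^ 'n"
  assumes "X \<in> mideal 0" shows "X \<in> column_lattice z"
proof -
  have "X = X + z ** 0" by (simp add: vec_eq_iff matrix_matrix_mult_def)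
  then show ?thesis using assms zero_in_mideal unfolding column_lattice_def by blast
qed

section \<open>Lattices in a single column and the effect of adding a column\<close>

text \<open>Column \<open>j\<close> lies in \<open>p\<^sup>-\<^sup>m (O\<^sup>n + z O\<^sup>n)\<close>, the other columns are integral.\<close>

definition column_lattice_at :: "'n \<Rightarrow> nat \<Rightarrow> 'p::prime_type padic ^ 'n ^ 'n \<Rightarrow> ('p padic ^ 'n ^ 'n) set" where
  "column_lattice_at j m z =
     {w. mscale (unif powi int m) (w ** unit_proj j) \<in> column_lattice z \<and> w - w ** unit_proj j \<in> mideal 0}"

text \<open>Projection to column \<open>j\<close> acts from the right and so commutes with
  \<open>A\<close>; after removing \<open>A\<close>, both conditions become conditions on single
  entries.\<close>

lemma column_lattice_at_smith:
  fixes A B :: "'p::prime_type padic ^ 'n ^ 'n"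
  assumes A: "A \<in> GL_integral" and B: "B \<in> GL_integral"
  shows "column_lattice_at j m (A ** diag_powers k ** B) =
    (\<lambda>u. A ** u ** mat 1) ` matbox (\<lambda>i l. if l = j then - pos_exponent k i - int m else 0)"
proof -
  let ?z = "A ** diag_powers k ** B" and ?P = "unit_proj j :: 'p padic ^ 'n ^ 'n"
  let ?c = "unif powi int m :: 'p padic"
  note Ai = GL_integral_D[OF A]
  have cancel: "matrix_inv A ** (A ** x) = x" "A ** (matrix_inv A ** x) = x" for x :: "'p padic ^ 'n ^ 'n"
    using Ai by (simp_all add: matrix_mul_assoc)
  have 1: "A ** x \<in> column_lattice ?z \<longleftrightarrow> x \<in> matbox (\<lambda>i j. - pos_exponent k i)" for x
  proof -
    have "A ** x \<in> column_lattice ?z \<longleftrightarrow> (\<exists>y\<in>matbox (\<lambda>i j. - pos_exponent k i). A ** x = A ** y)"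
      unfolding column_lattice_smith[OF A B] by auto
    also have "\<dots> \<longleftrightarrow> x \<in> matbox (\<lambda>i j. - pos_exponent k i)" using cancel(1) by metis
    finally show ?thesis .
  qed
  have 2: "A ** x \<in> mideal 0 \<longleftrightarrow> x \<in> mideal 0" for x :: "'p padic ^ 'n ^ 'n"
    using mideal_mult_left[OF Ai(1), of x 0] mideal_mult_left[OF GL_integral_D(1)[OF Ai(4)], of "A ** x" 0]
    by (auto simp: cancel)
  have 3: "A ** u \<in> column_lattice_at j m ?z \<longleftrightarrow>
      u \<in> matbox (\<lambda>i l. if l = j then - pos_exponent k i - int m else 0)" for u
  proof -
    have "A ** u \<in> column_lattice_at j m ?z \<longleftrightarrow>
        A ** mscale ?c (u ** ?P) \<in> column_lattice ?z \<and> A ** (u - u ** ?P) \<in> mideal 0"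
      by (simp add: column_lattice_at_def mscale_mult(2)[symmetric] matrix_minus_ldistrib matrix_mul_assoc)
    also have "\<dots> \<longleftrightarrow> mscale ?c (u ** ?P) \<in> matbox (\<lambda>i j. - pos_exponent k i) \<and> u - u ** ?P \<in> mideal 0"
      unfolding 1 2 ..
    also have "\<dots> \<longleftrightarrow> (\<forall>i. ?c * u $ i $ j \<in> pideal (- pos_exponent k i)) \<and> (\<forall>i l. l \<noteq> j \<longrightarrow> u $ i $ l \<in> pideal 0)"
      by (auto simp: matbox_def mideal_def if_distrib[of "\<lambda>x. _ * x"] split: if_splits)
    also have "\<dots> \<longleftrightarrow> (\<forall>i. u $ i $ j \<in> pideal (- pos_exponent k i - int m)) \<and> (\<forall>i l. l \<noteq> j \<longrightarrow> u $ i $ l \<in> pideal 0)"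
    proof -
      have "?c * u $ i $ j \<in> pideal (- pos_exponent k i) \<longleftrightarrow> u $ i $ j \<in> pideal (- pos_exponent k i - int m)" for i
        using unif_powi_mult_in_pideal_iff[of "int m" "u $ i $ j" "- pos_exponent k i - int m"] by simp
      then show ?thesis by simp
    qed
    also have "\<dots> \<longleftrightarrow> u \<in> matbox (\<lambda>i l. if l = j then - pos_exponent k i - int m else 0)"
      by (auto simp: matbox_def)
    finally show ?thesis .
  qed
  show ?thesis
  proof (intro equalityI subsetI)
    fix w assume "w \<in> column_lattice_at j m ?z"
    then have "matrix_inv A ** w \<in> matbox (\<lambda>i l. if l = j then - pos_exponent k i - int m else 0)"
      using 3[of "matrix_inv A ** w"] by (simp add: cancel)
    then show "w \<in> (\<lambda>u. A ** u ** mat 1) ` matbox (\<lambda>i l. if l = j then - pos_exponent k i - int m else 0)"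
      by (intro image_eqI[of _ _ "matrix_inv A ** w"]) (simp_all add: cancel)
  qed (use 3 in auto)
qed

context padic_haar
begin

text \<open>Only one column ranges over the lattice, so \<open>gamma z\<close> appears to the first
  power. The scaling by p^(-m) in that column contributes p^m for each of its n entries.\<close>

lemma vol_column_lattice_at:
  fixes z :: "'p padic ^ 'n ^ 'n"
  shows "column_lattice_at j m z \<in> sets borel"
    "emeasure vol (column_lattice_at j m z) = ennreal (gamma z * real CARD('p) ^ (m * CARD('n)))"
proof -
  obtain A B k where z: "A \<in> GL_integral" "B \<in> GL_integral" "z = A ** diag_powers k ** B"
    by (rule smith_normal_form)
  show "column_lattice_at j m z \<in> sets borel"
    unfolding z(3) column_lattice_at_smith[OF z(1,2)]
    by (rule vol_two_sided_mult_aux(1)) (use GL_integral_D(3)[OF z(1)] in auto)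
  have "emeasure vol (column_lattice_at j m z) =
      emeasure vol (matbox (\<lambda>i l. if l = j then - pos_exponent k i - int m else 0))"
    unfolding z(3) column_lattice_at_smith[OF z(1,2)] using GL_integral_D(2,3)[OF z(1)]
    by (subst vol_two_sided_mult) auto
  also have "\<dots> = ennreal (real CARD('p) powi ((\<Sum>i\<in>UNIV. pos_exponent k i) + int (m * CARD('n))))"
    by (simp add: vol_matbox sum_subtractf sum_negf algebra_simps)
  also have "real CARD('p) powi ((\<Sum>i\<in>UNIV. pos_exponent k i) + int (m * CARD('n))) =
      gamma z * real CARD('p) ^ (m * CARD('n))"
    unfolding z(3) gamma_smith[OF z(1,2)] by (subst power_int_add) (simp_all del: of_nat_mult)
  finally show "emeasure vol (column_lattice_at j m z) = ennreal (gamma z * real CARD('p) ^ (m * CARD('n)))" .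
qed

text \<open>The translates t + Mat(n, O) by the counted representatives are disjoint, have volume 1
  and lie in \<open>column_lattice_at j m z\<close>, so their number is at most its volume.\<close>

lemma count_column_reps_le:
  fixes z :: "'p padic ^ 'n ^ 'n"
  shows "emeasure (count_space (column_reps j)) {t \<in> column_reps j. mscale (unif powi int m) t \<in> column_lattice z} \<le>
    ennreal (gamma z * real CARD('p) ^ (m * CARD('n)))"
proof -
  let ?T = "{t \<in> column_reps j. mscale (unif powi int m) t \<in> column_lattice z}"
  let ?F = "\<lambda>t. (\<lambda>X. t + X) ` (mideal 0 :: ('p padic ^ 'n ^ 'n) set)"
  have T: "countable ?T" by (rule countable_subset[OF _ countable_column_reps]) auto
  have "emeasure (count_space (column_reps j)) ?T = emeasure (count_space ?T) ?T"
    by (simp add: emeasure_count_space)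
  also have "\<dots> = (\<integral>\<^sup>+ t. 1 \<partial>count_space ?T)" by simp
  also have "\<dots> = (\<integral>\<^sup>+ t. emeasure vol (?F t) \<partial>count_space ?T)"
    by (intro nn_integral_cong) (simp add: vol_translate)
  also have "\<dots> = emeasure vol (\<Union>(?F ` ?T))"
  proof (rule emeasure_UN_countable[symmetric, OF _ T])
    show "?F t \<in> sets vol" for t by (simp add: translate_borel)
    show "disjoint_family_on ?F ?T"
      unfolding disjoint_family_on_def
    proof (intro ballI impI)
      fix t u assume tu: "t \<in> ?T" "u \<in> ?T" "t \<noteq> u"
      show "?F t \<inter> ?F u = {}"
      proof (rule ccontr)
        assume "?F t \<inter> ?F u \<noteq> {}"
        then obtain X Y where XY: "X \<in> mideal 0" "Y \<in> mideal 0" "t + X = u + Y" by blast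
        then have "t - u = Y - X" by (simp add: algebra_simps)
        then have "t - u \<in> mideal 0" using XY by (simp add: mideal_diff)
        then show False using tu column_reps_eqI by blast
      qed
    qed
  qed
  also have "\<dots> \<le> emeasure vol (column_lattice_at j m z)"
  proof (rule emeasure_mono)
    show "\<Union>(?F ` ?T) \<subseteq> column_lattice_at j m z"
    proof safe
      fix t X :: "'p padic ^ 'n ^ 'n"
      assume t: "t \<in> column_reps j" "mscale (unif powi int m) t \<in> column_lattice z" and X: "X \<in> mideal 0"
      have P: "t ** unit_proj j = t" by (rule column_reps_unit_proj[OF t(1)])
      have XP: "X ** unit_proj j \<in> mideal 0" using X by (rule mideal_mult_left) simp
      have "(unif powi int m :: 'p padic) \<in> pideal 0"
        by (rule pideal_mono[OF unif_powi_in_pideal]) simp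
      then have "mscale (unif powi int m) t + mscale (unif powi int m) (X ** unit_proj j) \<in> column_lattice z"
        by (intro column_lattice_add[OF t(2) mideal_subset_column_lattice[OF mscale_in_mideal[OF _ XP]]])
      then show "t + X \<in> column_lattice_at j m z"
        using X XP by (simp add: column_lattice_at_def matrix_add_rdistrib P mscale_add mideal_diff)
    qed
  qed (simp add: vol_column_lattice_at)
  finally show ?thesis by (simp add: vol_column_lattice_at)
qed

text \<open>The column of \<open>t\<close> has order at least p^m modulo O^n + z O^n. Since column
  \<open>j\<close> of \<open>z\<close> is integral, the lattice of z + t contains that of z and also
  \<open>t\<close>, hence p^m disjoint cosets of the former.\<close>

lemma gamma_add_column_ge:
  fixes z t :: "'p padic ^ 'n ^ 'n"
  assumes z: "\<And>i. z $ i $ j \<in> pideal 0" and t: "t ** unit_proj j = t"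
    and m: "\<And>l. l < m \<Longrightarrow> mscale (unif powi int l) t \<notin> column_lattice z"
  shows "gamma z * real CARD('p) ^ m \<le> gamma (z + t)"
proof -
  let ?P = "unit_proj j :: 'p padic ^ 'n ^ 'n"
  \<comment> \<open>Cosets through the multiples i t with i < p^m, in the lattice of the single
    column \<open>j\<close>, where volume is \<open>gamma\<close> itself.\<close>
  let ?F = "\<lambda>i. (\<lambda>w. mscale (of_nat i) t + w) ` column_lattice_at j 0 z"
  have zP: "z ** ?P \<in> mideal 0" using z by (simp add: mideal_def)
  have sub1: "x \<in> column_lattice (z + t)" if x: "x \<in> column_lattice z" for x
  proof -
    obtain X Y where XY: "X \<in> mideal 0" "Y \<in> mideal 0" "x = X + z ** Y"
      using x by (auto simp: column_lattice_def)
    \<comment> \<open>Erasing row \<open>j\<close> of \<open>Y\<close> removes the influence of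
      \<open>t\<close>, which lives in column \<open>j\<close>; the part of z Y lost in this way is
      integral by \<open>zP\<close>.\<close>
    have "(z + t) ** (Y - ?P ** Y) = z ** Y - z ** ?P ** Y + t ** Y - t ** ?P ** Y"
      by (simp add: matrix_add_rdistrib matrix_minus_ldistrib matrix_mul_assoc)
    then have "x = (X + z ** ?P ** Y) + (z + t) ** (Y - ?P ** Y)" unfolding t XY(3) by simp
    moreover have "X + z ** ?P ** Y \<in> mideal 0" "Y - ?P ** Y \<in> mideal 0"
      using XY zP by (auto intro!: mideal_add mideal_diff mideal_mult_left)
    ultimately show ?thesis by (auto simp: column_lattice_def)
  qed
  have tin: "t \<in> column_lattice (z + t)"
  proof -
    have "t = - (z ** ?P) + (z + t) ** ?P" by (simp add: matrix_add_rdistrib t)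
    then show ?thesis using zP unfolding column_lattice_def by (metis (mono_tags, lifting) mem_Collect_eq mideal_minus unit_proj_in_mideal)
  qed
  have "ennreal (gamma z * real CARD('p) ^ m) = (\<Sum>i\<in>{..<CARD('p) ^ m}. emeasure vol (column_lattice_at j 0 z))"
    by (simp add: vol_column_lattice_at ennreal_of_nat_eq_real_of_nat ennreal_mult[symmetric] less_imp_le mult.commute)
  also have "\<dots> = (\<Sum>i\<in>{..<CARD('p) ^ m}. emeasure vol (?F i))"
    by (intro sum.cong refl) (simp add: vol_translate vol_column_lattice_at)
  also have "\<dots> = emeasure vol (\<Union>i\<in>{..<CARD('p) ^ m}. ?F i)"
  proof (rule sum_emeasure)
    show "?F ` {..<CARD('p) ^ m} \<subseteq> sets vol" using translate_borel[OF vol_column_lattice_at(1)] by auto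
    have disj: "?F i \<inter> ?F i' = {}" if "i < i'" "i' < CARD('p) ^ m" for i i'
    proof (rule ccontr)
      assume "?F i \<inter> ?F i' \<noteq> {}"
      then obtain w w' where w: "w \<in> column_lattice_at j 0 z" "w' \<in> column_lattice_at j 0 z"
        "mscale (of_nat i) t + w = mscale (of_nat i') t + w'" by blast
      define d where "d = (of_nat i' - of_nat i :: 'p padic)"
      have "mscale d t = mscale (of_nat i') t - mscale (of_nat i) t" by (simp add: d_def vec_eq_iff algebra_simps)
      also have "\<dots> = w - w'" using w(3) by (simp add: algebra_simps)
      finally have "mscale d (t ** ?P) = w ** ?P - w' ** ?P"
        by (simp add: mscale_mult(1) matrix_minus_rdistrib)
      moreover have "mscale 1 x = x" for x :: "'p padic ^ 'n ^ 'n" by (simp add: vec_eq_iff)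
      then have "w ** ?P \<in> column_lattice z" "w' ** ?P \<in> column_lattice z"
        using w(1,2) by (auto simp: column_lattice_at_def)
      ultimately have dt: "mscale d t \<in> column_lattice z"
        using column_lattice_diff t by metis
      have "\<not> int CARD('p) ^ m dvd int i' - int i"
      proof
        assume "int CARD('p) ^ m dvd int i' - int i"
        then have "int CARD('p) ^ m \<le> int i' - int i" using that(1) by (intro zdvd_imp_le) auto
        moreover have "int i' < int CARD('p) ^ m" using that(2) by (metis of_nat_less_iff of_nat_power)
        ultimately show False by simp
      qed
      then have "(of_int (int i' - int i) :: 'p padic) \<notin> pideal (int m)" by (simp only: of_int_in_pideal_iff simp_thms)
      then have d: "d \<notin> pideal (int m)" by (simp add: d_def)
      then have dn: "real CARD('p) powi (- int m) < padic_norm d" by (simp add: pideal_def)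
      have dnz: "d \<noteq> 0" using d zero_in_pideal by metis
      have m0: "m > 0" using that by (cases m) auto
      \<comment> \<open>As |d| > p^(-m) strictly, p^m / d is even divisible by p, so p^(m-1) / d is
        integral. Thus d t in the lattice would put p^(m-1) t there, contrary to assumption
        \<open>m\<close> for l = m - 1.\<close>
      have "padic_norm (unif powi int m / d) < 1"
        using dn dnz unfolding padic_norm_divide padic_norm_unif_powi
        by (subst divide_less_eq_1_pos) (auto simp: less_le)
      then have "unif powi int m / d \<in> pideal 1" by (simp add: padic_norm_less_1_iff)
      then have "unif powi (- 1) * (unif powi int m / d) \<in> pideal (- 1 + 1)"
        by (intro pideal_mult unif_powi_in_pideal)
      then have "unif powi (- 1) * (unif powi int m / d) \<in> pideal 0" by simp
      then have "mscale (unif powi (- 1) * (unif powi int m / d)) (mscale d t) \<in> column_lattice z"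
        using dt by (rule column_lattice_mscale)
      moreover have "unif powi (- 1) * (unif powi int m / d) * d = unif powi int (m - 1)"
      proof -
        have "unif powi (- 1) * (unif powi int m / d) * d = unif powi (- 1) * unif powi int m" using dnz by simp
        also have "\<dots> = unif powi (- 1 + int m)" by (rule power_int_add[symmetric]) simp
        finally show ?thesis using m0 by (simp add: of_nat_diff add.commute)
      qed
      ultimately have "mscale (unif powi int (m - 1)) t \<in> column_lattice z" by (simp only: mscale_mscale)
      then show False using m[of "m - 1"] m0 by simp
    qed
    show "disjoint_family_on ?F {..<CARD('p) ^ m}"
      unfolding disjoint_family_on_def
    proof (intro ballI impI)
      fix i i' assume "i \<in> {..<CARD('p) ^ m}" "i' \<in> {..<CARD('p) ^ m}" "i \<noteq> i'"
      then show "?F i \<inter> ?F i' = {}" using disj[of i i'] disj[of i' i] by (cases "i < i'") auto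
    qed
  qed simp
  also have "\<dots> \<le> emeasure vol (column_lattice_at j 0 (z + t))"
  proof (rule emeasure_mono)
    show "(\<Union>i\<in>{..<CARD('p) ^ m}. ?F i) \<subseteq> column_lattice_at j 0 (z + t)"
    proof safe
      fix i w assume w: "w \<in> column_lattice_at j 0 z"
      have 1: "mscale 1 x = x" for x :: "'p padic ^ 'n ^ 'n" by (simp add: vec_eq_iff)
      have "mscale (of_nat i) t + w ** ?P \<in> column_lattice (z + t)"
        using w tin sub1 by (intro column_lattice_add column_lattice_mscale) (auto simp: column_lattice_at_def 1)
      then show "mscale (of_nat i) t + w \<in> column_lattice_at j 0 (z + t)"
        using w by (simp add: column_lattice_at_def 1 matrix_add_rdistrib t flip: mscale_mult(1))
    qed
  qed (simp add: vol_column_lattice_at)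
  finally have "ennreal (gamma z * real CARD('p) ^ m) \<le> ennreal (gamma (z + t))"
    by (simp add: vol_column_lattice_at)
  then show ?thesis by (subst (asm) ennreal_le_iff) (auto intro: less_imp_le)
qed

end

text \<open>The sets interpolating between Mat(n, O), for empty \<open>S\<close>, and all matrices,
  for \<open>S = UNIV\<close>.\<close>

definition integral_off :: "'n set \<Rightarrow> ('p::prime_type padic ^ 'n ^ 'n) set" where
  "integral_off S = {z. \<forall>i j. j \<notin> S \<longrightarrow> z $ i $ j \<in> pideal 0}"

lemma integral_off_borel [measurable]: "integral_off S \<in> sets borel"
proof (rule borel_open)
  have "mball z 0 \<subseteq> integral_off S" if "z \<in> integral_off S" for z :: "'a padic ^ 'b ^ 'b"
    using that by (auto simp: mball_eq_image integral_off_def mideal_def intro!: pideal_add)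
  then show "open (integral_off S :: ('a padic ^ 'b ^ 'b) set)" unfolding open_matrix_iff by blast
qed

lemma integral_off_insert:
  fixes z :: "'p::prime_type padic ^ 'n ^ 'n"
  assumes "z \<in> integral_off (insert j S)"
  obtains t where "t \<in> column_reps j" "z - t \<in> integral_off S"
proof
  let ?t = "(\<chi> i l. if l = j then coset_rep (z $ i $ l) else 0) :: 'p padic ^ 'n ^ 'n"
  show "?t \<in> column_reps j" by (simp add: column_reps_def)
  have "z $ i $ j - coset_rep (z $ i $ j) \<in> pideal 0" for i
    using coset_rep_diff[of "z $ i $ j"] by (subst pideal_diff_commute)
  then show "z - ?t \<in> integral_off S" using assms by (auto simp: integral_off_def)
qed

lemma nn_integral_count_space_ge:
  assumes "t \<in> T" shows "f t \<le> (\<integral>\<^sup>+ t. f t \<partial>count_space T)"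
proof -
  have "f t = (\<integral>\<^sup>+ x. f x * indicator {t} x \<partial>count_space T)"
    using assms by (subst nn_integral_indicator_singleton) (auto simp: emeasure_count_space)
  also have "\<dots> \<le> (\<integral>\<^sup>+ t. f t \<partial>count_space T)"
    by (intro nn_integral_mono) (auto split: split_indicator)
  finally show ?thesis .
qed

section \<open>Convergence by releasing the columns\<close>

context padic_haar
begin

lemma nn_integral_vol_translate:
  assumes f: "f \<in> borel_measurable borel"
  shows "(\<integral>\<^sup>+ z. f (t + z) \<partial>vol) = (\<integral>\<^sup>+ z. f z \<partial>vol)"
proof -
  have m: "(\<lambda>z. t + z) \<in> borel_measurable borel"
    using measurable_translate[of "- t"] by (simp add: add.commute)
  have "distr vol borel (\<lambda>z. t + z) = vol"
  proof (rule measure_eqI)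
    fix A assume "A \<in> sets (distr vol borel (\<lambda>z. t + z))"
    then have A: "A \<in> sets borel" by simp
    have "(\<lambda>z. t + z) -` A = (\<lambda>z. - t + z) ` A" 
      unfolding translate_image_eq[of "- t" A] by (simp add: add.commute)
    then show "emeasure (distr vol borel (\<lambda>z. t + z)) A = emeasure vol A"
      using A m by (subst emeasure_distr) (auto simp: vol_translate simp del: uminus_add_conv_diff)
  qed simp
  then have "(\<integral>\<^sup>+ z. f z \<partial>vol) = (\<integral>\<^sup>+ z. f z \<partial>distr vol borel (\<lambda>z. t + z))" by simp
  also have "\<dots> = (\<integral>\<^sup>+ z. f (t + z) \<partial>vol)" using f m by (intro nn_integral_distr) auto
  finally show ?thesis by simp
qed

text \<open>If m is least with p^m t in the lattice of z, the summand is at most (gamma(z)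
  p^m)^(-alpha), and at most gamma(z) p^(mn) representatives satisfy this membership. Summing over m
  gives ratio p^(n - alpha) and one more factor gamma(z), which is the drop of alpha by one.\<close>

lemma gamma_column_sum_le:
  fixes z :: "'p padic ^ 'n ^ 'n"
  assumes z: "\<And>i. z $ i $ j \<in> pideal 0" and \<alpha>: "\<alpha> > 0"
  shows "(\<integral>\<^sup>+ t. ennreal (gamma (t + z) powr (- \<alpha>)) \<partial>count_space (column_reps j)) \<le>
    (\<Sum>m. ennreal ((real CARD('p) powr (real CARD('n) - \<alpha>)) ^ m)) * ennreal (gamma z powr (- (\<alpha> - 1)))"
proof -
  let ?T = "column_reps j :: ('p padic ^ 'n ^ 'n) set"
  \<comment> \<open>Membership at \<open>m\<close> without minimality. The summand for
    \<open>t\<close> is bounded by the term at the least such m; the further terms only enlarge the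
    bound.\<close>
  define E where "E m = {t \<in> ?T. mscale (unif powi int m) t \<in> column_lattice z}" for m :: nat
  define a where "a m = gamma z powr (- \<alpha>) * (real CARD('p) powr (- \<alpha>)) ^ m" for m :: nat
  have a0: "a m \<ge> 0" for m by (simp add: a_def)
  have p0: "real CARD('p) > 0" by simp
  have ptwise: "ennreal (gamma (t + z) powr (- \<alpha>)) \<le> (\<Sum>m. ennreal (a m) * indicator (E m) t)" if t: "t \<in> ?T" for t
  proof -
    obtain N :: nat where N: "t \<in> mideal (- int N)" by (rule in_some_mideal)
    have "unif powi int N * t $ i $ l \<in> pideal (int N + - int N)" for i l
      using N by (intro pideal_mult unif_powi_in_pideal) (simp add: mideal_def)
    then have "mscale (unif powi int N) t \<in> column_lattice z"
      by (intro mideal_subset_column_lattice) (simp add: mideal_def)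
    then have ex: "\<exists>m. mscale (unif powi int m) t \<in> column_lattice z" ..
    define m where "m = (LEAST m. mscale (unif powi int m) t \<in> column_lattice z)"
    have m: "mscale (unif powi int m) t \<in> column_lattice z"
      using LeastI_ex[OF ex] by (simp add: m_def)
    have "gamma z * real CARD('p) ^ m \<le> gamma (z + t)"
      using not_less_Least unfolding m_def
      by (intro gamma_add_column_ge[OF z column_reps_unit_proj[OF t]]) auto
    then have "gamma (z + t) powr (- \<alpha>) \<le> (gamma z * real CARD('p) ^ m) powr (- \<alpha>)"
      using \<alpha> by (intro powr_mono2') (auto intro!: mult_pos_pos)
    also have "\<dots> = a m"
      using p0 gamma_pos[of z]
      by (simp add: a_def powr_mult less_imp_le powr_powr mult.commute flip: powr_realpow)
    finally have "ennreal (gamma (t + z) powr (- \<alpha>)) \<le> ennreal (a m) * indicator (E m) t"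
      using m t by (simp add: E_def add.commute a0)
    also have "\<dots> = (\<Sum>k\<in>{m}. ennreal (a k) * indicator (E k) t)"
      by (subst sum.insert) (simp_all only: finite.emptyI empty_iff not_False_eq_True sum.empty add_0_right)
    also have "\<dots> \<le> (\<Sum>m. ennreal (a m) * indicator (E m) t)" by (rule sum_le_suminf) auto
    finally show ?thesis .
  qed
  have "(\<integral>\<^sup>+ t. ennreal (gamma (t + z) powr (- \<alpha>)) \<partial>count_space ?T) \<le>
      (\<integral>\<^sup>+ t. (\<Sum>m. ennreal (a m) * indicator (E m) t) \<partial>count_space ?T)"
    by (intro nn_integral_mono) (use ptwise in simp)
  also have "\<dots> = (\<Sum>m. \<integral>\<^sup>+ t. ennreal (a m) * indicator (E m) t \<partial>count_space ?T)"
    by (rule nn_integral_suminf) simp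
  also have "\<dots> = (\<Sum>m. ennreal (a m) * emeasure (count_space ?T) (E m))"
    by (subst nn_integral_cmult_indicator) (auto simp: E_def)
  also have "\<dots> \<le> (\<Sum>m. ennreal ((real CARD('p) powr (real CARD('n) - \<alpha>)) ^ m) * ennreal (gamma z powr (- (\<alpha> - 1))))"
  proof (rule suminf_le)
    fix m
    have "ennreal (a m) * emeasure (count_space ?T) (E m) \<le>
        ennreal (a m) * ennreal (gamma z * real CARD('p) ^ (m * CARD('n)))"
      unfolding E_def by (intro mult_left_mono count_column_reps_le) simp
    also have "\<dots> = ennreal (a m * (gamma z * real CARD('p) ^ (m * CARD('n))))"
      by (rule ennreal_mult[symmetric]) (auto simp: a0 less_imp_le)
    also have "a m * (gamma z * real CARD('p) ^ (m * CARD('n))) =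
        (real CARD('p) powr (real CARD('n) - \<alpha>)) ^ m * gamma z powr (- (\<alpha> - 1))"
    proof -
      have "gamma z powr (- (\<alpha> - 1)) = gamma z powr (- \<alpha>) * gamma z powr 1"
        by (subst powr_add[symmetric]) simp
      moreover have "real CARD('p) powr (real CARD('n) - \<alpha>) = real CARD('p) powr (- \<alpha>) * real CARD('p) ^ CARD('n)"
        using p0 by (subst powr_realpow[symmetric]) (auto simp flip: powr_add)
      ultimately show ?thesis
        using gamma_pos[of z] by (simp add: a_def power_mult_distrib less_imp_le mult_ac flip: power_mult)
    qed
    finally show "ennreal (a m) * emeasure (count_space ?T) (E m) \<le>
        ennreal ((real CARD('p) powr (real CARD('n) - \<alpha>)) ^ m) * ennreal (gamma z powr (- (\<alpha> - 1)))"
      by (simp add: ennreal_mult)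
  qed auto
  also have "\<dots> = (\<Sum>m. ennreal ((real CARD('p) powr (real CARD('n) - \<alpha>)) ^ m)) * ennreal (gamma z powr (- (\<alpha> - 1)))"
    by (rule ennreal_suminf_multc)
  finally show ?thesis .
qed

text \<open>The larger domain is covered by the countably many translates of
  \<open>integral_off S\<close> by column representatives. Translation invariance and Tonelli with
  counting measure bring the sum over representatives inside, where the pointwise bound
  applies.\<close>

lemma nn_integral_gamma_integral_off_insert:
  fixes j :: 'n and \<alpha> :: real
  assumes j: "j \<notin> S" and \<alpha>: "\<alpha> > 0"
  shows "(\<integral>\<^sup>+ z. ennreal (gamma z powr (- \<alpha>)) * indicator (integral_off (insert j S)) z \<partial>vol) \<le>
    (\<Sum>m. ennreal ((real CARD('p) powr (real CARD('n) - \<alpha>)) ^ m)) *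
    (\<integral>\<^sup>+ z. ennreal (gamma z powr (- (\<alpha> - 1))) * indicator (integral_off S) z \<partial>vol)"
proof -
  let ?T = "column_reps j :: ('p padic ^ 'n ^ 'n) set"
  let ?f = "\<lambda>z :: 'p padic ^ 'n ^ 'n. ennreal (gamma z powr (- \<alpha>))"
  let ?C = "\<Sum>m. ennreal ((real CARD('p) powr (real CARD('n) - \<alpha>)) ^ m)"
  have [measurable]: "(\<lambda>z. z - t) \<in> borel_measurable vol" "(\<lambda>z. t + z) \<in> borel_measurable vol" for t
    using measurable_translate[of t] measurable_translate[of "- t"] by (simp_all add: add.commute)
  have "(\<integral>\<^sup>+ z. ?f z * indicator (integral_off (insert j S)) z \<partial>vol) \<le>
      (\<integral>\<^sup>+ z. (\<integral>\<^sup>+ t. ?f z * indicator (integral_off S) (z - t) \<partial>count_space ?T) \<partial>vol)"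
  proof (rule nn_integral_mono)
    fix z :: "'p padic ^ 'n ^ 'n"
    show "?f z * indicator (integral_off (insert j S)) z \<le> (\<integral>\<^sup>+ t. ?f z * indicator (integral_off S) (z - t) \<partial>count_space ?T)"
    proof (cases "z \<in> integral_off (insert j S)")
      case True
      then obtain t where t: "t \<in> ?T" "z - t \<in> integral_off S" by (rule integral_off_insert)
      then have "?f z * indicator (integral_off (insert j S)) z = ?f z * indicator (integral_off S) (z - t)"
        using True by simp
      also have "\<dots> \<le> (\<integral>\<^sup>+ t. ?f z * indicator (integral_off S) (z - t) \<partial>count_space ?T)"
        by (rule nn_integral_count_space_ge[OF t(1)])
      finally show ?thesis .
    qed simp
  qed
  also have "\<dots> = (\<integral>\<^sup>+ t. (\<integral>\<^sup>+ z. ?f z * indicator (integral_off S) (z - t) \<partial>vol) \<partial>count_space ?T)"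
    by (rule nn_integral_count_space_nn_integral[OF countable_column_reps]) measurable
  also have "\<dots> = (\<integral>\<^sup>+ t. (\<integral>\<^sup>+ z. ?f (t + z) * indicator (integral_off S) z \<partial>vol) \<partial>count_space ?T)"
  proof (rule nn_integral_cong)
    fix t
    show "(\<integral>\<^sup>+ z. ?f z * indicator (integral_off S) (z - t) \<partial>vol) = (\<integral>\<^sup>+ z. ?f (t + z) * indicator (integral_off S) z \<partial>vol)"
      by (subst nn_integral_vol_translate[of _ t, symmetric]) simp_all
  qed
  also have "\<dots> = (\<integral>\<^sup>+ z. (\<integral>\<^sup>+ t. ?f (t + z) * indicator (integral_off S) z \<partial>count_space ?T) \<partial>vol)"
    by (rule nn_integral_count_space_nn_integral[OF countable_column_reps, symmetric]) measurable
  also have "\<dots> \<le> (\<integral>\<^sup>+ z. ?C * (ennreal (gamma z powr (- (\<alpha> - 1))) * indicator (integral_off S) z) \<partial>vol)"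
  proof (rule nn_integral_mono)
    fix z :: "'p padic ^ 'n ^ 'n"
    show "(\<integral>\<^sup>+ t. ?f (t + z) * indicator (integral_off S) z \<partial>count_space ?T) \<le>
        ?C * (ennreal (gamma z powr (- (\<alpha> - 1))) * indicator (integral_off S) z)"
    proof (cases "z \<in> integral_off S")
      case True
      have "(\<integral>\<^sup>+ t. ?f (t + z) \<partial>count_space ?T) \<le> ?C * ennreal (gamma z powr (- (\<alpha> - 1)))"
        by (rule gamma_column_sum_le[OF _ \<alpha>]) (use True j in \<open>simp add: integral_off_def\<close>)
      moreover have "indicator (integral_off S) z = (1 :: ennreal)" using True by (rule indicator_simps(1))
      ultimately show ?thesis by (simp only: mult_1_right)
    qed simp
  qed
  also have "\<dots> = ?C * (\<integral>\<^sup>+ z. ennreal (gamma z powr (- (\<alpha> - 1))) * indicator (integral_off S) z \<partial>vol)"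
    by (rule nn_integral_cmult) measurable
  finally show ?thesis .
qed

text \<open>Each released column needs its current exponent above n and passes on the exponent
  lowered by one; the last of \<open>card S\<close> columns sees alpha - card S + 1, whence the
  bound.\<close>

lemma nn_integral_gamma_integral_off_finite:
  fixes S :: "'n set"
  assumes "finite S" "\<alpha> > real CARD('n) + real (card S) - 1"
  shows "(\<integral>\<^sup>+ z. ennreal (gamma z powr (- \<alpha>)) * indicator (integral_off S) z \<partial>vol) < \<infinity>"
  using assms
proof (induction S arbitrary: \<alpha>)
  case empty
  have "integral_off {} = mideal 0" by (auto simp: integral_off_def mideal_def)
  then have "(\<integral>\<^sup>+ z. ennreal (gamma z powr (- \<alpha>)) * indicator (integral_off {}) z \<partial>vol) =
      (\<integral>\<^sup>+ z. indicator (mideal 0) z \<partial>vol)"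
    by (intro nn_integral_cong) (auto simp: gamma_integral split: split_indicator)
  then show ?case by (simp add: nn_integral_indicator)
next
  case (insert j S)
  have \<alpha>: "\<alpha> > real CARD('n)" "\<alpha> - 1 > real CARD('n) + real (card S) - 1"
    using insert.prems insert.hyps by auto
  let ?q = "real CARD('p) powr (real CARD('n) - \<alpha>)"
  have "?q < 1" using \<alpha>(1) CARD_gt_1[where 'p='p] by (intro powr_less_one) auto
  then have "(\<Sum>m. ennreal (?q ^ m)) = ennreal (\<Sum>m. ?q ^ m)"
    by (intro suminf_ennreal2 summable_geometric) auto
  then have "(\<Sum>m. ennreal (?q ^ m)) * (\<integral>\<^sup>+ z. ennreal (gamma z powr (- (\<alpha> - 1))) * indicator (integral_off S) z \<partial>vol) < \<infinity>"
    using insert.IH[OF \<alpha>(2)] by (simp add: ennreal_mult_less_top)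
  moreover have "\<alpha> > 0" using \<alpha>(1) by (meson less_trans of_nat_0_less_iff zero_less_card_finite)
  ultimately show ?case
    using nn_integral_gamma_integral_off_insert[OF insert.hyps(2)] by (meson le_less_trans)
qed

lemma hua_const_finite:
  assumes "\<alpha> > 2 * real CARD('n) - 1"
  shows "hua_const vol \<alpha> < \<infinity>"
proof -
  have "integral_off UNIV = (UNIV :: ('p padic ^ 'n ^ 'n) set)" by (simp add: integral_off_def)
  then show ?thesis
    using nn_integral_gamma_integral_off_finite[of UNIV \<alpha>] assms by (simp add: hua_const_def)
qed

lemma prob_space_hua_measure:
  assumes "s > -1"
  shows "prob_space (hua_measure vol s)"
proof
  let ?c = "hua_const vol (s + 2 * real CARD('n))"
  have c: "?c \<noteq> 0" "?c \<noteq> \<infinity>"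
    using hua_const_ge_1[of "s + 2 * real CARD('n)"] hua_const_finite[of "s + 2 * real CARD('n)"] assms by auto
  have "emeasure (hua_measure vol s) UNIV = (\<integral>\<^sup>+ z. inverse ?c * ennreal (gamma z powr (- s - 2 * real CARD('n))) \<partial>vol)"
    unfolding hua_measure_def by (subst emeasure_density) auto
  also have "\<dots> = inverse ?c * (\<integral>\<^sup>+ z. ennreal (gamma z powr (- s - 2 * real CARD('n))) \<partial>vol)"
    by (rule nn_integral_cmult) measurable
  also have "(\<integral>\<^sup>+ z. ennreal (gamma z powr (- s - 2 * real CARD('n))) \<partial>vol) = ?c"
    by (simp add: hua_const_def)
  also have "inverse ?c * ?c = 1"
    using c by (simp add: mult.commute[of "inverse ?c"] less_top flip: divide_ennreal_def)
  finally show "emeasure (hua_measure vol s) (space (hua_measure vol s)) = 1" by simp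
qed

end

section \<open>Uniqueness\<close>

text \<open>Since 0*g = a^(-1) b, the diagonal matrix has to be written as such a quotient with
  integral blocks. A fractional entry p^(-m) becomes 1 / p^m and an integral entry x becomes x /
  1.\<close>

lemma orbit_of_0:
  fixes z :: "'p::prime_type padic ^ 'n ^ 'n"
  obtains a b c d where "block_matrix a b c d \<in> GL_integral" "det a \<noteq> 0" "linear_fractional a b c d 0 = z"
proof -
  obtain P Q k where z: "P \<in> GL_integral" "Q \<in> GL_integral" "z = P ** diag_powers k ** Q"
    by (rule smith_normal_form)
  define dm where "dm f = (\<chi> i j. if i = j then f i else 0)" for f :: "'n \<Rightarrow> 'p padic"
  have dm: "dm f ** X = (\<chi> i j. f i * X $ i $ j)" for f and X :: "'p padic ^ 'n ^ 'n"
    by (simp add: vec_eq_iff diagonal_mult_nth dm_def)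
  let ?pos = "\<lambda>i. pos_exponent k i > 0"
  \<comment> \<open>For each index a 2 x 2 matrix with rows (e, f) and (g, h) of determinant 1:
    (p^m, 1; -1, 0) for a positive exponent m, and (1, x; 0, 1) for an integral entry x. Its inverse
    has rows (h, -f) and (-g, e).\<close>
  define e f g h :: "'n \<Rightarrow> 'p padic" where "e i = (if ?pos i then unif powi pos_exponent k i else 1)"
    and "f i = (if ?pos i then 1 else diag_entry k i)" and "g i = (if ?pos i then - 1 else 0)"
    and "h i = (if ?pos i then 0 else 1)" for i
  have I: "{dm e, dm f, dm g, dm h, dm (\<lambda>i. - f i), dm (\<lambda>i. - g i)} \<subseteq> mideal 0"
  proof -
    have "f i \<in> pideal 0" for i
    proof (cases "?pos i")
      case False
      then have "pos_exponent k i = 0" using pos_exponent_nonneg[of k i] by linarith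
      then show ?thesis using diag_entry_in_pideal[of k i] by (simp add: f_def)
    qed (simp add: f_def)
    moreover have "e i \<in> pideal 0" for i
      by (auto simp: e_def intro: pideal_mono[OF unif_powi_in_pideal])
    ultimately show ?thesis by (auto simp: dm_def mideal_def g_def h_def)
  qed
  have "block_inverses (dm e) (dm f) (dm g) (dm h) (dm h) (dm (\<lambda>i. - f i)) (dm (\<lambda>i. - g i)) (dm e)"
    unfolding block_inverses_def dm
    using I by (auto simp: vec_eq_iff mat_def dm_def e_def f_def g_def h_def)
  then have "block_matrix (dm e) (dm f) (dm g) (dm h) \<in> GL_integral"
    unfolding block_matrix_in_GL_integral_iff by blast
  \<comment> \<open>This right factor turns 0*g from e^(-1) f into P e^(-1) f Q, inserting the outer
    factors of the Smith form.\<close>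
  moreover have "block_matrix (matrix_inv P) 0 0 Q \<in> GL_integral"
    unfolding block_matrix_in_GL_integral_iff
    using GL_integral_D[OF z(1)] GL_integral_D[OF z(2)] GL_integral_D(1)[OF GL_integral_D(4)[OF z(1)]]
      GL_integral_D(1)[OF GL_integral_D(4)[OF z(2)]]
    by (intro exI[of _ P] exI[of _ "matrix_inv Q"] exI[of _ 0]) (simp add: block_inverses_def)
  ultimately have g: "block_matrix (dm e ** matrix_inv P) (dm f ** Q) (dm g ** matrix_inv P) (dm h ** Q) \<in> GL_integral"
    using GL_integral_mult by (fastforce simp: block_matrix_mult)
  have "det (dm e) \<noteq> 0"
    unfolding dm_def by (subst det_diagonal) (auto simp: e_def)
  moreover have "det (matrix_inv P) \<noteq> 0" by (rule GL_integral_D(3)[OF GL_integral_D(4)[OF z(1)]])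
  ultimately have nz: "det (dm e ** matrix_inv P) \<noteq> 0" by (simp add: det_mul)
  have ef: "e i * diag_entry k i = f i" for i
    by (cases "k i") (auto simp: e_def f_def diag_entry_def pos_exponent_def max_def power_int_minus)
  have "dm e ** diag_powers k = dm f"
    by (simp add: dm vec_eq_iff) (auto simp: dm_def diag_powers_nth' ef)
  then have "(dm e ** matrix_inv P) ** z = dm f ** Q"
    unfolding z(3) using GL_integral_D(6)[OF z(1)]
    by (metis matrix_mul_assoc matrix_mul_rid)
  then have "linear_fractional (dm e ** matrix_inv P) (dm f ** Q) (dm g ** matrix_inv P) (dm h ** Q) 0 = z"
    by (intro linear_fractional_eqI) (use nz in simp_all)
  then show ?thesis using that[OF g nz] by blast
qed

text \<open>The block matrix (1, x; 0, 1) acts as translation by \<open>x\<close>, and its factor is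
  a power of |det 1| = 1.\<close>

lemma transforms_with_translate:
  fixes \<nu> :: "('p::prime_type padic ^ 'n ^ 'n) measure"
  assumes sets: "sets \<nu> = sets borel"
    and \<nu>: "\<And>a b c d. block_matrix a b c d \<in> GL_integral \<Longrightarrow>
      transforms_with \<nu> a b c d (\<lambda>z. padic_norm (det (a + z ** c)) powr s)"
    and x: "x \<in> mideal 0" and B: "B \<in> sets borel"
  shows "emeasure \<nu> ((\<lambda>z. x + z) ` B) = emeasure \<nu> B"
proof -
  have "block_inverses (mat 1) x 0 (mat 1) (mat 1) (- x) 0 (mat 1)"
    using x by (simp add: block_inverses_def)
  then have "block_matrix (mat 1) x 0 (mat 1) \<in> GL_integral"
    unfolding block_matrix_in_GL_integral_iff by blast
  from \<nu>[OF this] have "emeasure \<nu> (linear_fractional (mat 1) x 0 (mat 1) ` B) = (\<integral>\<^sup>+ z\<in>B. 1 \<partial>\<nu>)"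
    using B by (simp add: transforms_with_def)
  moreover have "linear_fractional (mat 1) x 0 (mat 1) z = x + z" for z
    by (rule linear_fractional_eqI) simp_all
  ultimately show ?thesis using B sets by (simp add: nn_integral_indicator)
qed

text \<open>The goal is the symmetric equation \<open>y\<close> times nu = \<open>x\<close> times
  mu. It is proved on balls in Mat(n, O), then for their Borel subsets, then near every point
  through the action, then globally.\<close>

lemma transforms_with_unique:
  fixes \<mu> \<nu> :: "('p::prime_type padic ^ 'n ^ 'n) measure"
  assumes sets: "sets \<mu> = sets borel" "sets \<nu> = sets borel" and prob: "prob_space \<mu>" "prob_space \<nu>"
    and \<mu>: "\<And>a b c d. block_matrix a b c d \<in> GL_integral \<Longrightarrow>
      transforms_with \<mu> a b c d (\<lambda>z. padic_norm (det (a + z ** c)) powr s)"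
    and \<nu>: "\<And>a b c d. block_matrix a b c d \<in> GL_integral \<Longrightarrow>
      transforms_with \<nu> a b c d (\<lambda>z. padic_norm (det (a + z ** c)) powr s)"
    and pos: "emeasure \<mu> (mideal 0) \<noteq> 0"
  shows "\<nu> = \<mu>"
proof -
  interpret \<mu>: prob_space \<mu> by fact
  interpret \<nu>: prob_space \<nu> by fact
  define x where "x = emeasure \<nu> (mideal 0)"
  define y where "y = emeasure \<mu> (mideal 0)"
  have xy: "x \<noteq> \<infinity>" "y \<noteq> \<infinity>" by (simp_all add: x_def y_def)
  have sp: "space \<mu> = UNIV" "space \<nu> = UNIV" using sets_eq_imp_space_eq[OF sets(1)] sets_eq_imp_space_eq[OF sets(2)] by simp_all
  let ?M = "scale_measure y \<nu>" and ?N = "scale_measure x \<mu>"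
  have finM: "emeasure ?M B \<noteq> \<infinity>" for B
    using xy \<nu>.emeasure_finite[of B] by (simp add: ennreal_mult_eq_top_iff)
  obtain D :: "('p padic ^ 'n ^ 'n) set" where D: "countable D" "\<And>z k. \<exists>d\<in>D. d \<in> mball z k"
    by (rule countable_dense_matrices) blast
  have sub: "mball z k \<subseteq> mideal 0" if "z \<in> mideal 0" for z :: "'p padic ^ 'n ^ 'n" and k
    using mball_sub[of z 0 0 k] that by (simp add: mball_0)
  have ball: "emeasure ?M (mball z k) = emeasure ?N (mball z k)" if z: "z \<in> mideal 0" for z k
  proof -
    define \<Q> where "\<Q> = (\<lambda>w. mball w k) ` (mideal 0 :: ('p padic ^ 'n ^ 'n) set)"
    have "\<Q> \<subseteq> (\<lambda>w. mball w k) ` D"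
    proof
      fix X assume "X \<in> \<Q>"
      then obtain w where w: "X = mball w k" by (auto simp: \<Q>_def)
      obtain d where "d \<in> D" "d \<in> mball w k" using D(2) by blast
      then show "X \<in> (\<lambda>w. mball w k) ` D" using mball_eq[of d w k] w by (intro image_eqI[of _ _ d]) simp_all
    qed
    then have cQ: "countable \<Q>" by (rule countable_subset) (intro countable_image D(1))
    have UQ: "\<Union>\<Q> = mideal 0"
      unfolding \<Q>_def using mball_center sub by blast
    have disj: "disjoint_family_on (\<lambda>X. X) \<Q>"
      unfolding disjoint_family_on_def
    proof (intro ballI impI)
      fix X Y assume XY: "X \<in> \<Q>" "Y \<in> \<Q>" "X \<noteq> Y"
      then obtain v w where "X = mball v k" "Y = mball w k" by (auto simp: \<Q>_def)
      then show "X \<inter> Y = {}" using XY(3) mball_eq by blast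
    qed
    \<comment> \<open>The number of balls of radius p^(-k) in Mat(n, O), the same for both measures.
      Invariance gives mass(Mat(n, O)) = kappa mass(ball) for each; multiplying the two equations
      crosswise gives the claim.\<close>
    define \<kappa> where "\<kappa> = emeasure (count_space \<Q>) \<Q>"
    have *: "emeasure M (mideal 0) = emeasure M (mball z k) * \<kappa>"
      if sM: "sets M = sets borel" and M: "\<And>a b c d. block_matrix a b c d \<in> GL_integral \<Longrightarrow>
        transforms_with M a b c d (\<lambda>z. padic_norm (det (a + z ** c)) powr s)"
      for M :: "('p padic ^ 'n ^ 'n) measure"
    proof -
      have m: "emeasure M (mball w k) = emeasure M (mideal (int k))" if "w \<in> mideal 0" for w
        unfolding mball_eq_image by (rule transforms_with_translate[OF sM M that]) simp_all
      have "emeasure M (mideal 0) = emeasure M (\<Union>((\<lambda>X. X) ` \<Q>))" by (simp add: UQ)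
      also have "\<dots> = (\<integral>\<^sup>+ X. emeasure M X \<partial>count_space \<Q>)"
        by (rule emeasure_UN_countable[OF _ cQ disj]) (auto simp: \<Q>_def sM)
      also have "\<dots> = (\<integral>\<^sup>+ X. emeasure M (mball z k) \<partial>count_space \<Q>)"
        by (intro nn_integral_cong) (use m z in \<open>auto simp: \<Q>_def\<close>)
      also have "\<dots> = emeasure M (mball z k) * \<kappa>" by (simp add: \<kappa>_def)
      finally show ?thesis .
    qed
    show ?thesis
      using *[OF sets(1) \<mu>] *[OF sets(2) \<nu>] by (simp add: x_def y_def mult_ac)
  qed
  have integral: "emeasure ?M B = emeasure ?N B" if "B \<in> sets borel" "B \<subseteq> mideal 0" for B
  proof (rule emeasure_eq_on_good_balls[where U = "mideal 0" and good = "\<lambda>z k. z \<in> mideal 0"])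
    show "mball z k \<subseteq> mideal 0" if "z \<in> mideal 0" for z :: "'p padic ^ 'n ^ 'n" and k
      by (rule sub[OF that])
    show "w \<in> mideal 0" if "z \<in> mideal 0" "w \<in> mball z k" for z w :: "'p padic ^ 'n ^ 'n" and k
      using sub that by blast
    show "emeasure ?M (mball z k) \<noteq> \<infinity>" for z k by (rule finM)
    show "emeasure ?M (mball z k) = emeasure ?N (mball z k)" if "z \<in> mideal 0" for z k by (rule ball[OF that])
  qed (use that ball finM sets in auto)
  \<comment> \<open>With z = 0*g, small Borel sets near z are images of sets near 0 inside Mat(n,
    O), on which |det(a + x c)| is the constant |det a|. Both measures therefore pick up the same
    factor, and equality is transported from 0 to z.\<close>
  have near: "\<exists>k. \<forall>B\<in>sets borel. B \<subseteq> mball z k \<longrightarrow> emeasure ?M B = emeasure ?N B" for z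
  proof -
    obtain a b c d where g: "block_matrix a b c d \<in> GL_integral" "det a \<noteq> 0" "linear_fractional a b c d 0 = z"
      by (rule orbit_of_0)
    obtain a' b' c' d' where g': "block_inverses a b c d a' b' c' d'"
      using g(1) unfolding block_matrix_in_GL_integral_iff by blast
    let ?f = "linear_fractional a b c d" and ?f' = "linear_fractional a' b' c' d'"
    obtain k where k: "lf_ball a c 0 k" using lf_ball_exists[of a 0 c 0] g(2) by auto
    let ?V = "{w. det (a' + w ** c') \<noteq> 0 \<and> ?f' w \<in> mball 0 k}"
    have "open ?V" by (rule open_linear_fractional_vimage[OF open_mball])
    moreover have "z \<in> ?V" using linear_fractional_inverse(2,3)[OF g', of 0 z] g by simp
    ultimately obtain l where l: "mball z l \<subseteq> ?V" unfolding open_matrix_iff by blast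
    have "emeasure ?M B = emeasure ?N B" if B: "B \<in> sets borel" "B \<subseteq> mball z l" for B
    proof -
      define S where "S = {x. det (a + x ** c) \<noteq> 0 \<and> ?f x \<in> B}"
      have inv: "det (a + ?f' w ** c) \<noteq> 0" "?f (?f' w) = w" "?f' w \<in> mball 0 k" if "w \<in> B" for w
        using linear_fractional_inverse(2,3)[OF block_inverses_sym[OF g'] _ refl, of w] that B(2) l by auto
      have S_sub: "S \<subseteq> mball 0 k"
      proof
        fix x assume "x \<in> S"
        then have "?f' (?f x) = x" "?f x \<in> B"
          using linear_fractional_inverse(3)[OF g' _ refl, of x] by (auto simp: S_def)
        then show "x \<in> mball 0 k" using inv(3) by metis
      qed
      have "S \<in> sets borel"
      proof -
        let ?F = "\<lambda>z. if det (a + z ** c) \<noteq> 0 then ?f z else 0"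
        have "open {x. det (a + x ** c) \<noteq> 0}" using open_linear_fractional_vimage[of UNIV a c] by simp
        then have "{x. det (a + x ** c) \<noteq> 0} \<in> sets borel" by simp
        moreover have "?F -` B \<in> sets borel" using measurable_sets[OF measurable_linear_fractional B(1)] by simp
        ultimately have "?F -` B \<inter> {x. det (a + x ** c) \<noteq> 0} \<in> sets borel" by (rule sets.Int[rotated])
        also have "?F -` B \<inter> {x. det (a + x ** c) \<noteq> 0} = S" by (auto simp: S_def)
        finally show ?thesis .
      qed
      have fS: "?f ` S = B" using inv by (auto simp: S_def image_iff) metis
      have int: "S \<subseteq> mideal 0" using S_sub mideal_mono[of _ "int k" 0] by (auto simp: mball_0)
      have *: "emeasure M B = ennreal (padic_norm (det a) powr s) * emeasure M S"
        if sM: "sets M = sets borel" and M: "\<And>a b c d. block_matrix a b c d \<in> GL_integral \<Longrightarrow>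
          transforms_with M a b c d (\<lambda>z. padic_norm (det (a + z ** c)) powr s)"
        for M :: "('p padic ^ 'n ^ 'n) measure"
      proof -
        have "S \<subseteq> {x. det (a + x ** c) \<noteq> 0}" by (auto simp: S_def)
        then have "emeasure M (?f ` S) = (\<integral>\<^sup>+ x\<in>S. ennreal (padic_norm (det (a + x ** c)) powr s) \<partial>M)"
          using M[OF g(1)] \<open>S \<in> sets borel\<close> by (auto simp: transforms_with_def)
        also have "\<dots> = (\<integral>\<^sup>+ x\<in>S. ennreal (padic_norm (det a) powr s) \<partial>M)"
        proof (rule nn_integral_cong)
          fix x
          show "ennreal (padic_norm (det (a + x ** c)) powr s) * indicator S x =
              ennreal (padic_norm (det a) powr s) * indicator S x"
          proof (cases "x \<in> S")
            case True
            then have "padic_norm (det (a + x ** c)) = padic_norm (det (a + 0 ** c))"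
              using S_sub by (intro lf_ball_hereditary(2)[OF k _ order_refl]) blast
            then show ?thesis by simp
          qed simp
        qed
        also have "\<dots> = ennreal (padic_norm (det a) powr s) * emeasure M S"
          using \<open>S \<in> sets borel\<close> by (simp add: nn_integral_cmult_indicator sM)
        finally show ?thesis by (simp add: fS)
      qed
      show ?thesis
        using *[OF sets(1) \<mu>] *[OF sets(2) \<nu>] integral[OF \<open>S \<in> sets borel\<close> int] 
        by (simp add: mult.left_commute[of x "ennreal _"] mult.left_commute[of y "ennreal _"])
    qed
    then show ?thesis by blast
  qed
  have all: "emeasure ?M B = emeasure ?N B" if "B \<in> sets borel" for B
  proof (rule emeasure_eq_on_good_balls[where U = UNIV
        and good = "\<lambda>z k. \<forall>B\<in>sets borel. B \<subseteq> mball z k \<longrightarrow> emeasure ?M B = emeasure ?N B"])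
    show "\<forall>B\<in>sets borel. B \<subseteq> mball w l \<longrightarrow> emeasure ?M B = emeasure ?N B"
      if z: "\<forall>B\<in>sets borel. B \<subseteq> mball z k \<longrightarrow> emeasure ?M B = emeasure ?N B"
        and w: "w \<in> mball z k" "k \<le> l" for z k w l
    proof (intro ballI impI)
      fix C assume "C \<in> sets borel" "C \<subseteq> mball w l"
      then show "emeasure ?M C = emeasure ?N C" using z mball_sub[OF w] by (meson subset_trans)
    qed
    show "\<exists>k. \<forall>B\<in>sets borel. B \<subseteq> mball z k \<longrightarrow> emeasure ?M B = emeasure ?N B" for z by (rule near)
    show "emeasure ?M (mball z k) \<noteq> \<infinity>" for z k by (rule finM)
  qed (use that sets in auto)
  \<comment> \<open>Evaluating on the whole space, where both probability measures give 1.\<close>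
  have "y = x"
    using all[of UNIV] \<mu>.emeasure_space_1 \<nu>.emeasure_space_1 by (simp add: sp)
  moreover have "y \<noteq> 0" using pos by (simp add: y_def)
  ultimately have "emeasure \<nu> B = emeasure \<mu> B" if "B \<in> sets borel" for B
    using all[OF that] xy by (simp add: ennreal_mult_cancel_left)
  then show ?thesis using sets by (intro measure_eqI) auto
qed

theorem theorem1p2:
  fixes vol :: "('p::prime_type padic ^ 'n::finite ^ 'n) measure" and s :: real
  assumes "is_normalized_haar vol" and "s > -1"
  shows
    "(\<forall>a b c d. block_matrix a b c d \<in> GL_integral \<longrightarrow>
        transforms_with (hua_measure vol s) a b c d (\<lambda>z. padic_norm (det (a + z ** c)) powr s))
     \<and>
     (\<forall>\<nu> :: ('p padic ^ 'n ^ 'n) measure.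
        (sets \<nu> = sets borel \<and> prob_space \<nu> \<and>
         (\<forall>a b c d. block_matrix a b c d \<in> GL_integral \<longrightarrow>
            transforms_with \<nu> a b c d (\<lambda>z. padic_norm (det (a + z ** c)) powr s)))
        \<longleftrightarrow> \<nu> = hua_measure vol s)"
proof -
  interpret padic_haar vol by unfold_locales (rule assms(1))
  have a: "transforms_with (hua_measure vol s) a b c d (\<lambda>z. padic_norm (det (a + z ** c)) powr s)"
    if "block_matrix a b c d \<in> GL_integral" for a b c d :: "'p padic ^ 'n ^ 'n"
    using that hua_measure_transforms unfolding block_matrix_in_GL_integral_iff by blast
  have prob: "prob_space (hua_measure vol s)" by (rule prob_space_hua_measure[OF assms(2)])
  \<comment> \<open>An infinite constant would have reciprocal 0 and make the measure vanish;
    finiteness is what gives Mat(n, O) positive mass.\<close>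
  have "hua_const vol (s + 2 * real CARD('n)) < \<infinity>" using assms(2) by (intro hua_const_finite) simp
  then have pos: "emeasure (hua_measure vol s) (mideal 0) \<noteq> 0"
    by (subst emeasure_hua_measure_gamma_const[of _ 1]) (auto simp: gamma_integral)
  have "\<nu> = hua_measure vol s"
    if "sets \<nu> = sets borel" "prob_space \<nu>"
      "\<forall>a b c d. block_matrix a b c d \<in> GL_integral \<longrightarrow>
        transforms_with \<nu> a b c d (\<lambda>z. padic_norm (det (a + z ** c)) powr s)"
    for \<nu> :: "('p padic ^ 'n ^ 'n) measure"
    by (rule transforms_with_unique[OF sets_hua_measure that(1) prob that(2) a _ pos]) (use that(3) in blast)+
  then show ?thesis using a prob by auto
qed

end
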